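(* Let $\mathcal D$ be a small $K$-linear category and $C$ a $K$-coalgebra such that each $Hom_{\mathcal D}(X,Y)$ has a given right $C$-comodule structure $\rho_{XY}$, and let $\mathcal D$ be a $C$-Galois extension of a subcategory $\mathcal E$. Then there exists a unique right-right entwining structure $(\mathcal D,C,\psi)$ which makes $Hom_{\mathcal D}(-,Y)$ an object in $\mathscr M(\psi)_{\mathcal D}^C$ for every $Y\in Ob(\mathcal D)$ with its canonical $\mathcal D$-module structure and right $C$-coactions $\{\rho_{XY}\}_{X\in Ob(\mathcal D)}$.
   Context: $K$ is a field; Sweedler notation $\Delta_C(c)=c_1\otimes c_2$ and $\rho(m)=m_0\otimes m_1$ (summation omitted) is used. A right (resp. left) module over a small $K$-linear category $\mathcal D$ is a $K$-linear functor $\mathcal D^{op}\to \mathrm{Vect}_K$ (resp. $\mathcal D\to\mathrm{Vect}_K$). Write $\mathbf h_Y=Hom_{\mathcal D}(-,Y)$ and ${}_X\mathbf h=Hom_{\mathcal D}(X,-)$. For a right $\mathcal E$-module $\mathcal M$ and a left $\mathcal E$-module $\mathcal N$, $\mathcal M\otimes_{\mathcal E}\mathcal N$ is the quotient of $\bigoplus_{Z}\mathcal M(Z)\otimes\mathcal N(Z)$ by the relations $\mathcal M(f)(m)\otimes n=m\otimes\mathcal N(f)(n)$. A (right-right) entwining structure $(\mathcal D,C,\psi)$ consists of $K$-linear maps $\psi_{XY}:C\otimes Hom_{\mathcal D}(X,Y)\to Hom_{\mathcal D}(X,Y)\otimes C$ for $X,Y\in Ob(\mathcal D)$, written $\psi_{XY}(c\otimes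 f)=f_\psi\otimes c^\psi$ (summation omitted; $\psi'$ denotes a second application of $\psi$), such that for $f\in Hom_{\mathcal D}(X,Y)$, $g\in Hom_{\mathcal D}(Y,Z)$, $c\in C$: $(gf)_\psi\otimes c^\psi=g_\psi f_{\psi'}\otimes (c^{\psi})^{\psi'}$; $\ \varepsilon_C(c^\psi)f_\psi=\varepsilon_C(c)f$; $\ f_\psi\otimes\Delta_C(c^\psi)=(f_\psi)_{\psi'}\otimes (c_1)^{\psi'}\otimes (c_2)^\psi$; $\ \psi_{XX}(c\otimes \mathrm{id}_X)=\mathrm{id}_X\otimes c$. An entwined module is a right $\mathcal D$-module $\mathcal M$ with a right $C$-comodule structure on each $\mathcal M(Y)$ such that $(\mathcal M(f)(m))_0\otimes(\mathcal M(f)(m))_1=\mathcal M(f_\psi)(m_0)\otimes (m_1)^\psi$ for $f\in Hom_{\mathcal D}(Y,X)$, $m\in\mathcal M(X)$; with objectwise $C$-colinear $\mathcal D$-module morphisms these form the category $\mathscr M(\psi)_{\mathcal D}^C$. ${}_{\mathcal D}\mathscr M^C$ is the category of left $\mathcal D$-modules $\mathcal M$ with a right $C$-comodule structure on each $\mathcal M(X)$ such that every $\mathcal M(f)$ is $C$-colinear; morphisms are objectwise $C$-colinear $\mathcal D$-module morphisms. Given comodule structures $\rho_{XY}:Hom_{\mathcal D}(X,Y)\to Hom_{\mathcal D}(X,Y)\otimes C$, $f\mapsto f_0\otimes f_1$ (not assumed compatible with composition), the subcategory $\mathcal E\subseteq\mathcal D$ of $C$-coinvariants has $Ob(\mathcal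 E)=Ob(\mathcal D)$ and $Hom_{\mathcal E}(X,Y)=\{g\in Hom_{\mathcal D}(X,Y)\mid \rho_{ZY}(gf)=gf_0\otimes f_1\ \ \forall Z,\ \forall f\in Hom_{\mathcal D}(Z,X)\}$. For each $X$, both ${}_X\mathbf h\otimes C$ (with $g\cdot(f\otimes c)=gf\otimes c$ and coaction $\mathrm{id}\otimes\Delta_C$) and $h\otimes_{\mathcal E}{}_X\mathbf h: Y\mapsto\mathbf h_Y\otimes_{\mathcal E}{}_X\mathbf h$ (with left $\mathcal D$-action by composition on the first factor and coaction $f\otimes f'\mapsto f\otimes f'_0\otimes f'_1$) are objects of ${}_{\mathcal D}\mathscr M^C$, and there is a canonical morphism $can_X:h\otimes_{\mathcal E}{}_X\mathbf h\to{}_X\mathbf h\otimes C$ in ${}_{\mathcal D}\mathscr M^C$, $can_X(Y)=can_{XY}:f\otimes f'\mapsto ff'_0\otimes f'_1$. $\mathcal D$ is a $C$-Galois extension of a $K$-linear subcategory $\mathcal E$ if $\mathcal E$ is the subcategory of $C$-coinvariants of $\mathcal D$ and $can_X$ is an isomorphism for every $X\in Ob(\mathcal D)$. *)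

theory Defs
  imports "HOL-Algebra.Module" "HOL-Algebra.AbelCoset" "HOL-Library.FuncSet"
begin

text \<open>
  Vector spaces over a field \<open>K\<close> are \<open>K\<close>-modules in the sense of the locale \<^locale>\<open>module\<close>.
  Ring multiplication and unit of the underlying record play no role and are left unspecified
  in the constructions below.
\<close>

section \<open>Linear maps, direct sums and quotients\<close>

definition lin_hom ::
  "('k, 'r) ring_scheme \<Rightarrow> ('k, 'a, 'x) module_scheme \<Rightarrow> ('k, 'b, 'y) module_scheme \<Rightarrow> ('a \<Rightarrow> 'b) set"
  where "lin_hom K M N = {h \<in> carrier M \<rightarrow> carrier N.
    (\<forall>x\<in>carrier M. \<forall>y\<in>carrier M. h (x \<oplus>\<^bsub>M\<^esub> y) = h x \<oplus>\<^bsub>N\<^esub> h y) \<and>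
    (\<forall>a\<in>carrier K. \<forall>x\<in>carrier M. h (a \<odot>\<^bsub>M\<^esub> x) = a \<odot>\<^bsub>N\<^esub> h x)}"

definition direct_sum :: "'i set \<Rightarrow> ('i \<Rightarrow> ('k, 'a, 'x) module_scheme) \<Rightarrow> ('k, 'i \<Rightarrow> 'a) module"
  where "direct_sum I M =
    \<lparr>carrier = {x \<in> (\<Pi>\<^sub>E i\<in>I. carrier (M i)). finite {i \<in> I. x i \<noteq> \<zero>\<^bsub>M i\<^esub>}},
     mult = undefined, one = undefined,
     zero = (\<lambda>i\<in>I. \<zero>\<^bsub>M i\<^esub>),
     add = (\<lambda>x y. \<lambda>i\<in>I. x i \<oplus>\<^bsub>M i\<^esub> y i),
     smult = (\<lambda>a x. \<lambda>i\<in>I. a \<odot>\<^bsub>M i\<^esub> x i)\<rparr>"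

definition direct_sum_in :: "'i set \<Rightarrow> ('i \<Rightarrow> ('k, 'a, 'x) module_scheme) \<Rightarrow> 'i \<Rightarrow> 'a \<Rightarrow> 'i \<Rightarrow> 'a"
  where "direct_sum_in I M j x = (\<lambda>i\<in>I. if i = j then x else \<zero>\<^bsub>M i\<^esub>)"

definition direct_sum_lift ::
  "'i set \<Rightarrow> ('i \<Rightarrow> ('k, 'a, 'x) module_scheme) \<Rightarrow> ('k, 'p, 'y) module_scheme \<Rightarrow>
    ('i \<Rightarrow> 'a \<Rightarrow> 'p) \<Rightarrow> ('i \<Rightarrow> 'a) \<Rightarrow> 'p"
  where "direct_sum_lift I M P h x = (\<Oplus>\<^bsub>P\<^esub>i\<in>{i \<in> I. x i \<noteq> \<zero>\<^bsub>M i\<^esub>}. h i (x i))"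

definition quot_module ::
  "('k, 'a, 'x) module_scheme \<Rightarrow> 'a set \<Rightarrow> ('k, 'a set) module"
  where "quot_module M N =
    \<lparr>carrier = a_rcosets\<^bsub>M\<^esub> N,
     mult = undefined, one = undefined,
     zero = N,
     add = (<+>\<^bsub>M\<^esub>),
     smult = (\<lambda>a X. N <+>\<^bsub>M\<^esub> ((\<lambda>x. a \<odot>\<^bsub>M\<^esub> x) ` X))\<rparr>"

text \<open>The map induced on cosets by a linear map that vanishes on the submodule.\<close>

definition quot_lift :: "('a \<Rightarrow> 'p) \<Rightarrow> 'a set \<Rightarrow> 'p"
  where "quot_lift h X = the_elem (h ` X)"

definition generated_submodule ::
  "('k, 'r) ring_scheme \<Rightarrow> ('k, 'a, 'x) module_scheme \<Rightarrow> 'a set \<Rightarrow> 'a set"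
  where "generated_submodule K M S = \<Inter>{N. submodule N K M \<and> S \<subseteq> N}"

section \<open>Tensor products over the ground field\<close>

definition scalar_module :: "('k, 'r) ring_scheme \<Rightarrow> ('k, 'k) module"
  where "scalar_module K =
    \<lparr>carrier = carrier K, mult = mult K, one = one K, zero = zero K, add = add K,
     smult = mult K\<rparr>"

definition free_module :: "('k, 'r) ring_scheme \<Rightarrow> 's set \<Rightarrow> ('k, 's \<Rightarrow> 'k) module"
  where "free_module K S = direct_sum S (\<lambda>_. scalar_module K)"

definition free_gen :: "('k, 'r) ring_scheme \<Rightarrow> 's set \<Rightarrow> 's \<Rightarrow> 's \<Rightarrow> 'k"
  where "free_gen K S s = direct_sum_in S (\<lambda>_. scalar_module K) s \<one>\<^bsub>K\<^esub>"

definition free_lift ::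
  "('k, 'r) ring_scheme \<Rightarrow> 's set \<Rightarrow> ('k, 'p, 'y) module_scheme \<Rightarrow> ('s \<Rightarrow> 'p) \<Rightarrow> ('s \<Rightarrow> 'k) \<Rightarrow> 'p"
  where "free_lift K S P b = direct_sum_lift S (\<lambda>_. scalar_module K) P (\<lambda>s a. a \<odot>\<^bsub>P\<^esub> b s)"

type_synonym ('k, 'a, 'b) tensor = "('a \<times> 'b \<Rightarrow> 'k) set"

definition tensor_rel ::
  "('k, 'r) ring_scheme \<Rightarrow> ('k, 'a, 'x) module_scheme \<Rightarrow> ('k, 'b, 'y) module_scheme \<Rightarrow>
    ('a \<times> 'b \<Rightarrow> 'k) set"
  where "tensor_rel K M N =
    (let F = free_module K (carrier M \<times> carrier N);
         e = (\<lambda>m n. free_gen K (carrier M \<times> carrier N) (m, n))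
     in generated_submodule K F
      ({e (m \<oplus>\<^bsub>M\<^esub> m') n \<ominus>\<^bsub>F\<^esub> (e m n \<oplus>\<^bsub>F\<^esub> e m' n) | m m' n.
          m \<in> carrier M \<and> m' \<in> carrier M \<and> n \<in> carrier N} \<union>
       {e m (n \<oplus>\<^bsub>N\<^esub> n') \<ominus>\<^bsub>F\<^esub> (e m n \<oplus>\<^bsub>F\<^esub> e m n') | m n n'.
          m \<in> carrier M \<and> n \<in> carrier N \<and> n' \<in> carrier N} \<union>
       {e (a \<odot>\<^bsub>M\<^esub> m) n \<ominus>\<^bsub>F\<^esub> a \<odot>\<^bsub>F\<^esub> e m n | a m n.
          a \<in> carrier K \<and> m \<in> carrier M \<and> n \<in> carrier N} \<union>
       {e m (a \<odot>\<^bsub>N\<^esub> n) \<ominus>\<^bsub>F\<^esub> a \<odot>\<^bsub>F\<^esub> e m n | a m n.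
          a \<in> carrier K \<and> m \<in> carrier M \<and> n \<in> carrier N}))"

definition tensor ::
  "('k, 'r) ring_scheme \<Rightarrow> ('k, 'a, 'x) module_scheme \<Rightarrow> ('k, 'b, 'y) module_scheme \<Rightarrow>
    ('k, ('k, 'a, 'b) tensor) module"
  where "tensor K M N =
    quot_module (free_module K (carrier M \<times> carrier N)) (tensor_rel K M N)"

definition pure_tensor ::
  "('k, 'r) ring_scheme \<Rightarrow> ('k, 'a, 'x) module_scheme \<Rightarrow> ('k, 'b, 'y) module_scheme \<Rightarrow>
    'a \<Rightarrow> 'b \<Rightarrow> ('k, 'a, 'b) tensor"
  where "pure_tensor K M N m n =
    tensor_rel K M N +>\<^bsub>free_module K (carrier M \<times> carrier N)\<^esub>
      free_gen K (carrier M \<times> carrier N) (m, n)"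

text \<open>
  For a \<open>K\<close>-bilinear \<open>b\<close> the linear map \<open>M \<otimes> N \<rightarrow> P\<close> with \<open>m \<otimes> n \<mapsto> b m n\<close>. An expression
  \<open>b m\<^sub>0 m\<^sub>1\<close> in Sweedler notation, where \<open>m\<^sub>0 \<otimes> m\<^sub>1 = t\<close>, is \<open>tensor_lift K M N P b t\<close>.
\<close>

definition tensor_lift ::
  "('k, 'r) ring_scheme \<Rightarrow> ('k, 'a, 'x) module_scheme \<Rightarrow> ('k, 'b, 'y) module_scheme \<Rightarrow>
    ('k, 'p, 'z) module_scheme \<Rightarrow> ('a \<Rightarrow> 'b \<Rightarrow> 'p) \<Rightarrow> ('k, 'a, 'b) tensor \<Rightarrow> 'p"
  where "tensor_lift K M N P b =
    quot_lift (free_lift K (carrier M \<times> carrier N) P (\<lambda>(m, n). b m n))"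

definition tensor_map ::
  "('k, 'r) ring_scheme \<Rightarrow> ('k, 'a, 'x) module_scheme \<Rightarrow> ('k, 'b, 'y) module_scheme \<Rightarrow>
    ('k, 'a2, 'x2) module_scheme \<Rightarrow> ('k, 'b2, 'y2) module_scheme \<Rightarrow>
    ('a \<Rightarrow> 'a2) \<Rightarrow> ('b \<Rightarrow> 'b2) \<Rightarrow> ('k, 'a, 'b) tensor \<Rightarrow> ('k, 'a2, 'b2) tensor"
  where "tensor_map K M N M' N' f g =
    tensor_lift K M N (tensor K M' N') (\<lambda>m n. pure_tensor K M' N' (f m) (g n))"

definition tensor_assoc ::
  "('k, 'r) ring_scheme \<Rightarrow> ('k, 'a, 'x) module_scheme \<Rightarrow> ('k, 'b, 'y) module_scheme \<Rightarrow>
    ('k, 'c, 'z) module_scheme \<Rightarrow>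
    ('k, ('k, 'a, 'b) tensor, 'c) tensor \<Rightarrow> ('k, 'a, ('k, 'b, 'c) tensor) tensor"
  where "tensor_assoc K L M N =
    tensor_lift K (tensor K L M) N (tensor K L (tensor K M N))
      (\<lambda>t n. tensor_lift K L M (tensor K L (tensor K M N))
        (\<lambda>l m. pure_tensor K L (tensor K M N) l (pure_tensor K M N m n)) t)"

section \<open>Coalgebras and comodules\<close>

record ('k, 'c) coalgebra = "('k, 'c) module" +
  comult :: "'c \<Rightarrow> ('k, 'c, 'c) tensor"
  counit :: "'c \<Rightarrow> 'k"

locale coalgebra = module K C
  for K :: "('k, 'r) ring_scheme" and C :: "('k, 'c, 'x) coalgebra_scheme" +
  assumes comult_lin: "comult C \<in> lin_hom K C (tensor K C C)"
    and counit_lin: "counit C \<in> lin_hom K C (scalar_module K)"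
    and comult_coassoc: "c \<in> carrier C \<Longrightarrow>
      tensor_assoc K C C C (tensor_map K C C (tensor K C C) C (comult C) (\<lambda>d. d) (comult C c)) =
      tensor_map K C C C (tensor K C C) (\<lambda>d. d) (comult C) (comult C c)"
    and counit_left: "c \<in> carrier C \<Longrightarrow>
      tensor_lift K C C C (\<lambda>c1 c2. counit C c1 \<odot>\<^bsub>C\<^esub> c2) (comult C c) = c"
    and counit_right: "c \<in> carrier C \<Longrightarrow>
      tensor_lift K C C C (\<lambda>c1 c2. counit C c2 \<odot>\<^bsub>C\<^esub> c1) (comult C c) = c"

locale right_comodule = module K M
  for K :: "('k, 'r) ring_scheme" and C :: "('k, 'c, 'x) coalgebra_scheme"
    and M :: "('k, 'v, 'y) module_scheme" and \<rho> :: "'v \<Rightarrow> ('k, 'v, 'c) tensor" +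
  assumes coaction_lin: "\<rho> \<in> lin_hom K M (tensor K M C)"
    and coaction_coassoc: "m \<in> carrier M \<Longrightarrow>
      tensor_assoc K M C C (tensor_map K M C (tensor K M C) C \<rho> (\<lambda>c. c) (\<rho> m)) =
      tensor_map K M C M (tensor K C C) (\<lambda>v. v) (comult C) (\<rho> m)"
    and coaction_counit: "m \<in> carrier M \<Longrightarrow>
      tensor_lift K M C M (\<lambda>m0 m1. counit C m1 \<odot>\<^bsub>M\<^esub> m0) (\<rho> m) = m"

definition colinear ::
  "('k, 'r) ring_scheme \<Rightarrow> ('k, 'c, 'x) coalgebra_scheme \<Rightarrow>
    ('k, 'v, 'y) module_scheme \<Rightarrow> ('v \<Rightarrow> ('k, 'v, 'c) tensor) \<Rightarrow>
    ('k, 'w, 'z) module_scheme \<Rightarrow> ('w \<Rightarrow> ('k, 'w, 'c) tensor) \<Rightarrow> ('v \<Rightarrow> 'w) \<Rightarrow> bool"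
  where "colinear K C M \<rho> N \<sigma> h \<longleftrightarrow>
    (\<forall>m\<in>carrier M. \<sigma> (h m) = tensor_map K M C N C h (\<lambda>c. c) (\<rho> m))"

section \<open>Small linear categories and their modules\<close>

text \<open>\<open>comp D X Y Z g f\<close> is \<open>gf\<close> for \<open>f : X \<rightarrow> Y\<close> and \<open>g : Y \<rightarrow> Z\<close>.\<close>

record ('k, 'o, 'm) lin_cat =
  Ob :: "'o set"
  Hom :: "'o \<Rightarrow> 'o \<Rightarrow> ('k, 'm) module"
  ident :: "'o \<Rightarrow> 'm"
  comp :: "'o \<Rightarrow> 'o \<Rightarrow> 'o \<Rightarrow> 'm \<Rightarrow> 'm \<Rightarrow> 'm"

locale linear_category =
  fixes K :: "('k, 'r) ring_scheme" and D :: "('k, 'o, 'm) lin_cat"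
  assumes Hom_module: "\<lbrakk>X \<in> Ob D; Y \<in> Ob D\<rbrakk> \<Longrightarrow> module K (Hom D X Y)"
    and ident_closed: "X \<in> Ob D \<Longrightarrow> ident D X \<in> carrier (Hom D X X)"
    and comp_left_lin: "\<lbrakk>X \<in> Ob D; Y \<in> Ob D; Z \<in> Ob D; g \<in> carrier (Hom D Y Z)\<rbrakk> \<Longrightarrow>
      (\<lambda>f. comp D X Y Z g f) \<in> lin_hom K (Hom D X Y) (Hom D X Z)"
    and comp_right_lin: "\<lbrakk>X \<in> Ob D; Y \<in> Ob D; Z \<in> Ob D; f \<in> carrier (Hom D X Y)\<rbrakk> \<Longrightarrow>
      (\<lambda>g. comp D X Y Z g f) \<in> lin_hom K (Hom D Y Z) (Hom D X Z)"
    and comp_ident_left: "\<lbrakk>X \<in> Ob D; Y \<in> Ob D; f \<in> carrier (Hom D X Y)\<rbrakk> \<Longrightarrow>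
      comp D X Y Y (ident D Y) f = f"
    and comp_ident_right: "\<lbrakk>X \<in> Ob D; Y \<in> Ob D; f \<in> carrier (Hom D X Y)\<rbrakk> \<Longrightarrow>
      comp D X X Y f (ident D X) = f"
    and comp_assoc: "\<lbrakk>W \<in> Ob D; X \<in> Ob D; Y \<in> Ob D; Z \<in> Ob D;
        f \<in> carrier (Hom D W X); g \<in> carrier (Hom D X Y); h \<in> carrier (Hom D Y Z)\<rbrakk> \<Longrightarrow>
      comp D W X Z (comp D X Y Z h g) f = comp D W Y Z h (comp D W X Y g f)"

definition opposite :: "('k, 'o, 'm) lin_cat \<Rightarrow> ('k, 'o, 'm) lin_cat"
  where "opposite D =
    D\<lparr>Hom := (\<lambda>X Y. Hom D Y X), comp := (\<lambda>X Y Z g f. comp D Z Y X f g)\<rparr>"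

text \<open>
  A subcategory with the same objects is given by its family \<open>E X Y\<close> of hom-sets.
\<close>

definition restrict_Hom ::
  "('k, 'o, 'm) lin_cat \<Rightarrow> ('o \<Rightarrow> 'o \<Rightarrow> 'm set) \<Rightarrow> ('k, 'o, 'm) lin_cat"
  where "restrict_Hom D E = D\<lparr>Hom := (\<lambda>X Y. (Hom D X Y)\<lparr>carrier := E X Y\<rparr>)\<rparr>"

locale linear_subcategory =
  fixes K :: "('k, 'r) ring_scheme" and D :: "('k, 'o, 'm) lin_cat"
    and E :: "'o \<Rightarrow> 'o \<Rightarrow> 'm set"
  assumes sub_Hom: "\<lbrakk>X \<in> Ob D; Y \<in> Ob D\<rbrakk> \<Longrightarrow> submodule (E X Y) K (Hom D X Y)"
    and sub_ident: "X \<in> Ob D \<Longrightarrow> ident D X \<in> E X X"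
    and sub_comp: "\<lbrakk>X \<in> Ob D; Y \<in> Ob D; Z \<in> Ob D; f \<in> E X Y; g \<in> E Y Z\<rbrakk> \<Longrightarrow>
      comp D X Y Z g f \<in> E X Z"

text \<open>
  Functors to vector spaces; \<open>mod_map M X Y f\<close> maps \<open>mod_obj M X\<close> to \<open>mod_obj M Y\<close>
  for \<open>f\<close> in \<open>Hom D X Y\<close>.
\<close>

record ('k, 'o, 'm, 'v) cat_module =
  mod_obj :: "'o \<Rightarrow> ('k, 'v) module"
  mod_map :: "'o \<Rightarrow> 'o \<Rightarrow> 'm \<Rightarrow> 'v \<Rightarrow> 'v"

locale left_cat_module =
  fixes K :: "('k, 'r) ring_scheme" and D :: "('k, 'o, 'm) lin_cat"
    and M :: "('k, 'o, 'm, 'v, 'y) cat_module_scheme"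
  assumes mod_obj_module: "X \<in> Ob D \<Longrightarrow> module K (mod_obj M X)"
    and mod_map_lin: "\<lbrakk>X \<in> Ob D; Y \<in> Ob D; f \<in> carrier (Hom D X Y)\<rbrakk> \<Longrightarrow>
      mod_map M X Y f \<in> lin_hom K (mod_obj M X) (mod_obj M Y)"
    and mod_map_lin_Hom: "\<lbrakk>X \<in> Ob D; Y \<in> Ob D; m \<in> carrier (mod_obj M X)\<rbrakk> \<Longrightarrow>
      (\<lambda>f. mod_map M X Y f m) \<in> lin_hom K (Hom D X Y) (mod_obj M Y)"
    and mod_map_ident: "\<lbrakk>X \<in> Ob D; m \<in> carrier (mod_obj M X)\<rbrakk> \<Longrightarrow>
      mod_map M X X (ident D X) m = m"
    and mod_map_comp: "\<lbrakk>X \<in> Ob D; Y \<in> Ob D; Z \<in> Ob D; f \<in> carrier (Hom D X Y);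
        g \<in> carrier (Hom D Y Z); m \<in> carrier (mod_obj M X)\<rbrakk> \<Longrightarrow>
      mod_map M X Z (comp D X Y Z g f) m = mod_map M Y Z g (mod_map M X Y f m)"

text \<open>
  For a right module, \<open>mod_map M X Y f\<close> with \<open>f\<close> in \<open>Hom D Y X\<close> maps \<open>mod_obj M X\<close> to
  \<open>mod_obj M Y\<close>.
\<close>

abbreviation right_cat_module ::
  "('k, 'r) ring_scheme \<Rightarrow> ('k, 'o, 'm) lin_cat \<Rightarrow> ('k, 'o, 'm, 'v, 'y) cat_module_scheme \<Rightarrow> bool"
  where "right_cat_module K D M \<equiv> left_cat_module K (opposite D) M"

text \<open>The representable modules \<open>Hom(-, Y)\<close> and \<open>Hom(X, -)\<close>.\<close>

definition right_hom :: "('k, 'o, 'm) lin_cat \<Rightarrow> 'o \<Rightarrow> ('k, 'o, 'm, 'm) cat_module"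
  where "right_hom D Y =
    \<lparr>mod_obj = (\<lambda>X. Hom D X Y), mod_map = (\<lambda>X Z f g. comp D Z X Y g f)\<rparr>"

definition left_hom :: "('k, 'o, 'm) lin_cat \<Rightarrow> 'o \<Rightarrow> ('k, 'o, 'm, 'm) cat_module"
  where "left_hom D X =
    \<lparr>mod_obj = (\<lambda>Y. Hom D X Y), mod_map = (\<lambda>Y Z g f. comp D X Y Z g f)\<rparr>"

section \<open>Tensor products over a linear category\<close>

type_synonym ('k, 'o, 'v, 'w) cat_tensor = "('o \<Rightarrow> ('k, 'v, 'w) tensor) set"

definition cat_tensor_sum ::
  "('k, 'r) ring_scheme \<Rightarrow> ('k, 'o, 'm) lin_cat \<Rightarrow> ('k, 'o, 'm, 'v, 'x) cat_module_scheme \<Rightarrow>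
    ('k, 'o, 'm, 'w, 'y) cat_module_scheme \<Rightarrow> ('k, 'o \<Rightarrow> ('k, 'v, 'w) tensor) module"
  where "cat_tensor_sum K E M N =
    direct_sum (Ob E) (\<lambda>Z. tensor K (mod_obj M Z) (mod_obj N Z))"

definition cat_tensor_in ::
  "('k, 'r) ring_scheme \<Rightarrow> ('k, 'o, 'm) lin_cat \<Rightarrow> ('k, 'o, 'm, 'v, 'x) cat_module_scheme \<Rightarrow>
    ('k, 'o, 'm, 'w, 'y) cat_module_scheme \<Rightarrow> 'o \<Rightarrow> 'v \<Rightarrow> 'w \<Rightarrow> 'o \<Rightarrow> ('k, 'v, 'w) tensor"
  where "cat_tensor_in K E M N Z m n =
    direct_sum_in (Ob E) (\<lambda>Z. tensor K (mod_obj M Z) (mod_obj N Z)) Z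
      (pure_tensor K (mod_obj M Z) (mod_obj N Z) m n)"

definition cat_tensor_rel ::
  "('k, 'r) ring_scheme \<Rightarrow> ('k, 'o, 'm) lin_cat \<Rightarrow> ('k, 'o, 'm, 'v, 'x) cat_module_scheme \<Rightarrow>
    ('k, 'o, 'm, 'w, 'y) cat_module_scheme \<Rightarrow> ('o \<Rightarrow> ('k, 'v, 'w) tensor) set"
  where "cat_tensor_rel K E M N =
    generated_submodule K (cat_tensor_sum K E M N)
      {cat_tensor_in K E M N Z (mod_map M W Z f m) n \<ominus>\<^bsub>cat_tensor_sum K E M N\<^esub>
       cat_tensor_in K E M N W m (mod_map N Z W f n) | Z W f m n.
         Z \<in> Ob E \<and> W \<in> Ob E \<and> f \<in> carrier (Hom E Z W) \<and>
         m \<in> carrier (mod_obj M W) \<and> n \<in> carrier (mod_obj N Z)}"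

text \<open>\<open>cat_tensor K E M N\<close> is \<open>M \<otimes>\<^sub>E N\<close> for a right module \<open>M\<close> and a left module \<open>N\<close>.\<close>

definition cat_tensor ::
  "('k, 'r) ring_scheme \<Rightarrow> ('k, 'o, 'm) lin_cat \<Rightarrow> ('k, 'o, 'm, 'v, 'x) cat_module_scheme \<Rightarrow>
    ('k, 'o, 'm, 'w, 'y) cat_module_scheme \<Rightarrow> ('k, ('k, 'o, 'v, 'w) cat_tensor) module"
  where "cat_tensor K E M N =
    quot_module (cat_tensor_sum K E M N) (cat_tensor_rel K E M N)"

definition pure_cat_tensor ::
  "('k, 'r) ring_scheme \<Rightarrow> ('k, 'o, 'm) lin_cat \<Rightarrow> ('k, 'o, 'm, 'v, 'x) cat_module_scheme \<Rightarrow>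
    ('k, 'o, 'm, 'w, 'y) cat_module_scheme \<Rightarrow> 'o \<Rightarrow> 'v \<Rightarrow> 'w \<Rightarrow> ('k, 'o, 'v, 'w) cat_tensor"
  where "pure_cat_tensor K E M N Z m n =
    cat_tensor_rel K E M N +>\<^bsub>cat_tensor_sum K E M N\<^esub> cat_tensor_in K E M N Z m n"

text \<open>
  For a family \<open>b\<close> of bilinear maps, balanced over \<open>E\<close>, the linear map \<open>M \<otimes>\<^sub>E N \<rightarrow> P\<close>
  sending \<open>m \<otimes> n\<close> in the summand at \<open>Z\<close> to \<open>b Z m n\<close>.
\<close>

definition cat_tensor_lift ::
  "('k, 'r) ring_scheme \<Rightarrow> ('k, 'o, 'm) lin_cat \<Rightarrow> ('k, 'o, 'm, 'v, 'x) cat_module_scheme \<Rightarrow>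
    ('k, 'o, 'm, 'w, 'y) cat_module_scheme \<Rightarrow> ('k, 'p, 'z) module_scheme \<Rightarrow>
    ('o \<Rightarrow> 'v \<Rightarrow> 'w \<Rightarrow> 'p) \<Rightarrow> ('k, 'o, 'v, 'w) cat_tensor \<Rightarrow> 'p"
  where "cat_tensor_lift K E M N P b =
    quot_lift (direct_sum_lift (Ob E) (\<lambda>Z. tensor K (mod_obj M Z) (mod_obj N Z)) P
      (\<lambda>Z. tensor_lift K (mod_obj M Z) (mod_obj N Z) P (b Z)))"

section \<open>Left modules with colinear action\<close>

record ('k, 'o, 'm, 'v, 'c) cat_comodule = "('k, 'o, 'm, 'v) cat_module" +
  coact :: "'o \<Rightarrow> 'v \<Rightarrow> ('k, 'v, 'c) tensor"

locale left_cat_comodule = left_cat_module K D M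
  for K :: "('k, 'r) ring_scheme" and D :: "('k, 'o, 'm) lin_cat"
    and C :: "('k, 'c, 'x) coalgebra_scheme"
    and M :: "('k, 'o, 'm, 'v, 'c) cat_comodule" +
  assumes coact_comodule: "X \<in> Ob D \<Longrightarrow> right_comodule K C (mod_obj M X) (coact M X)"
    and mod_map_colinear: "\<lbrakk>X \<in> Ob D; Y \<in> Ob D; f \<in> carrier (Hom D X Y)\<rbrakk> \<Longrightarrow>
      colinear K C (mod_obj M X) (coact M X) (mod_obj M Y) (coact M Y) (mod_map M X Y f)"

locale cat_comodule_hom =
  source: left_cat_comodule K D C M + target: left_cat_comodule K D C N
  for K :: "('k, 'r) ring_scheme" and D :: "('k, 'o, 'm) lin_cat"
    and C :: "('k, 'c, 'x) coalgebra_scheme"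
    and M :: "('k, 'o, 'm, 'v, 'c) cat_comodule"
    and N :: "('k, 'o, 'm, 'w, 'c) cat_comodule" and \<phi> :: "'o \<Rightarrow> 'v \<Rightarrow> 'w" +
  assumes hom_lin: "X \<in> Ob D \<Longrightarrow> \<phi> X \<in> lin_hom K (mod_obj M X) (mod_obj N X)"
    and hom_natural: "\<lbrakk>X \<in> Ob D; Y \<in> Ob D; f \<in> carrier (Hom D X Y);
        m \<in> carrier (mod_obj M X)\<rbrakk> \<Longrightarrow>
      \<phi> Y (mod_map M X Y f m) = mod_map N X Y f (\<phi> X m)"
    and hom_colinear: "X \<in> Ob D \<Longrightarrow>
      colinear K C (mod_obj M X) (coact M X) (mod_obj N X) (coact N X) (\<phi> X)"

definition cat_comodule_iso ::
  "('k, 'r) ring_scheme \<Rightarrow> ('k, 'o, 'm) lin_cat \<Rightarrow> ('k, 'c, 'x) coalgebra_scheme \<Rightarrow>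
    ('k, 'o, 'm, 'v, 'c) cat_comodule \<Rightarrow> ('k, 'o, 'm, 'w, 'c) cat_comodule \<Rightarrow>
    ('o \<Rightarrow> 'v \<Rightarrow> 'w) \<Rightarrow> bool"
  where "cat_comodule_iso K D C M N \<phi> \<longleftrightarrow>
    cat_comodule_hom K D C M N \<phi> \<and>
    (\<exists>\<theta>. cat_comodule_hom K D C N M \<theta> \<and>
      (\<forall>X\<in>Ob D. (\<forall>m\<in>carrier (mod_obj M X). \<theta> X (\<phi> X m) = m) \<and>
                (\<forall>n\<in>carrier (mod_obj N X). \<phi> X (\<theta> X n) = n)))"

section \<open>Coinvariants and Galois extensions\<close>

definition coinvariants ::
  "('k, 'r) ring_scheme \<Rightarrow> ('k, 'o, 'm) lin_cat \<Rightarrow> ('k, 'c, 'x) coalgebra_scheme \<Rightarrow>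
    ('o \<Rightarrow> 'o \<Rightarrow> 'm \<Rightarrow> ('k, 'm, 'c) tensor) \<Rightarrow> 'o \<Rightarrow> 'o \<Rightarrow> 'm set"
  where "coinvariants K D C \<rho> X Y = {g \<in> carrier (Hom D X Y).
    \<forall>Z\<in>Ob D. \<forall>f\<in>carrier (Hom D Z X).
      \<rho> Z Y (comp D Z X Y g f) =
      tensor_map K (Hom D Z X) C (Hom D Z Y) C (comp D Z X Y g) (\<lambda>c. c) (\<rho> Z X f)}"

text \<open>\<open>Hom(X, -) \<otimes> C\<close>, with coaction \<open>f \<otimes> c \<mapsto> (f \<otimes> c\<^sub>1) \<otimes> c\<^sub>2\<close>.\<close>

definition hom_tensor_C ::
  "('k, 'r) ring_scheme \<Rightarrow> ('k, 'o, 'm) lin_cat \<Rightarrow> ('k, 'c, 'x) coalgebra_scheme \<Rightarrow> 'o \<Rightarrow>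
    ('k, 'o, 'm, ('k, 'm, 'c) tensor, 'c) cat_comodule"
  where "hom_tensor_C K D C X =
    \<lparr>mod_obj = (\<lambda>Y. tensor K (Hom D X Y) C),
     mod_map = (\<lambda>Y Z g. tensor_map K (Hom D X Y) C (Hom D X Z) C (comp D X Y Z g) (\<lambda>c. c)),
     coact = (\<lambda>Y. tensor_lift K (Hom D X Y) C (tensor K (tensor K (Hom D X Y) C) C)
       (\<lambda>f c. tensor_map K C C (tensor K (Hom D X Y) C) C
         (\<lambda>c1. pure_tensor K (Hom D X Y) C f c1) (\<lambda>c2. c2) (comult C c)))\<rparr>"

text \<open>\<open>Y \<mapsto> Hom(-, Y) \<otimes>\<^sub>E Hom(X, -)\<close>, with coaction \<open>f \<otimes> f' \<mapsto> (f \<otimes> f'\<^sub>0) \<otimes> f'\<^sub>1\<close>.\<close>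

definition hom_tensor_hom ::
  "('k, 'r) ring_scheme \<Rightarrow> ('k, 'o, 'm) lin_cat \<Rightarrow> ('k, 'c, 'x) coalgebra_scheme \<Rightarrow>
    ('o \<Rightarrow> 'o \<Rightarrow> 'm \<Rightarrow> ('k, 'm, 'c) tensor) \<Rightarrow> ('o \<Rightarrow> 'o \<Rightarrow> 'm set) \<Rightarrow> 'o \<Rightarrow>
    ('k, 'o, 'm, ('k, 'o, 'm, 'm) cat_tensor, 'c) cat_comodule"
  where "hom_tensor_hom K D C \<rho> E X =
    (let E' = restrict_Hom D E;
         H = (\<lambda>Y. cat_tensor K E' (right_hom D Y) (left_hom D X))
     in
    \<lparr>mod_obj = H,
     mod_map = (\<lambda>Y Y' g. cat_tensor_lift K E' (right_hom D Y) (left_hom D X) (H Y')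
       (\<lambda>Z f f'. pure_cat_tensor K E' (right_hom D Y') (left_hom D X) Z (comp D Z Y Y' g f) f')),
     coact = (\<lambda>Y. cat_tensor_lift K E' (right_hom D Y) (left_hom D X) (tensor K (H Y) C)
       (\<lambda>Z f f'. tensor_map K (Hom D X Z) C (H Y) C
         (\<lambda>f0. pure_cat_tensor K E' (right_hom D Y) (left_hom D X) Z f f0) (\<lambda>c. c)
         (\<rho> X Z f')))\<rparr>)"

definition can ::
  "('k, 'r) ring_scheme \<Rightarrow> ('k, 'o, 'm) lin_cat \<Rightarrow> ('k, 'c, 'x) coalgebra_scheme \<Rightarrow>
    ('o \<Rightarrow> 'o \<Rightarrow> 'm \<Rightarrow> ('k, 'm, 'c) tensor) \<Rightarrow> ('o \<Rightarrow> 'o \<Rightarrow> 'm set) \<Rightarrow> 'o \<Rightarrow> 'o \<Rightarrow>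
    ('k, 'o, 'm, 'm) cat_tensor \<Rightarrow> ('k, 'm, 'c) tensor"
  where "can K D C \<rho> E X Y =
    cat_tensor_lift K (restrict_Hom D E) (right_hom D Y) (left_hom D X) (tensor K (Hom D X Y) C)
      (\<lambda>Z f f'. tensor_map K (Hom D X Z) C (Hom D X Y) C (comp D X Z Y f) (\<lambda>c. c) (\<rho> X Z f'))"

locale galois_extension = linear_subcategory K D E
  for K :: "('k, 'r) ring_scheme" and D :: "('k, 'o, 'm) lin_cat"
    and C :: "('k, 'c, 'x) coalgebra_scheme"
    and \<rho> :: "'o \<Rightarrow> 'o \<Rightarrow> 'm \<Rightarrow> ('k, 'm, 'c) tensor" and E :: "'o \<Rightarrow> 'o \<Rightarrow> 'm set" +
  assumes eq_coinvariants: "\<lbrakk>X \<in> Ob D; Y \<in> Ob D\<rbrakk> \<Longrightarrow> E X Y = coinvariants K D C \<rho> X Y"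
    and can_iso: "X \<in> Ob D \<Longrightarrow>
      cat_comodule_iso K D C (hom_tensor_hom K D C \<rho> E X) (hom_tensor_C K D C X)
        (can K D C \<rho> E X)"

section \<open>Entwining structures and entwined modules\<close>

text \<open>
  \<open>\<psi> X Y : C \<otimes> Hom(X, Y) \<rightarrow> Hom(X, Y) \<otimes> C\<close>. The values of \<open>\<psi>\<close> outside the relevant domains are
  fixed by extensionality, so that equality of entwining structures is equality in HOL.
\<close>

locale entwining_structure = linear_category K D + coalgebra K C
  for K :: "('k, 'r) ring_scheme" and D :: "('k, 'o, 'm) lin_cat"
    and C :: "('k, 'c, 'x) coalgebra_scheme"
    and \<psi> :: "'o \<Rightarrow> 'o \<Rightarrow> ('k, 'c, 'm) tensor \<Rightarrow> ('k, 'm, 'c) tensor" +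
  assumes psi_lin: "\<psi> \<in> (\<Pi>\<^sub>E X\<in>Ob D. \<Pi>\<^sub>E Y\<in>Ob D.
      lin_hom K (tensor K C (Hom D X Y)) (tensor K (Hom D X Y) C) \<inter>
      extensional (carrier (tensor K C (Hom D X Y))))"
    \<comment> \<open>\<open>(gf)\<^sub>\<psi> \<otimes> c\<^sup>\<psi> = g\<^sub>\<psi> f\<^sub>\<psi>\<^sub>' \<otimes> (c\<^sup>\<psi>)\<^sup>\<psi>\<^sup>'\<close>\<close>
    and psi_comp: "\<lbrakk>X \<in> Ob D; Y \<in> Ob D; Z \<in> Ob D; c \<in> carrier C;
        f \<in> carrier (Hom D X Y); g \<in> carrier (Hom D Y Z)\<rbrakk> \<Longrightarrow>
      \<psi> X Z (pure_tensor K C (Hom D X Z) c (comp D X Y Z g f)) =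
      tensor_lift K (Hom D Y Z) C (tensor K (Hom D X Z) C)
        (\<lambda>g' c'. tensor_map K (Hom D X Y) C (Hom D X Z) C (comp D X Y Z g') (\<lambda>c''. c'')
          (\<psi> X Y (pure_tensor K C (Hom D X Y) c' f)))
        (\<psi> Y Z (pure_tensor K C (Hom D Y Z) c g))"
    \<comment> \<open>\<open>\<epsilon>(c\<^sup>\<psi>) f\<^sub>\<psi> = \<epsilon>(c) f\<close>\<close>
    and psi_counit: "\<lbrakk>X \<in> Ob D; Y \<in> Ob D; c \<in> carrier C; f \<in> carrier (Hom D X Y)\<rbrakk> \<Longrightarrow>
      tensor_lift K (Hom D X Y) C (Hom D X Y) (\<lambda>f' c'. counit C c' \<odot>\<^bsub>Hom D X Y\<^esub> f')
        (\<psi> X Y (pure_tensor K C (Hom D X Y) c f)) =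
      counit C c \<odot>\<^bsub>Hom D X Y\<^esub> f"
    \<comment> \<open>\<open>f\<^sub>\<psi> \<otimes> \<Delta>(c\<^sup>\<psi>) = (f\<^sub>\<psi>)\<^sub>\<psi>\<^sub>' \<otimes> (c\<^sub>1)\<^sup>\<psi>\<^sup>' \<otimes> (c\<^sub>2)\<^sup>\<psi>\<close>, in \<open>Hom(X, Y) \<otimes> (C \<otimes> C)\<close>\<close>
    and psi_comult: "\<lbrakk>X \<in> Ob D; Y \<in> Ob D; c \<in> carrier C; f \<in> carrier (Hom D X Y)\<rbrakk> \<Longrightarrow>
      tensor_map K (Hom D X Y) C (Hom D X Y) (tensor K C C) (\<lambda>f'. f') (comult C)
        (\<psi> X Y (pure_tensor K C (Hom D X Y) c f)) =
      tensor_lift K C C (tensor K (Hom D X Y) (tensor K C C))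
        (\<lambda>c1 c2. tensor_lift K (Hom D X Y) C (tensor K (Hom D X Y) (tensor K C C))
          (\<lambda>f' c2'. tensor_assoc K (Hom D X Y) C C
            (pure_tensor K (tensor K (Hom D X Y) C) C
              (\<psi> X Y (pure_tensor K C (Hom D X Y) c1 f')) c2'))
          (\<psi> X Y (pure_tensor K C (Hom D X Y) c2 f)))
        (comult C c)"
    and psi_ident: "\<lbrakk>X \<in> Ob D; c \<in> carrier C\<rbrakk> \<Longrightarrow>
      \<psi> X X (pure_tensor K C (Hom D X X) c (ident D X)) = pure_tensor K (Hom D X X) C (ident D X) c"

locale entwined_module = left_cat_module K "opposite D" M
  for K :: "('k, 'r) ring_scheme" and D :: "('k, 'o, 'm) lin_cat"
    and C :: "('k, 'c, 'x) coalgebra_scheme"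
    and \<psi> :: "'o \<Rightarrow> 'o \<Rightarrow> ('k, 'c, 'm) tensor \<Rightarrow> ('k, 'm, 'c) tensor"
    and M :: "('k, 'o, 'm, 'v, 'c) cat_comodule" +
  assumes entwined_comodule: "Y \<in> Ob D \<Longrightarrow> right_comodule K C (mod_obj M Y) (coact M Y)"
    \<comment> \<open>\<open>(M(f)(m))\<^sub>0 \<otimes> (M(f)(m))\<^sub>1 = M(f\<^sub>\<psi>)(m\<^sub>0) \<otimes> (m\<^sub>1)\<^sup>\<psi>\<close>\<close>
    and entwined: "\<lbrakk>X \<in> Ob D; Y \<in> Ob D; f \<in> carrier (Hom D Y X); m \<in> carrier (mod_obj M X)\<rbrakk> \<Longrightarrow>
      coact M Y (mod_map M X Y f m) =
      tensor_lift K (mod_obj M X) C (tensor K (mod_obj M Y) C)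
        (\<lambda>m0 m1. tensor_lift K (Hom D Y X) C (tensor K (mod_obj M Y) C)
          (\<lambda>f' c'. pure_tensor K (mod_obj M Y) C (mod_map M X Y f' m0) c')
          (\<psi> Y X (pure_tensor K C (Hom D Y X) m1 f)))
        (coact M X m)"

definition right_hom_comodule ::
  "('k, 'o, 'm) lin_cat \<Rightarrow> ('o \<Rightarrow> 'o \<Rightarrow> 'm \<Rightarrow> ('k, 'm, 'c) tensor) \<Rightarrow> 'o \<Rightarrow>
    ('k, 'o, 'm, 'm, 'c) cat_comodule"
  where "right_hom_comodule D \<rho> Y =
    cat_module.extend (right_hom D Y) \<lparr>coact = (\<lambda>X. \<rho> X Y)\<rparr>"

end

theory Submission
  imports Defs
begin

text \<open>
  Write \<open>h \<cdot> t\<close> for postcomposition with \<open>h\<close> in the first factor of \<open>t \<in> Hom(Y, W) \<otimes> C\<close>.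
  Suppose first that \<open>\<psi>\<close> is an entwining structure for which the representable right modules are
  entwined. For \<open>f : X \<rightarrow> Y\<close> the rule \<open>(h \<otimes> c) \<triangleleft> f = h \<cdot> \<psi>(c \<otimes> f)\<close> defines a linear map
  \<open>Hom(Y, W) \<otimes> C \<rightarrow> Hom(X, W) \<otimes> C\<close> that commutes with postcomposition, and the entwined module
  condition for \<open>Hom(-, W)\<close> says exactly \<open>\<rho>(g) \<triangleleft> f = \<rho>(g f)\<close>. Together these give

  \<open>(h \<cdot> \<rho>(g)) \<triangleleft> f = h \<cdot> \<rho>(g f)\<close>  for \<open>g : Y \<rightarrow> Z\<close> and \<open>h : Z \<rightarrow> W\<close>.

  The elements \<open>h \<cdot> \<rho>(g)\<close> are the values of the canonical map on pure tensors, so surjectivity of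
  the canonical map says that they span \<open>Hom(Y, W) \<otimes> C\<close> (\<open>HC_hom_eqI\<close>). Hence the displayed formula
  determines \<open>\<triangleleft>\<close>, and with it \<open>\<psi>(c \<otimes> f) = (id \<otimes> c) \<triangleleft> f\<close>; this is uniqueness.

  For existence the same formula is read as a definition. The family \<open>h \<otimes> g \<mapsto> h \<cdot> \<rho>(g f)\<close> is
  balanced over the coinvariants, because \<open>\<rho>(e g f) = e \<cdot> \<rho>(g f)\<close> for a coinvariant \<open>e\<close>. It
  therefore descends to \<open>Hom(-, W) \<otimes>\<^sub>E Hom(Y, -)\<close>, and composing it with the inverse of the canonical
  map produces \<open>\<triangleleft> f\<close> (\<open>precomp_exists\<close>). Every axiom of an entwining structure is the value at
  \<open>id \<otimes> c\<close> of an identity between linear maps on \<open>Hom(Y, W) \<otimes> C\<close>, and such an identity only has to be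
  verified on the elements \<open>h \<cdot> \<rho>(g)\<close>. There it becomes a property of \<open>\<rho>\<close>: compatibility of
  \<open>\<psi>\<close> with composition is associativity \<open>(g g') f = g (g' f)\<close>, compatibility with the counit is
  counitality of \<open>\<rho>\<close>, and compatibility with the comultiplication is coassociativity of \<open>\<rho>\<close>,
  used at \<open>g\<close> and at \<open>g f\<close>.

  All identities between maps out of tensor products are proved on generators, so the whole argument
  rests on two facts about each kind of tensor product: a bilinear (and balanced) map factors through
  it, and linear maps that agree on pure tensors are equal.
\<close>

section \<open>Linear and bilinear maps\<close>

lemma lin_homI:
  assumes "\<And>x. x \<in> carrier M \<Longrightarrow> h x \<in> carrier N"
    and "\<And>x y. \<lbrakk>x \<in> carrier M; y \<in> carrier M\<rbrakk> \<Longrightarrow> h (x \<oplus>\<^bsub>M\<^esub> y) = h x \<oplus>\<^bsub>N\<^esub> h y"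
    and "\<And>a x. \<lbrakk>a \<in> carrier K; x \<in> carrier M\<rbrakk> \<Longrightarrow> h (a \<odot>\<^bsub>M\<^esub> x) = a \<odot>\<^bsub>N\<^esub> h x"
  shows "h \<in> lin_hom K M N"
  using assms by (simp add: lin_hom_def)

lemma lin_hom_closed: "h \<in> lin_hom K M N \<Longrightarrow> x \<in> carrier M \<Longrightarrow> h x \<in> carrier N"
  by (auto simp: lin_hom_def)

lemma lin_hom_add:
  "h \<in> lin_hom K M N \<Longrightarrow> x \<in> carrier M \<Longrightarrow> y \<in> carrier M \<Longrightarrow>
    h (x \<oplus>\<^bsub>M\<^esub> y) = h x \<oplus>\<^bsub>N\<^esub> h y"
  by (auto simp: lin_hom_def)

lemma lin_hom_smult:
  "h \<in> lin_hom K M N \<Longrightarrow> a \<in> carrier K \<Longrightarrow> x \<in> carrier M \<Longrightarrow>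
    h (a \<odot>\<^bsub>M\<^esub> x) = a \<odot>\<^bsub>N\<^esub> h x"
  by (auto simp: lin_hom_def)

lemma lin_hom_zero:
  assumes "module K M" "module K N" "h \<in> lin_hom K M N"
  shows "h \<zero>\<^bsub>M\<^esub> = \<zero>\<^bsub>N\<^esub>"
proof -
  interpret M: module K M by fact
  interpret N: module K N by fact
  have "h (\<zero>\<^bsub>K\<^esub> \<odot>\<^bsub>M\<^esub> \<zero>\<^bsub>M\<^esub>) = \<zero>\<^bsub>K\<^esub> \<odot>\<^bsub>N\<^esub> h \<zero>\<^bsub>M\<^esub>"
    by (intro lin_hom_smult[OF assms(3)]) simp_all
  moreover have "h \<zero>\<^bsub>M\<^esub> \<in> carrier N"
    by (intro lin_hom_closed[OF assms(3)]) simp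
  ultimately show ?thesis by simp
qed

lemma lin_hom_uminus:
  assumes "module K M" "module K N" "h \<in> lin_hom K M N" "x \<in> carrier M"
  shows "h (\<ominus>\<^bsub>M\<^esub> x) = \<ominus>\<^bsub>N\<^esub> h x"
proof -
  interpret M: module K M by fact
  interpret N: module K N by fact
  have hx: "h x \<in> carrier N" "h (\<ominus>\<^bsub>M\<^esub> x) \<in> carrier N"
    using assms(4) by (auto intro: lin_hom_closed[OF assms(3)])
  have "h (\<ominus>\<^bsub>M\<^esub> x) \<oplus>\<^bsub>N\<^esub> h x = \<zero>\<^bsub>N\<^esub>"
    using lin_hom_add[OF assms(3), of "\<ominus>\<^bsub>M\<^esub> x" x] lin_hom_zero[OF assms(1-3)] assms(4)
    by (simp add: M.M.l_neg)
  then show ?thesis using hx by (metis N.M.minus_equality)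
qed

lemma lin_hom_minus:
  assumes "module K M" "module K N" "h \<in> lin_hom K M N" "x \<in> carrier M" "y \<in> carrier M"
  shows "h (x \<ominus>\<^bsub>M\<^esub> y) = h x \<ominus>\<^bsub>N\<^esub> h y"
proof -
  interpret M: module K M by fact
  show ?thesis
    using assms(4,5) lin_hom_add[OF assms(3), of x "\<ominus>\<^bsub>M\<^esub> y"] lin_hom_uminus[OF assms(1-3,5)]
    by (simp add: a_minus_def)
qed

lemma lin_hom_ident: "(\<lambda>x. x) \<in> lin_hom K M M"
  by (simp add: lin_hom_def)

lemma lin_hom_compose:
  "g \<in> lin_hom K N P \<Longrightarrow> f \<in> lin_hom K M N \<Longrightarrow> (\<lambda>x. g (f x)) \<in> lin_hom K M P"
  by (auto simp: lin_hom_def Pi_iff)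

lemma lin_hom_cong:
  assumes "module K M" "\<And>x. x \<in> carrier M \<Longrightarrow> f x = g x"
  shows "f \<in> lin_hom K M N \<longleftrightarrow> g \<in> lin_hom K M N"
proof -
  interpret M: module K M by fact
  show ?thesis by (auto simp: lin_hom_def Pi_iff assms(2))
qed

lemma lin_hom_plus:
  assumes "module K M" "module K N" "f \<in> lin_hom K M N" "g \<in> lin_hom K M N"
  shows "(\<lambda>x. f x \<oplus>\<^bsub>N\<^esub> g x) \<in> lin_hom K M N"
proof -
  interpret N: module K N by fact
  note [simp] = lin_hom_closed[OF assms(3)] lin_hom_closed[OF assms(4)]
  show ?thesis
    by (rule lin_homI)
      (auto simp: lin_hom_add[OF assms(3)] lin_hom_add[OF assms(4)] lin_hom_smult[OF assms(3)]
        lin_hom_smult[OF assms(4)] N.smult_r_distr N.M.a_ac)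
qed

lemma lin_hom_scale:
  assumes "module K M" "module K N" "f \<in> lin_hom K M N" "a \<in> carrier K"
  shows "(\<lambda>x. a \<odot>\<^bsub>N\<^esub> f x) \<in> lin_hom K M N"
proof -
  interpret N: module K N by fact
  note [simp] = lin_hom_closed[OF assms(3)]
  show ?thesis
    by (rule lin_homI)
      (auto simp: lin_hom_add[OF assms(3)] lin_hom_smult[OF assms(3)] N.smult_r_distr assms(4)
        N.smult_assoc1[symmetric] N.R.m_comm)
qed

definition bilinear_map ::
  "('k, 'r) ring_scheme \<Rightarrow> ('k, 'a, 'x) module_scheme \<Rightarrow> ('k, 'b, 'y) module_scheme \<Rightarrow>
    ('k, 'p, 'z) module_scheme \<Rightarrow> ('a \<Rightarrow> 'b \<Rightarrow> 'p) \<Rightarrow> bool"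
  where "bilinear_map K M N P b \<longleftrightarrow>
    (\<forall>m\<in>carrier M. b m \<in> lin_hom K N P) \<and> (\<forall>n\<in>carrier N. (\<lambda>m. b m n) \<in> lin_hom K M P)"

lemma bilinear_mapI:
  assumes "\<And>m. m \<in> carrier M \<Longrightarrow> b m \<in> lin_hom K N P"
    and "\<And>n. n \<in> carrier N \<Longrightarrow> (\<lambda>m. b m n) \<in> lin_hom K M P"
  shows "bilinear_map K M N P b"
  using assms by (simp add: bilinear_map_def)

lemma bilinear_map_left:
  "bilinear_map K M N P b \<Longrightarrow> n \<in> carrier N \<Longrightarrow> (\<lambda>m. b m n) \<in> lin_hom K M P"
  by (simp add: bilinear_map_def)

lemma bilinear_map_right:
  "bilinear_map K M N P b \<Longrightarrow> m \<in> carrier M \<Longrightarrow> b m \<in> lin_hom K N P"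
  by (simp add: bilinear_map_def)

lemma bilinear_map_closed:
  "bilinear_map K M N P b \<Longrightarrow> m \<in> carrier M \<Longrightarrow> n \<in> carrier N \<Longrightarrow> b m n \<in> carrier P"
  by (rule lin_hom_closed[OF bilinear_map_right])

lemma bilinear_map_compose:
  assumes b: "bilinear_map K M N P b" and f: "f \<in> lin_hom K M' M" and g: "g \<in> lin_hom K N' N"
    and h: "h \<in> lin_hom K P P'"
  shows "bilinear_map K M' N' P' (\<lambda>m n. h (b (f m) (g n)))"
proof (rule bilinear_mapI)
  fix m assume "m \<in> carrier M'"
  then show "(\<lambda>n. h (b (f m) (g n))) \<in> lin_hom K N' P'"
    by (intro lin_hom_compose[OF h] lin_hom_compose[OF bilinear_map_right[OF b] g]
        lin_hom_closed[OF f])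
next
  fix n assume "n \<in> carrier N'"
  then show "(\<lambda>m. h (b (f m) (g n))) \<in> lin_hom K M' P'"
    by (intro lin_hom_compose[OF h] lin_hom_compose[OF bilinear_map_left[OF b] f]
        lin_hom_closed[OF g])
qed

section \<open>Quotients by generated submodules\<close>

lemma kernel_submodule:
  assumes "module K M" "module K N" "h \<in> lin_hom K M N"
  shows "submodule {x \<in> carrier M. h x = \<zero>\<^bsub>N\<^esub>} K M"
proof -
  interpret M: module K M by fact
  interpret N: module K N by fact
  show ?thesis
    by (rule M.submoduleI)
      (auto simp: lin_hom_zero[OF assms] lin_hom_uminus[OF assms] lin_hom_add[OF assms(3)]
        lin_hom_smult[OF assms(3)])
qed

lemma generated_submodule_is_submodule:
  assumes "module K M" "S \<subseteq> carrier M"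
  shows "submodule (generated_submodule K M S) K M"
proof -
  interpret M: module K M by fact
  note * = M.submoduleE
  have c: "carrier M \<in> {N. submodule N K M \<and> S \<subseteq> N}"
    using M.carrier_is_submodule assms(2) by simp
  have z: "\<zero>\<^bsub>M\<^esub> \<in> N" if "submodule N K M" for N
    using subgroup.one_closed[OF submodule.axioms(1)[OF that]] by simp
  show ?thesis unfolding generated_submodule_def
    by (rule M.submoduleI) (use c z *(3-5) in \<open>auto intro: *(4)\<close>)
qed

lemma generated_submodule_incl: "S \<subseteq> generated_submodule K M S"
  by (auto simp: generated_submodule_def)

lemma generated_submodule_least:
  "submodule N K M \<Longrightarrow> S \<subseteq> N \<Longrightarrow> generated_submodule K M S \<subseteq> N"
  by (auto simp: generated_submodule_def)

text \<open>
  The form in which relations are checked: the kernel of \<open>h\<close> is a submodule, so it contains the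
  generated one as soon as it contains the generators.
\<close>

lemma lin_hom_vanishes_on_generated:
  assumes "module K M" "module K N" "h \<in> lin_hom K M N" "S \<subseteq> carrier M"
    and "\<And>x. x \<in> S \<Longrightarrow> h x = \<zero>\<^bsub>N\<^esub>" "x \<in> generated_submodule K M S"
  shows "h x = \<zero>\<^bsub>N\<^esub>"
  using generated_submodule_least[OF kernel_submodule[OF assms(1-3)], of S] assms(4-6) by blast

context
  fixes K :: "('k, 'r) ring_scheme" and M :: "('k, 'a, 'x) module_scheme" and N :: "'a set"
  assumes M: "module K M" and N: "submodule N K M"
begin

interpretation M: module K M by (rule M)
interpretation N: submodule N K M by (rule N)
interpretation N: abelian_subgroup N M
  by (rule abelian_subgroupI2) (rule M.a_comm_group, rule N.subgroup_axioms)

lemma quot_carrier: "carrier (quot_module M N) = {N +>\<^bsub>M\<^esub> x | x. x \<in> carrier M}"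
  by (auto simp: quot_module_def A_RCOSETS_def')

lemma quot_add:
  "x \<in> carrier M \<Longrightarrow> y \<in> carrier M \<Longrightarrow>
    (N +>\<^bsub>M\<^esub> x) \<oplus>\<^bsub>quot_module M N\<^esub> (N +>\<^bsub>M\<^esub> y) = N +>\<^bsub>M\<^esub> (x \<oplus>\<^bsub>M\<^esub> y)"
  by (simp add: quot_module_def N.a_rcos_sum)

lemma quot_zero: "\<zero>\<^bsub>quot_module M N\<^esub> = N +>\<^bsub>M\<^esub> \<zero>\<^bsub>M\<^esub>"
  by (simp add: quot_module_def N.a_subset)

lemma quot_smult:
  assumes a: "a \<in> carrier K" and x: "x \<in> carrier M"
  shows "a \<odot>\<^bsub>quot_module M N\<^esub> (N +>\<^bsub>M\<^esub> x) = N +>\<^bsub>M\<^esub> (a \<odot>\<^bsub>M\<^esub> x)"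
proof -
  have "N <+>\<^bsub>M\<^esub> ((\<lambda>x. a \<odot>\<^bsub>M\<^esub> x) ` (N +>\<^bsub>M\<^esub> x)) = N +>\<^bsub>M\<^esub> (a \<odot>\<^bsub>M\<^esub> x)"
  proof (intro equalityI subsetI)
    fix y assume "y \<in> N <+>\<^bsub>M\<^esub> ((\<lambda>x. a \<odot>\<^bsub>M\<^esub> x) ` (N +>\<^bsub>M\<^esub> x))"
    then obtain n n' where n: "n \<in> N" "n' \<in> N" "y = n \<oplus>\<^bsub>M\<^esub> a \<odot>\<^bsub>M\<^esub> (n' \<oplus>\<^bsub>M\<^esub> x)"
      by (auto simp: set_add_def' a_r_coset_def')
    then have "y = (n \<oplus>\<^bsub>M\<^esub> a \<odot>\<^bsub>M\<^esub> n') \<oplus>\<^bsub>M\<^esub> a \<odot>\<^bsub>M\<^esub> x"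
      using a x by (simp add: M.smult_r_distr M.M.a_ac)
    moreover have "n \<oplus>\<^bsub>M\<^esub> a \<odot>\<^bsub>M\<^esub> n' \<in> N" using n a by simp
    ultimately show "y \<in> N +>\<^bsub>M\<^esub> (a \<odot>\<^bsub>M\<^esub> x)" by (auto simp: a_r_coset_def')
  next
    fix y assume "y \<in> N +>\<^bsub>M\<^esub> (a \<odot>\<^bsub>M\<^esub> x)"
    then obtain n where n: "n \<in> N" "y = n \<oplus>\<^bsub>M\<^esub> a \<odot>\<^bsub>M\<^esub> x" by (auto simp: a_r_coset_def')
    then show "y \<in> N <+>\<^bsub>M\<^esub> ((\<lambda>x. a \<odot>\<^bsub>M\<^esub> x) ` (N +>\<^bsub>M\<^esub> x))"
      using N.a_rcos_self[OF x] by (auto simp: set_add_def')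
  qed
  then show ?thesis by (simp add: quot_module_def)
qed

lemma quot_is_module: "module K (quot_module M N)"
proof (rule moduleI)
  show "cring K" by (rule M.R.is_cring)
  have ac: "abelian_monoid (quot_module M N)"
    by (rule abelian_monoidI)
      (auto simp: quot_carrier quot_add quot_zero M.M.a_assoc, (metis M.M.a_closed M.M.zero_closed M.M.a_comm)+)
  show "abelian_group (quot_module M N)"
  proof (rule abelian_groupI)
    fix x assume "x \<in> carrier (quot_module M N)"
    then obtain y where y: "y \<in> carrier M" "x = N +>\<^bsub>M\<^esub> y" by (auto simp: quot_carrier)
    show "\<exists>z\<in>carrier (quot_module M N). z \<oplus>\<^bsub>quot_module M N\<^esub> x = \<zero>\<^bsub>quot_module M N\<^esub>"
      using y M.M.l_neg[of y]
      by (intro bexI[of _ "N +>\<^bsub>M\<^esub> (\<ominus>\<^bsub>M\<^esub> y)"])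
        (auto simp: quot_carrier quot_add quot_zero simp del: M.M.a_coset_add_zero)
  qed (use ac in \<open>auto simp: abelian_monoid.a_assoc abelian_monoid.a_comm abelian_monoid.l_zero
      intro: abelian_monoid.a_closed abelian_monoid.zero_closed\<close>)
qed (auto simp: quot_carrier quot_add quot_smult M.smult_l_distr M.smult_r_distr M.smult_assoc1
    intro: M.smult_closed)

lemma quot_proj_lin: "(\<lambda>x. N +>\<^bsub>M\<^esub> x) \<in> lin_hom K M (quot_module M N)"
  by (rule lin_homI) (auto simp: quot_carrier quot_add quot_smult)

lemma quot_proj_eqI:
  assumes "x \<in> carrier M" "y \<in> carrier M" "x \<ominus>\<^bsub>M\<^esub> y \<in> N"
  shows "N +>\<^bsub>M\<^esub> x = N +>\<^bsub>M\<^esub> y"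
  using assms N.a_rcos_module[OF assms(2,1)] N.a_repr_independence'[of x y]
  by (simp add: a_minus_def)

lemma quot_hom_eqI:
  assumes "\<And>x. x \<in> carrier M \<Longrightarrow> f (N +>\<^bsub>M\<^esub> x) = g (N +>\<^bsub>M\<^esub> x)"
    and "t \<in> carrier (quot_module M N)"
  shows "f t = g t"
  using assms by (auto simp: quot_carrier)

context
  fixes P :: "('k, 'p, 'y) module_scheme" and h
  assumes P: "module K P" and h: "h \<in> lin_hom K M P" and h0: "\<And>x. x \<in> N \<Longrightarrow> h x = \<zero>\<^bsub>P\<^esub>"
begin

interpretation P: module K P by (rule P)

lemma quot_lift_proj:
  assumes x: "x \<in> carrier M"
  shows "quot_lift h (N +>\<^bsub>M\<^esub> x) = h x"
proof -
  have "h (n \<oplus>\<^bsub>M\<^esub> x) = h x" if "n \<in> N" for n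
    using that x lin_hom_add[OF h, of n x] h0[OF that] lin_hom_closed[OF h x] by simp
  then have "h ` (N +>\<^bsub>M\<^esub> x) \<subseteq> {h x}" by (auto simp: a_r_coset_def')
  then have "h ` (N +>\<^bsub>M\<^esub> x) = {h x}" using N.a_rcos_self[OF x] by blast
  then show ?thesis by (simp add: quot_lift_def)
qed

lemma quot_lift_lin: "quot_lift h \<in> lin_hom K (quot_module M N) P"
  by (rule lin_homI)
    (auto simp: quot_carrier quot_add quot_smult quot_lift_proj lin_hom_add[OF h]
      lin_hom_smult[OF h] lin_hom_closed[OF h])

end
end

section \<open>Direct sums and free modules\<close>

context
  fixes K :: "('k, 'r) ring_scheme" and I :: "'i set" and M :: "'i \<Rightarrow> ('k, 'a, 'x) module_scheme"
  assumes K: "cring K" and M: "\<And>i. i \<in> I \<Longrightarrow> module K (M i)"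
begin

interpretation K: cring K by (rule K)

lemma summand_closed:
  assumes "i \<in> I"
  shows "\<zero>\<^bsub>M i\<^esub> \<in> carrier (M i)"
    and "x \<in> carrier (M i) \<Longrightarrow> y \<in> carrier (M i) \<Longrightarrow> x \<oplus>\<^bsub>M i\<^esub> y \<in> carrier (M i)"
    and "a \<in> carrier K \<Longrightarrow> x \<in> carrier (M i) \<Longrightarrow> a \<odot>\<^bsub>M i\<^esub> x \<in> carrier (M i)"
proof -
  interpret M: module K "M i" by (rule M[OF assms])
  show "\<zero>\<^bsub>M i\<^esub> \<in> carrier (M i)"
    and "x \<in> carrier (M i) \<Longrightarrow> y \<in> carrier (M i) \<Longrightarrow> x \<oplus>\<^bsub>M i\<^esub> y \<in> carrier (M i)"
    and "a \<in> carrier K \<Longrightarrow> x \<in> carrier (M i) \<Longrightarrow> a \<odot>\<^bsub>M i\<^esub> x \<in> carrier (M i)"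
    by simp_all
qed

lemma summand_arith:
  assumes "i \<in> I"
  shows "x \<in> carrier (M i) \<Longrightarrow> \<zero>\<^bsub>M i\<^esub> \<oplus>\<^bsub>M i\<^esub> x = x"
    and "x \<in> carrier (M i) \<Longrightarrow> x \<oplus>\<^bsub>M i\<^esub> \<zero>\<^bsub>M i\<^esub> = x"
    and "a \<in> carrier K \<Longrightarrow> a \<odot>\<^bsub>M i\<^esub> \<zero>\<^bsub>M i\<^esub> = \<zero>\<^bsub>M i\<^esub>"
    and "x \<in> carrier (M i) \<Longrightarrow> (\<ominus>\<^bsub>K\<^esub> \<one>\<^bsub>K\<^esub>) \<odot>\<^bsub>M i\<^esub> x \<oplus>\<^bsub>M i\<^esub> x = \<zero>\<^bsub>M i\<^esub>"
proof -
  interpret M: module K "M i" by (rule M[OF assms])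
  show "x \<in> carrier (M i) \<Longrightarrow> \<zero>\<^bsub>M i\<^esub> \<oplus>\<^bsub>M i\<^esub> x = x"
    and "x \<in> carrier (M i) \<Longrightarrow> x \<oplus>\<^bsub>M i\<^esub> \<zero>\<^bsub>M i\<^esub> = x"
    and "a \<in> carrier K \<Longrightarrow> a \<odot>\<^bsub>M i\<^esub> \<zero>\<^bsub>M i\<^esub> = \<zero>\<^bsub>M i\<^esub>"
    and "x \<in> carrier (M i) \<Longrightarrow> (\<ominus>\<^bsub>K\<^esub> \<one>\<^bsub>K\<^esub>) \<odot>\<^bsub>M i\<^esub> x \<oplus>\<^bsub>M i\<^esub> x = \<zero>\<^bsub>M i\<^esub>"
    by (simp_all add: M.smult_l_minus M.M.l_neg)
qed

lemma direct_sum_carrierI: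
  assumes "\<And>i. i \<in> I \<Longrightarrow> f i \<in> carrier (M i)" "finite F" "\<And>i. i \<in> I - F \<Longrightarrow> f i = \<zero>\<^bsub>M i\<^esub>"
  shows "(\<lambda>i\<in>I. f i) \<in> carrier (direct_sum I M)"
proof -
  have "{i \<in> I. (\<lambda>i\<in>I. f i) i \<noteq> \<zero>\<^bsub>M i\<^esub>} \<subseteq> F" using assms(3) by auto
  then have "finite {i \<in> I. (\<lambda>i\<in>I. f i) i \<noteq> \<zero>\<^bsub>M i\<^esub>}" using assms(2) finite_subset by blast
  then show ?thesis using assms(1) by (simp add: direct_sum_def)
qed

lemma direct_sum_carrierD:
  assumes "x \<in> carrier (direct_sum I M)"
  shows "i \<in> I \<Longrightarrow> x i \<in> carrier (M i)" "finite {i \<in> I. x i \<noteq> \<zero>\<^bsub>M i\<^esub>}" "x \<in> extensional I"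
  using assms by (auto simp: direct_sum_def PiE_def)

lemma direct_sum_eqI:
  assumes "x \<in> carrier (direct_sum I M)" "y \<in> carrier (direct_sum I M)" "\<And>i. i \<in> I \<Longrightarrow> x i = y i"
  shows "x = y"
  using assms direct_sum_carrierD(3) extensionalityI by metis

lemma direct_sum_add: "i \<in> I \<Longrightarrow> (x \<oplus>\<^bsub>direct_sum I M\<^esub> y) i = x i \<oplus>\<^bsub>M i\<^esub> y i"
  and direct_sum_zero: "i \<in> I \<Longrightarrow> \<zero>\<^bsub>direct_sum I M\<^esub> i = \<zero>\<^bsub>M i\<^esub>"
  and direct_sum_smult: "i \<in> I \<Longrightarrow> (a \<odot>\<^bsub>direct_sum I M\<^esub> x) i = a \<odot>\<^bsub>M i\<^esub> x i"
  by (simp_all add: direct_sum_def)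

lemma direct_sum_closed:
  shows "\<zero>\<^bsub>direct_sum I M\<^esub> \<in> carrier (direct_sum I M)"
    and "x \<in> carrier (direct_sum I M) \<Longrightarrow> y \<in> carrier (direct_sum I M) \<Longrightarrow>
      x \<oplus>\<^bsub>direct_sum I M\<^esub> y \<in> carrier (direct_sum I M)"
    and "a \<in> carrier K \<Longrightarrow> x \<in> carrier (direct_sum I M) \<Longrightarrow>
      a \<odot>\<^bsub>direct_sum I M\<^esub> x \<in> carrier (direct_sum I M)"
proof -
  have "(\<lambda>i\<in>I. \<zero>\<^bsub>M i\<^esub>) \<in> carrier (direct_sum I M)"
    by (rule direct_sum_carrierI[of _ "{}"]) (auto simp: summand_closed)
  then show "\<zero>\<^bsub>direct_sum I M\<^esub> \<in> carrier (direct_sum I M)" by (simp add: direct_sum_def)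
  {
    assume x: "x \<in> carrier (direct_sum I M)" and y: "y \<in> carrier (direct_sum I M)"
    have "(\<lambda>i\<in>I. x i \<oplus>\<^bsub>M i\<^esub> y i) \<in> carrier (direct_sum I M)"
      by (rule direct_sum_carrierI[of _ "{i \<in> I. x i \<noteq> \<zero>\<^bsub>M i\<^esub>} \<union> {i \<in> I. y i \<noteq> \<zero>\<^bsub>M i\<^esub>}"])
        (use direct_sum_carrierD(1,2)[OF x] direct_sum_carrierD(1,2)[OF y] in \<open>auto simp: summand_closed summand_arith\<close>)
    then show "x \<oplus>\<^bsub>direct_sum I M\<^esub> y \<in> carrier (direct_sum I M)" by (simp add: direct_sum_def)
  }
  {
    assume a: "a \<in> carrier K" and x: "x \<in> carrier (direct_sum I M)"
    have "(\<lambda>i\<in>I. a \<odot>\<^bsub>M i\<^esub> x i) \<in> carrier (direct_sum I M)"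
      by (rule direct_sum_carrierI[of _ "{i \<in> I. x i \<noteq> \<zero>\<^bsub>M i\<^esub>}"])
        (use direct_sum_carrierD(1,2)[OF x] a in \<open>auto simp: summand_closed summand_arith\<close>)
    then show "a \<odot>\<^bsub>direct_sum I M\<^esub> x \<in> carrier (direct_sum I M)" by (simp add: direct_sum_def)
  }
qed

lemma direct_sum_is_module: "module K (direct_sum I M)"
proof (rule moduleI)
  note simps = direct_sum_add direct_sum_zero direct_sum_smult
  note closed = direct_sum_closed direct_sum_carrierD(1)
  show "cring K" by (rule K)
  show "abelian_group (direct_sum I M)"
  proof (rule abelian_groupI)
    fix x assume x: "x \<in> carrier (direct_sum I M)"
    \<comment> \<open>Scaling by \<open>-1\<close> stays inside the finitely supported functions.\<close>
    let ?y = "(\<ominus>\<^bsub>K\<^esub> \<one>\<^bsub>K\<^esub>) \<odot>\<^bsub>direct_sum I M\<^esub> x"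
    have y: "?y \<in> carrier (direct_sum I M)" using x by (simp add: direct_sum_closed)
    have "?y \<oplus>\<^bsub>direct_sum I M\<^esub> x = \<zero>\<^bsub>direct_sum I M\<^esub>"
      by (rule direct_sum_eqI)
        (use x y in \<open>auto simp: closed simps summand_arith\<close>)
    with y show "\<exists>y\<in>carrier (direct_sum I M). y \<oplus>\<^bsub>direct_sum I M\<^esub> x = \<zero>\<^bsub>direct_sum I M\<^esub>"
      by blast
  qed (auto intro!: direct_sum_eqI simp: closed simps summand_arith
      abelian_monoid.a_assoc[OF abelian_group.axioms(1)[OF module.axioms(2)[OF M]]]
      abelian_monoid.a_comm[OF abelian_group.axioms(1)[OF module.axioms(2)[OF M]]])
qed (auto intro!: direct_sum_eqI
    simp: direct_sum_closed direct_sum_carrierD(1) direct_sum_add direct_sum_smult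
      module.smult_l_distr[OF M] module.smult_r_distr[OF M] module.smult_assoc1[OF M] module.smult_one[OF M])

lemma direct_sum_in_apply:
  "i \<in> I \<Longrightarrow> direct_sum_in I M j x i = (if i = j then x else \<zero>\<^bsub>M i\<^esub>)"
  by (simp add: direct_sum_in_def)

lemma direct_sum_in_closed:
  assumes "j \<in> I" "x \<in> carrier (M j)"
  shows "direct_sum_in I M j x \<in> carrier (direct_sum I M)"
proof -
  show ?thesis unfolding direct_sum_in_def
    by (rule direct_sum_carrierI[of _ "{j}"]) (use assms in \<open>auto simp: summand_closed\<close>)
qed

lemma direct_sum_in_lin:
  assumes "j \<in> I"
  shows "direct_sum_in I M j \<in> lin_hom K (M j) (direct_sum I M)"
proof -
  note [simp] = direct_sum_in_closed[OF assms] direct_sum_closed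
  show ?thesis
    by (rule lin_homI; (rule direct_sum_eqI)?)
      (use assms in \<open>auto simp: direct_sum_add direct_sum_smult direct_sum_in_apply summand_closed summand_arith\<close>)
qed

text \<open>
  An element of the direct sum has finite support and is the sum of its components; the induction
  peels off one index of the support at a time.
\<close>

lemma direct_sum_hom_eqI:
  assumes P: "module K P" and f: "f \<in> lin_hom K (direct_sum I M) P"
    and g: "g \<in> lin_hom K (direct_sum I M) P"
    and eq: "\<And>i a. i \<in> I \<Longrightarrow> a \<in> carrier (M i) \<Longrightarrow>
      f (direct_sum_in I M i a) = g (direct_sum_in I M i a)"
    and x: "x \<in> carrier (direct_sum I M)"
  shows "f x = g x"
proof -
  interpret S: module K "direct_sum I M" by (rule direct_sum_is_module)
  have "finite F \<Longrightarrow> F \<subseteq> I \<Longrightarrow> (\<forall>y\<in>carrier (direct_sum I M).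
    {i \<in> I. y i \<noteq> \<zero>\<^bsub>M i\<^esub>} \<subseteq> F \<longrightarrow> f y = g y)" for F
  proof (induction F rule: finite_induct)
    case empty
    have "y = \<zero>\<^bsub>direct_sum I M\<^esub>" if "y \<in> carrier (direct_sum I M)" "{i \<in> I. y i \<noteq> \<zero>\<^bsub>M i\<^esub>} \<subseteq> {}" for y
      by (rule direct_sum_eqI) (use that in \<open>auto simp: direct_sum_zero\<close>)
    then show ?case
      using lin_hom_zero[OF direct_sum_is_module P f] lin_hom_zero[OF direct_sum_is_module P g] by auto
  next
    case (insert j F)
    show ?case
    proof (intro ballI impI)
      fix y assume y: "y \<in> carrier (direct_sum I M)" and s: "{i \<in> I. y i \<noteq> \<zero>\<^bsub>M i\<^esub>} \<subseteq> insert j F"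
      have j: "j \<in> I" using insert by simp
      have yc: "y i \<in> carrier (M i)" if "i \<in> I" for i using direct_sum_carrierD(1)[OF y that] .
      define z where "z = (\<lambda>i\<in>I. if i = j then \<zero>\<^bsub>M i\<^esub> else y i)"
      have z: "z \<in> carrier (direct_sum I M)" unfolding z_def
        by (rule direct_sum_carrierI[OF _ direct_sum_carrierD(2)[OF y]]) (use yc in \<open>auto simp: summand_closed\<close>)
      have w: "direct_sum_in I M j (y j) \<in> carrier (direct_sum I M)"
        using j yc by (simp add: direct_sum_in_closed)
      have yz: "y = direct_sum_in I M j (y j) \<oplus>\<^bsub>direct_sum I M\<^esub> z"
        by (rule direct_sum_eqI)
          (use y z w yc in \<open>auto simp: direct_sum_add direct_sum_in_def z_def summand_arith summand_closed\<close>)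
      have "{i \<in> I. z i \<noteq> \<zero>\<^bsub>M i\<^esub>} \<subseteq> F" using s by (auto simp: z_def split: if_splits)
      then have "f z = g z" using insert z by auto
      then show "f y = g y"
        using lin_hom_add[OF f w z] lin_hom_add[OF g w z] eq[OF j yc[OF j]] yz by simp
    qed
  qed
  from this[OF direct_sum_carrierD(2)[OF x]] show ?thesis using x by auto
qed

context
  fixes P :: "('k, 'p, 'y) module_scheme" and h
  assumes P: "module K P" and h: "\<And>i. i \<in> I \<Longrightarrow> h i \<in> lin_hom K (M i) P"
begin

interpretation P: module K P by (rule P)

text \<open>
  The lift sums over the support of \<open>x\<close>, which changes under addition and scaling. Enlarging the
  index set to a common finite \<open>F\<close> makes the sums comparable.
\<close>

lemma direct_sum_lift_eq_finsum:
  assumes x: "x \<in> carrier (direct_sum I M)" and F: "finite F" "F \<subseteq> I"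
    and s: "{i \<in> I. x i \<noteq> \<zero>\<^bsub>M i\<^esub>} \<subseteq> F"
  shows "direct_sum_lift I M P h x = (\<Oplus>\<^bsub>P\<^esub>i\<in>F. h i (x i))"
proof -
  have "\<forall>i\<in>F - {i \<in> I. x i \<noteq> \<zero>\<^bsub>M i\<^esub>}. h i (x i) = \<zero>\<^bsub>P\<^esub>"
    using F lin_hom_zero[OF M P h] by auto
  moreover have "(\<lambda>i. h i (x i)) \<in> F \<rightarrow> carrier P"
    using F by (auto intro!: lin_hom_closed[OF h] direct_sum_carrierD(1)[OF x])
  ultimately show ?thesis
    unfolding direct_sum_lift_def using F(1) s by (intro P.M.add.finprod_mono_neutral_cong_left) auto
qed

lemma direct_sum_lift_lin: "direct_sum_lift I M P h \<in> lin_hom K (direct_sum I M) P"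
proof (rule lin_homI)
  have hc: "(\<lambda>i. h i (x i)) \<in> F \<rightarrow> carrier P" if "F \<subseteq> I" "x \<in> carrier (direct_sum I M)" for F x
    using that by (auto intro!: lin_hom_closed[OF h] direct_sum_carrierD(1)[OF that(2)])
  {
    fix x assume x: "x \<in> carrier (direct_sum I M)"
    let ?F = "{i \<in> I. x i \<noteq> \<zero>\<^bsub>M i\<^esub>}"
    have F: "finite ?F" "?F \<subseteq> I" using direct_sum_carrierD(2)[OF x] by auto
    show "direct_sum_lift I M P h x \<in> carrier P"
      using hc[OF F(2) x] by (auto simp: direct_sum_lift_def intro!: P.M.finsum_closed)
    fix a assume a: "a \<in> carrier K"
    have ax: "a \<odot>\<^bsub>direct_sum I M\<^esub> x \<in> carrier (direct_sum I M)" using a x by (simp add: direct_sum_closed)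
    have "{i \<in> I. (a \<odot>\<^bsub>direct_sum I M\<^esub> x) i \<noteq> \<zero>\<^bsub>M i\<^esub>} \<subseteq> ?F" using a by (auto simp: direct_sum_smult summand_arith)
    then have "direct_sum_lift I M P h (a \<odot>\<^bsub>direct_sum I M\<^esub> x) = (\<Oplus>\<^bsub>P\<^esub>i\<in>?F. h i ((a \<odot>\<^bsub>direct_sum I M\<^esub> x) i))"
      by (rule direct_sum_lift_eq_finsum[OF ax F])
    also have "\<dots> = (\<Oplus>\<^bsub>P\<^esub>i\<in>?F. a \<odot>\<^bsub>P\<^esub> h i (x i))"
      by (rule P.M.finsum_cong')
        (use a hc[OF F(2) x] in \<open>auto simp: direct_sum_smult lin_hom_smult[OF h a direct_sum_carrierD(1)[OF x]]\<close>)
    also have "\<dots> = a \<odot>\<^bsub>P\<^esub> direct_sum_lift I M P h x"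
      using P.finsum_smult_ldistr[OF F(1) a hc[OF F(2) x]] by (simp add: direct_sum_lift_def)
    finally show "direct_sum_lift I M P h (a \<odot>\<^bsub>direct_sum I M\<^esub> x) = a \<odot>\<^bsub>P\<^esub> direct_sum_lift I M P h x" .
  }
  fix x y assume x: "x \<in> carrier (direct_sum I M)" and y: "y \<in> carrier (direct_sum I M)"
  let ?F = "{i \<in> I. x i \<noteq> \<zero>\<^bsub>M i\<^esub>} \<union> {i \<in> I. y i \<noteq> \<zero>\<^bsub>M i\<^esub>}"
  have F: "finite ?F" "?F \<subseteq> I" using direct_sum_carrierD(2)[OF x] direct_sum_carrierD(2)[OF y] by auto
  have xy: "x \<oplus>\<^bsub>direct_sum I M\<^esub> y \<in> carrier (direct_sum I M)" using x y by (simp add: direct_sum_closed)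
  have "{i \<in> I. (x \<oplus>\<^bsub>direct_sum I M\<^esub> y) i \<noteq> \<zero>\<^bsub>M i\<^esub>} \<subseteq> ?F" by (auto simp: direct_sum_add summand_arith summand_closed)
  then have "direct_sum_lift I M P h (x \<oplus>\<^bsub>direct_sum I M\<^esub> y) = (\<Oplus>\<^bsub>P\<^esub>i\<in>?F. h i ((x \<oplus>\<^bsub>direct_sum I M\<^esub> y) i))"
    by (rule direct_sum_lift_eq_finsum[OF xy F])
  also have "\<dots> = (\<Oplus>\<^bsub>P\<^esub>i\<in>?F. h i (x i) \<oplus>\<^bsub>P\<^esub> h i (y i))"
  proof (rule P.M.finsum_cong'[OF refl])
    show "(\<lambda>i. h i (x i) \<oplus>\<^bsub>P\<^esub> h i (y i)) \<in> ?F \<rightarrow> carrier P"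
      using hc[OF F(2) x] hc[OF F(2) y] by (auto simp: Pi_iff)
    fix i assume "i \<in> ?F"
    then have i: "i \<in> I" by auto
    show "h i ((x \<oplus>\<^bsub>direct_sum I M\<^esub> y) i) = h i (x i) \<oplus>\<^bsub>P\<^esub> h i (y i)"
      using lin_hom_add[OF h[OF i] direct_sum_carrierD(1)[OF x i] direct_sum_carrierD(1)[OF y i]] i
      by (simp add: direct_sum_add)
  qed
  also have "\<dots> = (\<Oplus>\<^bsub>P\<^esub>i\<in>?F. h i (x i)) \<oplus>\<^bsub>P\<^esub> (\<Oplus>\<^bsub>P\<^esub>i\<in>?F. h i (y i))"
    by (rule P.M.finsum_addf[OF hc[OF F(2) x] hc[OF F(2) y]])
  also have "\<dots> = direct_sum_lift I M P h x \<oplus>\<^bsub>P\<^esub> direct_sum_lift I M P h y"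
    using direct_sum_lift_eq_finsum[OF x F] direct_sum_lift_eq_finsum[OF y F] by auto
  finally show "direct_sum_lift I M P h (x \<oplus>\<^bsub>direct_sum I M\<^esub> y) =
    direct_sum_lift I M P h x \<oplus>\<^bsub>P\<^esub> direct_sum_lift I M P h y" .
qed

lemma direct_sum_lift_in:
  assumes j: "j \<in> I" and a: "a \<in> carrier (M j)"
  shows "direct_sum_lift I M P h (direct_sum_in I M j a) = h j a"
proof -
  \<comment> \<open>The support is empty when \<open>a\<close> is zero; the sum over \<open>{j}\<close> covers both cases.\<close>
  have "direct_sum_lift I M P h (direct_sum_in I M j a) =
      (\<Oplus>\<^bsub>P\<^esub>i\<in>{j}. h i (direct_sum_in I M j a i))"
    by (rule direct_sum_lift_eq_finsum[OF direct_sum_in_closed[OF j a]])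
      (use j in \<open>auto simp: direct_sum_in_def split: if_splits\<close>)
  then show ?thesis
    using lin_hom_closed[OF h[OF j] a] j by (simp add: direct_sum_in_def)
qed

end
end

lemma scalar_module_is_module:
  assumes "cring K"
  shows "module K (scalar_module K)"
proof -
  interpret K: cring K by fact
  show ?thesis
  proof (rule moduleI)
    show "abelian_group (scalar_module K)"
      by (rule abelian_groupI)
        (auto simp: scalar_module_def K.a_ac intro: bexI[of _ "\<ominus>\<^bsub>K\<^esub> _"] K.l_neg)
  qed (auto simp: scalar_module_def K.l_distr K.r_distr K.m_assoc K.cring_axioms)
qed

context
  fixes K :: "('k, 'r) ring_scheme" and S :: "'s set"
  assumes K: "cring K"
begin

interpretation K: cring K by (rule K)

lemma free_module_is_module: "module K (free_module K S)"
  unfolding free_module_def by (intro direct_sum_is_module K scalar_module_is_module)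

lemma free_gen_closed: "s \<in> S \<Longrightarrow> free_gen K S s \<in> carrier (free_module K S)"
  unfolding free_module_def free_gen_def
  by (rule direct_sum_in_closed[OF K scalar_module_is_module[OF K]]) (simp_all add: scalar_module_def)

text \<open>
  The free module is spanned by the generators alone, since the summand at \<open>s\<close> consists of the scalar
  multiples of the generator \<open>s\<close>.
\<close>

lemma free_hom_eqI:
  assumes "module K P" "f \<in> lin_hom K (free_module K S) P" "g \<in> lin_hom K (free_module K S) P"
    and eq: "\<And>s. s \<in> S \<Longrightarrow> f (free_gen K S s) = g (free_gen K S s)"
    and "x \<in> carrier (free_module K S)"
  shows "f x = g x"
proof -
  let ?M = "\<lambda>_. scalar_module K"
  note sm = scalar_module_is_module[OF K]
  have "f (direct_sum_in S ?M s a) = g (direct_sum_in S ?M s a)"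
    if s: "s \<in> S" and a: "a \<in> carrier (scalar_module K)" for s a
  proof -
    have a': "a \<in> carrier K" using a by (simp add: scalar_module_def)
    have "direct_sum_in S ?M s (a \<odot>\<^bsub>scalar_module K\<^esub> \<one>\<^bsub>K\<^esub>) =
        a \<odot>\<^bsub>direct_sum S ?M\<^esub> direct_sum_in S ?M s \<one>\<^bsub>K\<^esub>"
      by (rule lin_hom_smult[OF direct_sum_in_lin[OF K sm s] a']) (simp add: scalar_module_def)
    then have "direct_sum_in S ?M s a = a \<odot>\<^bsub>free_module K S\<^esub> free_gen K S s"
      using a' by (simp add: free_module_def free_gen_def scalar_module_def)
    then show ?thesis
      using eq[OF s] lin_hom_smult[OF assms(2) a' free_gen_closed[OF s]]
        lin_hom_smult[OF assms(3) a' free_gen_closed[OF s]] by simp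
  qed
  then show ?thesis
    using direct_sum_hom_eqI[of K S ?M P f g x] assms(1-3,5) K sm
    unfolding free_module_def by blast
qed

context
  fixes P :: "('k, 'p, 'y) module_scheme" and b
  assumes P: "module K P" and b: "\<And>s. s \<in> S \<Longrightarrow> b s \<in> carrier P"
begin

interpretation P: module K P by (rule P)

lemma scale_gen_lin: "s \<in> S \<Longrightarrow> (\<lambda>a. a \<odot>\<^bsub>P\<^esub> b s) \<in> lin_hom K (scalar_module K) P"
  using b by (auto intro!: lin_homI simp: scalar_module_def P.smult_l_distr P.smult_assoc1)

lemma free_lift_lin: "free_lift K S P b \<in> lin_hom K (free_module K S) P"
  unfolding free_lift_def free_module_def
  by (intro direct_sum_lift_lin K P scalar_module_is_module scale_gen_lin)

lemma free_lift_gen: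
  assumes s: "s \<in> S"
  shows "free_lift K S P b (free_gen K S s) = b s"
proof -
  have "free_lift K S P b (free_gen K S s) = \<one>\<^bsub>K\<^esub> \<odot>\<^bsub>P\<^esub> b s"
    unfolding free_lift_def free_gen_def
    by (rule direct_sum_lift_in[OF K scalar_module_is_module[OF K] P scale_gen_lin s])
      (auto simp: scalar_module_def)
  then show ?thesis using b s by simp
qed

end
end

section \<open>Tensor products over the ground ring\<close>

context
  fixes K :: "('k, 'r) ring_scheme" and M :: "('k, 'a, 'x) module_scheme"
    and N :: "('k, 'b, 'y) module_scheme"
  assumes M: "module K M" and N: "module K N"
begin

interpretation M: module K M by (rule M)
interpretation N: module K N by (rule N)

private abbreviation "F \<equiv> free_module K (carrier M \<times> carrier N)"
private abbreviation "e m n \<equiv> free_gen K (carrier M \<times> carrier N) (m, n)"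
private abbreviation "relators \<equiv>
      ({e (m \<oplus>\<^bsub>M\<^esub> m') n \<ominus>\<^bsub>F\<^esub> (e m n \<oplus>\<^bsub>F\<^esub> e m' n) | m m' n.
          m \<in> carrier M \<and> m' \<in> carrier M \<and> n \<in> carrier N} \<union>
       {e m (n \<oplus>\<^bsub>N\<^esub> n') \<ominus>\<^bsub>F\<^esub> (e m n \<oplus>\<^bsub>F\<^esub> e m n') | m n n'.
          m \<in> carrier M \<and> n \<in> carrier N \<and> n' \<in> carrier N} \<union>
       {e (a \<odot>\<^bsub>M\<^esub> m) n \<ominus>\<^bsub>F\<^esub> a \<odot>\<^bsub>F\<^esub> e m n | a m n.
          a \<in> carrier K \<and> m \<in> carrier M \<and> n \<in> carrier N} \<union>
       {e m (a \<odot>\<^bsub>N\<^esub> n) \<ominus>\<^bsub>F\<^esub> a \<odot>\<^bsub>F\<^esub> e m n | a m n.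
          a \<in> carrier K \<and> m \<in> carrier M \<and> n \<in> carrier N})"

interpretation F: module K F
  by (rule free_module_is_module[OF M.R.is_cring])

lemma tensor_rel_eq: "tensor_rel K M N = generated_submodule K F relators"
  by (simp add: tensor_rel_def Let_def)

lemma tensor_gen_closed: "m \<in> carrier M \<Longrightarrow> n \<in> carrier N \<Longrightarrow> e m n \<in> carrier F"
  by (simp add: free_gen_closed M.R.is_cring)

lemma tensor_relators_closed: "relators \<subseteq> carrier F"
  by (auto intro!: F.M.minus_closed F.M.a_closed F.smult_closed tensor_gen_closed M.smult_closed N.smult_closed)

lemma tensor_rel_submodule: "submodule (tensor_rel K M N) K F"
  unfolding tensor_rel_eq
  by (rule generated_submodule_is_submodule[OF F.module_axioms tensor_relators_closed])

lemma tensor_is_module: "module K (tensor K M N)"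
  unfolding tensor_def by (rule quot_is_module[OF F.module_axioms tensor_rel_submodule])

lemma tensor_proj_lin: "(\<lambda>x. tensor_rel K M N +>\<^bsub>F\<^esub> x) \<in> lin_hom K F (tensor K M N)"
  unfolding tensor_def by (rule quot_proj_lin[OF F.module_axioms tensor_rel_submodule])

lemma tensor_proj_eqI:
  assumes "x \<in> carrier F" "y \<in> carrier F" "x \<ominus>\<^bsub>F\<^esub> y \<in> relators"
  shows "tensor_rel K M N +>\<^bsub>F\<^esub> x = tensor_rel K M N +>\<^bsub>F\<^esub> y"
proof (rule quot_proj_eqI[OF F.module_axioms tensor_rel_submodule assms(1,2)])
  show "x \<ominus>\<^bsub>F\<^esub> y \<in> tensor_rel K M N"
    unfolding tensor_rel_eq by (rule subsetD[OF generated_submodule_incl assms(3)])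
qed

lemma pure_tensor_closed:
  "m \<in> carrier M \<Longrightarrow> n \<in> carrier N \<Longrightarrow> pure_tensor K M N m n \<in> carrier (tensor K M N)"
  unfolding pure_tensor_def by (rule lin_hom_closed[OF tensor_proj_lin tensor_gen_closed])

text \<open>
  Each of the four families of relators makes one of the four equations true in the quotient.
\<close>

lemma pure_tensor_bilinear: "bilinear_map K M N (tensor K M N) (pure_tensor K M N)"
proof (rule bilinear_mapI)
  note proj = lin_hom_add[OF tensor_proj_lin, symmetric] lin_hom_smult[OF tensor_proj_lin, symmetric]
  fix m assume m: "m \<in> carrier M"
  show "pure_tensor K M N m \<in> lin_hom K N (tensor K M N)"
  proof (rule lin_homI)
    fix n n' assume n: "n \<in> carrier N" "n' \<in> carrier N"
    show "pure_tensor K M N m (n \<oplus>\<^bsub>N\<^esub> n') =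
        pure_tensor K M N m n \<oplus>\<^bsub>tensor K M N\<^esub> pure_tensor K M N m n'"
      unfolding pure_tensor_def
      by (simp add: m n proj tensor_gen_closed, rule tensor_proj_eqI) (use m n in \<open>auto simp: tensor_gen_closed\<close>)
  next
    fix a n assume n: "a \<in> carrier K" "n \<in> carrier N"
    show "pure_tensor K M N m (a \<odot>\<^bsub>N\<^esub> n) = a \<odot>\<^bsub>tensor K M N\<^esub> pure_tensor K M N m n"
      unfolding pure_tensor_def
      by (simp add: m n proj tensor_gen_closed, rule tensor_proj_eqI) (use m n in \<open>auto simp: tensor_gen_closed\<close>)
  qed (use m pure_tensor_closed in simp)
next
  note proj = lin_hom_add[OF tensor_proj_lin, symmetric] lin_hom_smult[OF tensor_proj_lin, symmetric]
  fix n assume n: "n \<in> carrier N"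
  show "(\<lambda>m. pure_tensor K M N m n) \<in> lin_hom K M (tensor K M N)"
  proof (rule lin_homI)
    fix m m' assume m: "m \<in> carrier M" "m' \<in> carrier M"
    show "pure_tensor K M N (m \<oplus>\<^bsub>M\<^esub> m') n =
        pure_tensor K M N m n \<oplus>\<^bsub>tensor K M N\<^esub> pure_tensor K M N m' n"
      unfolding pure_tensor_def
      by (simp add: m n proj tensor_gen_closed, rule tensor_proj_eqI) (use m n in \<open>auto simp: tensor_gen_closed\<close>)
  next
    fix a m assume m: "a \<in> carrier K" "m \<in> carrier M"
    show "pure_tensor K M N (a \<odot>\<^bsub>M\<^esub> m) n = a \<odot>\<^bsub>tensor K M N\<^esub> pure_tensor K M N m n"
      unfolding pure_tensor_def
      by (simp add: m n proj tensor_gen_closed, rule tensor_proj_eqI) (use m n in \<open>auto simp: tensor_gen_closed\<close>)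
  qed (use n pure_tensor_closed in simp)
qed

text \<open>
  The principle by which all identities in Sweedler notation are proved below.
\<close>

lemma tensor_hom_eqI:
  assumes P: "module K P" and f: "f \<in> lin_hom K (tensor K M N) P"
    and g: "g \<in> lin_hom K (tensor K M N) P"
    and eq: "\<And>m n. m \<in> carrier M \<Longrightarrow> n \<in> carrier N \<Longrightarrow>
      f (pure_tensor K M N m n) = g (pure_tensor K M N m n)"
    and t: "t \<in> carrier (tensor K M N)"
  shows "f t = g t"
proof -
  have "f (tensor_rel K M N +>\<^bsub>F\<^esub> x) = g (tensor_rel K M N +>\<^bsub>F\<^esub> x)" if "x \<in> carrier F" for x
    by (rule free_hom_eqI[OF M.R.is_cring P lin_hom_compose[OF f tensor_proj_lin]
          lin_hom_compose[OF g tensor_proj_lin] _ that])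
      (use eq in \<open>auto simp: pure_tensor_def\<close>)
  then show ?thesis
    using quot_hom_eqI[OF F.module_axioms tensor_rel_submodule, of f g] t unfolding tensor_def by blast
qed

context
  fixes P :: "('k, 'p, 'z) module_scheme" and b
  assumes P: "module K P" and b: "bilinear_map K M N P b"
begin

interpretation P: module K P by (rule P)

private abbreviation "free_b \<equiv> free_lift K (carrier M \<times> carrier N) P (\<lambda>(m, n). b m n)"

lemma free_b_lin: "free_b \<in> lin_hom K F P"
  by (rule free_lift_lin[OF M.R.is_cring P]) (auto simp: bilinear_map_closed[OF b])

lemma free_b_gen: "m \<in> carrier M \<Longrightarrow> n \<in> carrier N \<Longrightarrow> free_b (e m n) = b m n"
  by (subst free_lift_gen[OF M.R.is_cring P]) (auto simp: bilinear_map_closed[OF b])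

text \<open>
  Bilinearity of \<open>b\<close> says that the linear map on the free module extending \<open>b\<close> kills the relators.
\<close>

lemma free_b_rel:
  assumes "x \<in> tensor_rel K M N"
  shows "free_b x = \<zero>\<^bsub>P\<^esub>"
proof (rule lin_hom_vanishes_on_generated[OF F.module_axioms P free_b_lin tensor_relators_closed _
      assms[unfolded tensor_rel_eq]])
  note simps = lin_hom_minus[OF F.module_axioms P free_b_lin] lin_hom_add[OF free_b_lin]
    lin_hom_smult[OF free_b_lin] free_b_gen tensor_gen_closed lin_hom_add[OF bilinear_map_right[OF b]]
    lin_hom_smult[OF bilinear_map_right[OF b]] lin_hom_add[OF bilinear_map_left[OF b]]
    lin_hom_smult[OF bilinear_map_left[OF b]] P.M.minus_eq P.M.r_neg bilinear_map_closed[OF b]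
  fix x assume "x \<in> relators"
  then show "free_b x = \<zero>\<^bsub>P\<^esub>" by (auto simp: simps)
qed

lemma tensor_lift_lin: "tensor_lift K M N P b \<in> lin_hom K (tensor K M N) P"
  unfolding tensor_lift_def tensor_def
  by (rule quot_lift_lin[OF F.module_axioms tensor_rel_submodule P free_b_lin free_b_rel])

lemma tensor_lift_pure:
  "m \<in> carrier M \<Longrightarrow> n \<in> carrier N \<Longrightarrow>
    tensor_lift K M N P b (pure_tensor K M N m n) = b m n"
  unfolding tensor_lift_def pure_tensor_def
  by (simp add: quot_lift_proj[OF F.module_axioms tensor_rel_submodule P free_b_lin free_b_rel] tensor_gen_closed free_b_gen)

end

lemma bilinear_map_of_lin_hom:
  assumes f: "f \<in> lin_hom K (tensor K M N) P"
    and eq: "\<And>m n. m \<in> carrier M \<Longrightarrow> n \<in> carrier N \<Longrightarrow> f (pure_tensor K M N m n) = b m n"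
  shows "bilinear_map K M N P b"
proof (rule bilinear_mapI)
  fix m assume m: "m \<in> carrier M"
  show "b m \<in> lin_hom K N P"
    using lin_hom_compose[OF f bilinear_map_right[OF pure_tensor_bilinear m]] eq[OF m]
      lin_hom_cong[OF N, of "\<lambda>n. f (pure_tensor K M N m n)" "b m" P] by simp
next
  fix n assume n: "n \<in> carrier N"
  show "(\<lambda>m. b m n) \<in> lin_hom K M P"
    using lin_hom_compose[OF f bilinear_map_left[OF pure_tensor_bilinear n]] eq[OF _ n]
      lin_hom_cong[OF M, of "\<lambda>m. f (pure_tensor K M N m n)" "\<lambda>m. b m n" P] by simp
qed

text \<open>
  Recognizes a Sweedler expression as the value of a linear map that is already at hand. No
  bilinearity of \<open>b\<close> has to be shown: it is inherited from \<open>f\<close>.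
\<close>

lemma tensor_lift_unique:
  assumes P: "module K P" and f: "f \<in> lin_hom K (tensor K M N) P"
    and eq: "\<And>m n. m \<in> carrier M \<Longrightarrow> n \<in> carrier N \<Longrightarrow> f (pure_tensor K M N m n) = b m n"
    and t: "t \<in> carrier (tensor K M N)"
  shows "tensor_lift K M N P b t = f t"
  using bilinear_map_of_lin_hom[OF f eq]
  by (intro tensor_hom_eqI[OF P tensor_lift_lin[OF P] f _ t]) (simp_all add: tensor_lift_pure[OF P] eq)

text \<open>
  If the integrand of a Sweedler expression depends linearly on a parameter, so does the expression,
  for every tensor \<open>t\<close>. This is how nested Sweedler expressions are seen to be bilinear.
\<close>

lemma tensor_lift_lin_parameter:
  assumes Q: "module K Q" and P: "module K P"
    and b: "\<And>s. s \<in> carrier Q \<Longrightarrow> bilinear_map K M N P (b s)"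
    and lin: "\<And>m n. m \<in> carrier M \<Longrightarrow> n \<in> carrier N \<Longrightarrow> (\<lambda>s. b s m n) \<in> lin_hom K Q P"
    and t: "t \<in> carrier (tensor K M N)"
  shows "(\<lambda>s. tensor_lift K M N P (b s) t) \<in> lin_hom K Q P"
proof (rule lin_homI)
  interpret Q: module K Q by (rule Q)
  fix s assume s: "s \<in> carrier Q"
  show "tensor_lift K M N P (b s) t \<in> carrier P"
    by (rule lin_hom_closed[OF tensor_lift_lin[OF P b[OF s]] t])
  {
    fix s' assume s': "s' \<in> carrier Q"
    show "tensor_lift K M N P (b (s \<oplus>\<^bsub>Q\<^esub> s')) t =
        tensor_lift K M N P (b s) t \<oplus>\<^bsub>P\<^esub> tensor_lift K M N P (b s') t"
      by (rule tensor_hom_eqI[OF P tensor_lift_lin[OF P b[OF Q.M.a_closed[OF s s']]]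
            lin_hom_plus[OF tensor_is_module P tensor_lift_lin[OF P b[OF s]]
              tensor_lift_lin[OF P b[OF s']]] _ t])
        (simp add: tensor_lift_pure[OF P] b s s' lin_hom_add[OF lin])
  }
  fix a assume a: "a \<in> carrier K"
  show "tensor_lift K M N P (b (a \<odot>\<^bsub>Q\<^esub> s)) t = a \<odot>\<^bsub>P\<^esub> tensor_lift K M N P (b s) t"
    by (rule tensor_hom_eqI[OF P tensor_lift_lin[OF P b[OF Q.smult_closed[OF a s]]]
          lin_hom_scale[OF tensor_is_module P tensor_lift_lin[OF P b[OF s]] a] _ t])
      (simp add: tensor_lift_pure[OF P] b s a lin_hom_smult[OF lin])
qed

end

lemma tensor_map_lin:
  assumes "module K M" "module K N" "module K M'" "module K N'"
    and "f \<in> lin_hom K M M'" "g \<in> lin_hom K N N'"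
  shows "tensor_map K M N M' N' f g \<in> lin_hom K (tensor K M N) (tensor K M' N')"
  unfolding tensor_map_def
  by (intro tensor_lift_lin tensor_is_module assms
      bilinear_map_compose[OF pure_tensor_bilinear assms(5,6) lin_hom_ident])

lemma tensor_map_pure:
  assumes "module K M" "module K N" "module K M'" "module K N'"
    and "f \<in> lin_hom K M M'" "g \<in> lin_hom K N N'" "m \<in> carrier M" "n \<in> carrier N"
  shows "tensor_map K M N M' N' f g (pure_tensor K M N m n) = pure_tensor K M' N' (f m) (g n)"
  unfolding tensor_map_def
  by (intro tensor_lift_pure tensor_is_module assms
      bilinear_map_compose[OF pure_tensor_bilinear assms(5,6) lin_hom_ident])

lemma bilinear_map_parameter_lift:
  assumes M: "module K M" and N: "module K N" and Q: "module K Q" and P: "module K P"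
    and b: "\<And>s. s \<in> carrier Q \<Longrightarrow> bilinear_map K M N P (b s)"
    and lin: "\<And>m n. m \<in> carrier M \<Longrightarrow> n \<in> carrier N \<Longrightarrow> (\<lambda>s. b s m n) \<in> lin_hom K Q P"
  shows "bilinear_map K Q (tensor K M N) P (\<lambda>s. tensor_lift K M N P (b s))"
  by (intro bilinear_mapI tensor_lift_lin tensor_lift_lin_parameter assms)

lemma bilinear_map_swap: "bilinear_map K M N P b \<Longrightarrow> bilinear_map K N M P (\<lambda>n m. b m n)"
  by (auto simp: bilinear_map_def)

context
  fixes K :: "('k, 'r) ring_scheme" and L :: "('k, 'a, 'x) module_scheme"
    and M :: "('k, 'b, 'y) module_scheme" and N :: "('k, 'c, 'z) module_scheme"
  assumes L: "module K L" and M: "module K M" and N: "module K N"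
begin

private abbreviation "A \<equiv> tensor K (tensor K L M) N"
private abbreviation "B \<equiv> tensor K L (tensor K M N)"

lemma tensor_assoc_bilinear:
  "bilinear_map K (tensor K L M) N B
      (\<lambda>t n. tensor_lift K L M B (\<lambda>l m. pure_tensor K L (tensor K M N) l (pure_tensor K M N m n)) t)"
proof (rule bilinear_map_swap, rule bilinear_map_parameter_lift[OF L M N])
  show "module K B" by (intro tensor_is_module L M N)
  fix n assume n: "n \<in> carrier N"
  show "bilinear_map K L M B (\<lambda>l m. pure_tensor K L (tensor K M N) l (pure_tensor K M N m n))"
    by (rule bilinear_map_compose[OF pure_tensor_bilinear[OF L tensor_is_module[OF M N]]
        lin_hom_ident bilinear_map_left[OF pure_tensor_bilinear[OF M N] n] lin_hom_ident])
next
  fix l m assume l: "l \<in> carrier L" and m: "m \<in> carrier M"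
  show "(\<lambda>n. pure_tensor K L (tensor K M N) l (pure_tensor K M N m n)) \<in> lin_hom K N B"
    by (rule lin_hom_compose[OF bilinear_map_right[OF pure_tensor_bilinear[OF L tensor_is_module[OF M N]] l]
        bilinear_map_right[OF pure_tensor_bilinear[OF M N] m]])
qed

lemma tensor_assoc_lin: "tensor_assoc K L M N \<in> lin_hom K A B"
  unfolding tensor_assoc_def
  by (rule tensor_lift_lin[OF _ _ _ tensor_assoc_bilinear]) (intro tensor_is_module L M N)+

lemma tensor_assoc_pure:
  assumes l: "l \<in> carrier L" and m: "m \<in> carrier M" and n: "n \<in> carrier N"
  shows "tensor_assoc K L M N (pure_tensor K (tensor K L M) N (pure_tensor K L M l m) n) =
    pure_tensor K L (tensor K M N) l (pure_tensor K M N m n)"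
proof -
  note mods = L M N tensor_is_module[OF L M] tensor_is_module[OF M N]
    tensor_is_module[OF L tensor_is_module[OF M N]]
  have b: "bilinear_map K L M B (\<lambda>l m. pure_tensor K L (tensor K M N) l (pure_tensor K M N m n))"
    by (rule bilinear_map_compose[OF pure_tensor_bilinear[OF L tensor_is_module[OF M N]]
        lin_hom_ident bilinear_map_left[OF pure_tensor_bilinear[OF M N] n] lin_hom_ident])
  show ?thesis
    unfolding tensor_assoc_def
    by (simp add: tensor_lift_pure[OF _ _ _ tensor_assoc_bilinear] tensor_lift_pure[OF _ _ _ b]
        mods pure_tensor_closed l m n)
qed

end

section \<open>Tensor products over a linear category\<close>

context
  fixes K :: "('k, 'r) ring_scheme" and E :: "('k, 'o, 'm) lin_cat"
    and M :: "('k, 'o, 'm, 'v, 'x) cat_module_scheme"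
    and N :: "('k, 'o, 'm, 'w, 'y) cat_module_scheme"
  assumes K: "cring K"
    and M: "\<And>Z. Z \<in> Ob E \<Longrightarrow> module K (mod_obj M Z)"
    and N: "\<And>Z. Z \<in> Ob E \<Longrightarrow> module K (mod_obj N Z)"
    and M_map: "\<And>Z W f m. \<lbrakk>Z \<in> Ob E; W \<in> Ob E; f \<in> carrier (Hom E Z W);
      m \<in> carrier (mod_obj M W)\<rbrakk> \<Longrightarrow> mod_map M W Z f m \<in> carrier (mod_obj M Z)"
    and N_map: "\<And>Z W f n. \<lbrakk>Z \<in> Ob E; W \<in> Ob E; f \<in> carrier (Hom E Z W);
      n \<in> carrier (mod_obj N Z)\<rbrakk> \<Longrightarrow> mod_map N Z W f n \<in> carrier (mod_obj N W)"
begin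

private abbreviation "T Z \<equiv> tensor K (mod_obj M Z) (mod_obj N Z)"
private abbreviation "S \<equiv> cat_tensor_sum K E M N"
private abbreviation "inc \<equiv> cat_tensor_in K E M N"
private abbreviation "balancing \<equiv> {inc Z (mod_map M W Z f m) n \<ominus>\<^bsub>S\<^esub> inc W m (mod_map N Z W f n) | Z W f m n.
         Z \<in> Ob E \<and> W \<in> Ob E \<and> f \<in> carrier (Hom E Z W) \<and>
         m \<in> carrier (mod_obj M W) \<and> n \<in> carrier (mod_obj N Z)}"

lemma cat_summand_module: "Z \<in> Ob E \<Longrightarrow> module K (T Z)"
  by (intro tensor_is_module M N)

interpretation S: module K S
  unfolding cat_tensor_sum_def by (rule direct_sum_is_module[OF K cat_summand_module])

lemma cat_in_lin:
  "Z \<in> Ob E \<Longrightarrow> direct_sum_in (Ob E) T Z \<in> lin_hom K (T Z) S"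
  unfolding cat_tensor_sum_def by (rule direct_sum_in_lin[OF K cat_summand_module])

lemma cat_tensor_in_closed:
  "Z \<in> Ob E \<Longrightarrow> m \<in> carrier (mod_obj M Z) \<Longrightarrow> n \<in> carrier (mod_obj N Z) \<Longrightarrow> inc Z m n \<in> carrier S"
  unfolding cat_tensor_in_def by (intro lin_hom_closed[OF cat_in_lin] pure_tensor_closed M N)

lemma cat_balancing_closed: "balancing \<subseteq> carrier S"
  by (auto intro!: S.M.minus_closed cat_tensor_in_closed M_map N_map)

lemma cat_tensor_rel_submodule: "submodule (cat_tensor_rel K E M N) K S"
  unfolding cat_tensor_rel_def
  by (rule generated_submodule_is_submodule[OF S.module_axioms cat_balancing_closed])

lemma cat_proj_lin: "(\<lambda>x. cat_tensor_rel K E M N +>\<^bsub>S\<^esub> x) \<in> lin_hom K S (cat_tensor K E M N)"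
  unfolding cat_tensor_def by (rule quot_proj_lin[OF S.module_axioms cat_tensor_rel_submodule])

lemma pure_cat_tensor_closed:
  "Z \<in> Ob E \<Longrightarrow> m \<in> carrier (mod_obj M Z) \<Longrightarrow> n \<in> carrier (mod_obj N Z) \<Longrightarrow>
    pure_cat_tensor K E M N Z m n \<in> carrier (cat_tensor K E M N)"
  unfolding pure_cat_tensor_def by (rule lin_hom_closed[OF cat_proj_lin cat_tensor_in_closed])

text \<open>
  Pure tensors span: the direct sum is spanned by its summands, and each summand by its own pure
  tensors.
\<close>

lemma cat_tensor_hom_eqI:
  assumes P: "module K P" and f: "f \<in> lin_hom K (cat_tensor K E M N) P"
    and g: "g \<in> lin_hom K (cat_tensor K E M N) P"
    and eq: "\<And>Z m n. Z \<in> Ob E \<Longrightarrow> m \<in> carrier (mod_obj M Z) \<Longrightarrow> n \<in> carrier (mod_obj N Z) \<Longrightarrow>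
      f (pure_cat_tensor K E M N Z m n) = g (pure_cat_tensor K E M N Z m n)"
    and t: "t \<in> carrier (cat_tensor K E M N)"
  shows "f t = g t"
proof -
  let ?p = "\<lambda>x. cat_tensor_rel K E M N +>\<^bsub>S\<^esub> x"
  have fp: "(\<lambda>x. f (?p x)) \<in> lin_hom K S P" and gp: "(\<lambda>x. g (?p x)) \<in> lin_hom K S P"
    by (rule lin_hom_compose[OF f cat_proj_lin], rule lin_hom_compose[OF g cat_proj_lin])
  have "f (?p x) = g (?p x)" if x: "x \<in> carrier S" for x
  proof (rule direct_sum_hom_eqI[OF K cat_summand_module P fp[unfolded cat_tensor_sum_def]
        gp[unfolded cat_tensor_sum_def] _ x[unfolded cat_tensor_sum_def],
        folded cat_tensor_sum_def])
    fix Z u assume Z: "Z \<in> Ob E" and u: "u \<in> carrier (T Z)"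
    show "f (?p (direct_sum_in (Ob E) T Z u)) = g (?p (direct_sum_in (Ob E) T Z u))"
      by (rule tensor_hom_eqI[OF M[OF Z] N[OF Z] P lin_hom_compose[OF fp cat_in_lin[OF Z]]
            lin_hom_compose[OF gp cat_in_lin[OF Z]] _ u])
        (use eq[OF Z] in \<open>simp add: pure_cat_tensor_def cat_tensor_in_def\<close>)
  qed
  then show ?thesis
    using quot_hom_eqI[OF S.module_axioms cat_tensor_rel_submodule, of f g] t
    unfolding cat_tensor_def by blast
qed

context
  fixes P :: "('k, 'p, 'z) module_scheme" and b
  assumes P: "module K P"
    and b: "\<And>Z. Z \<in> Ob E \<Longrightarrow> bilinear_map K (mod_obj M Z) (mod_obj N Z) P (b Z)"
    and balanced: "\<And>Z W f m n. \<lbrakk>Z \<in> Ob E; W \<in> Ob E; f \<in> carrier (Hom E Z W);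
      m \<in> carrier (mod_obj M W); n \<in> carrier (mod_obj N Z)\<rbrakk> \<Longrightarrow>
      b Z (mod_map M W Z f m) n = b W m (mod_map N Z W f n)"
begin

interpretation P: module K P by (rule P)

private abbreviation "sum_lift \<equiv> direct_sum_lift (Ob E) T P (\<lambda>Z. tensor_lift K (mod_obj M Z) (mod_obj N Z) P (b Z))"

lemma cat_sum_lift_lin: "sum_lift \<in> lin_hom K S P"
  unfolding cat_tensor_sum_def by (intro direct_sum_lift_lin K cat_summand_module P tensor_lift_lin M N b)

lemma cat_sum_lift_in:
  assumes "Z \<in> Ob E" "m \<in> carrier (mod_obj M Z)" "n \<in> carrier (mod_obj N Z)"
  shows "sum_lift (inc Z m n) = b Z m n"
proof -
  have "sum_lift (inc Z m n) = tensor_lift K (mod_obj M Z) (mod_obj N Z) P (b Z)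
      (pure_tensor K (mod_obj M Z) (mod_obj N Z) m n)"
    unfolding cat_tensor_in_def
    by (rule direct_sum_lift_in[OF K cat_summand_module P])
      (intro tensor_lift_lin M N P b pure_tensor_closed assms | assumption)+
  then show ?thesis using assms by (simp add: tensor_lift_pure M N P b)
qed

text \<open>
  The balancing condition on \<open>b\<close> says that the induced map on the direct sum kills the relations
  \<open>m f \<otimes> n = m \<otimes> f n\<close>.
\<close>

lemma cat_sum_lift_rel:
  assumes "x \<in> cat_tensor_rel K E M N"
  shows "sum_lift x = \<zero>\<^bsub>P\<^esub>"
proof (rule lin_hom_vanishes_on_generated[OF S.module_axioms P cat_sum_lift_lin cat_balancing_closed _
      assms[unfolded cat_tensor_rel_def]])
  fix x assume "x \<in> balancing"
  then show "sum_lift x = \<zero>\<^bsub>P\<^esub>"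
    by (auto simp: lin_hom_minus[OF S.module_axioms P cat_sum_lift_lin] cat_tensor_in_closed M_map N_map cat_sum_lift_in
        balanced P.M.minus_eq P.M.r_neg bilinear_map_closed[OF b])
qed

lemma cat_tensor_lift_lin: "cat_tensor_lift K E M N P b \<in> lin_hom K (cat_tensor K E M N) P"
  unfolding cat_tensor_lift_def cat_tensor_def
  by (rule quot_lift_lin[OF S.module_axioms cat_tensor_rel_submodule P cat_sum_lift_lin cat_sum_lift_rel])

lemma cat_tensor_lift_pure:
  "Z \<in> Ob E \<Longrightarrow> m \<in> carrier (mod_obj M Z) \<Longrightarrow> n \<in> carrier (mod_obj N Z) \<Longrightarrow>
    cat_tensor_lift K E M N P b (pure_cat_tensor K E M N Z m n) = b Z m n"
  unfolding cat_tensor_lift_def pure_cat_tensor_def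
  by (simp add: quot_lift_proj[OF S.module_axioms cat_tensor_rel_submodule P cat_sum_lift_lin cat_sum_lift_rel]
      cat_tensor_in_closed cat_sum_lift_in)

end
end

section \<open>Postcomposition on \<open>Hom(X, Y) \<otimes> C\<close>\<close>

locale comodule_category = linear_category K D + coalgebra K C
  for K :: "('k, 'r) ring_scheme" and D :: "('k, 'o, 'm) lin_cat"
    and C :: "('k, 'c, 'x) coalgebra_scheme" +
  fixes \<rho> :: "'o \<Rightarrow> 'o \<Rightarrow> 'm \<Rightarrow> ('k, 'm, 'c) tensor"
  assumes Hom_comodule: "\<lbrakk>X \<in> Ob D; Y \<in> Ob D\<rbrakk> \<Longrightarrow> right_comodule K C (Hom D X Y) (\<rho> X Y)"
begin

abbreviation HC :: "'o \<Rightarrow> 'o \<Rightarrow> ('k, ('k, 'm, 'c) tensor) module"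
  where "HC X Y \<equiv> tensor K (Hom D X Y) C"

text \<open>
  The action of \<open>g\<close> written \<open>g \<cdot> t\<close> in the introduction. The second factor is arbitrary because
  the comultiplication axiom needs it both for \<open>C\<close> and for \<open>C \<otimes> C\<close>.
\<close>

abbreviation postcomp ::
  "('k, 'p, 'z) module_scheme \<Rightarrow> 'o \<Rightarrow> 'o \<Rightarrow> 'o \<Rightarrow> 'm \<Rightarrow> ('k, 'm, 'p) tensor \<Rightarrow> ('k, 'm, 'p) tensor"
  where "postcomp P X Y Z g \<equiv>
    tensor_map K (Hom D X Y) P (Hom D X Z) P (comp D X Y Z g) (\<lambda>p. p)"

lemma K_cring: "cring K"
  by (rule R.is_cring)

lemma C_module: "module K C"
  by (rule module_axioms)

lemma CC_module: "module K (tensor K C C)"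
  by (intro tensor_is_module C_module)

lemma HC_module: "X \<in> Ob D \<Longrightarrow> Y \<in> Ob D \<Longrightarrow> module K (HC X Y)"
  by (intro tensor_is_module Hom_module C_module)

lemma comp_closed:
  "\<lbrakk>X \<in> Ob D; Y \<in> Ob D; Z \<in> Ob D; f \<in> carrier (Hom D X Y); g \<in> carrier (Hom D Y Z)\<rbrakk> \<Longrightarrow>
    comp D X Y Z g f \<in> carrier (Hom D X Z)"
  using lin_hom_closed[OF comp_left_lin] .

lemma rho_lin: "X \<in> Ob D \<Longrightarrow> Y \<in> Ob D \<Longrightarrow> \<rho> X Y \<in> lin_hom K (Hom D X Y) (HC X Y)"
  using right_comodule.coaction_lin[OF Hom_comodule] .

lemma rho_closed:
  "X \<in> Ob D \<Longrightarrow> Y \<in> Ob D \<Longrightarrow> f \<in> carrier (Hom D X Y) \<Longrightarrow> \<rho> X Y f \<in> carrier (HC X Y)"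
  using lin_hom_closed[OF rho_lin] .

context
  fixes P :: "('k, 'p, 'z) module_scheme" and X Y Z :: 'o
  assumes P: "module K P" and ob: "X \<in> Ob D" "Y \<in> Ob D" "Z \<in> Ob D"
begin

lemma postcomp_lin:
  "g \<in> carrier (Hom D Y Z) \<Longrightarrow>
    postcomp P X Y Z g \<in> lin_hom K (tensor K (Hom D X Y) P) (tensor K (Hom D X Z) P)"
  by (intro tensor_map_lin Hom_module P ob comp_left_lin lin_hom_ident)

lemma postcomp_closed:
  "g \<in> carrier (Hom D Y Z) \<Longrightarrow> t \<in> carrier (tensor K (Hom D X Y) P) \<Longrightarrow>
    postcomp P X Y Z g t \<in> carrier (tensor K (Hom D X Z) P)"
  using lin_hom_closed[OF postcomp_lin] .

lemma postcomp_pure: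
  "g \<in> carrier (Hom D Y Z) \<Longrightarrow> f \<in> carrier (Hom D X Y) \<Longrightarrow> p \<in> carrier P \<Longrightarrow>
    postcomp P X Y Z g (pure_tensor K (Hom D X Y) P f p) =
    pure_tensor K (Hom D X Z) P (comp D X Y Z g f) p"
  by (intro tensor_map_pure Hom_module P ob comp_left_lin lin_hom_ident)

lemma postcomp_bilinear:
  "bilinear_map K (Hom D Y Z) (tensor K (Hom D X Y) P) (tensor K (Hom D X Z) P) (postcomp P X Y Z)"
  unfolding tensor_map_def
proof (intro bilinear_map_parameter_lift Hom_module P ob tensor_is_module)
  note pure = pure_tensor_bilinear[OF Hom_module[OF ob(1,3)] P]
  fix g assume g: "g \<in> carrier (Hom D Y Z)"
  show "bilinear_map K (Hom D X Y) P (tensor K (Hom D X Z) P)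
      (\<lambda>f p. pure_tensor K (Hom D X Z) P (comp D X Y Z g f) p)"
    by (rule bilinear_map_compose[OF pure comp_left_lin[OF ob g] lin_hom_ident lin_hom_ident])
next
  note pure = pure_tensor_bilinear[OF Hom_module[OF ob(1,3)] P]
  fix f p assume f: "f \<in> carrier (Hom D X Y)" and p: "p \<in> carrier P"
  show "(\<lambda>g. pure_tensor K (Hom D X Z) P (comp D X Y Z g f) p)
      \<in> lin_hom K (Hom D Y Z) (tensor K (Hom D X Z) P)"
    by (rule lin_hom_compose[OF bilinear_map_left[OF pure p] comp_right_lin[OF ob f]])
qed

end

lemma postcomp_ident:
  assumes P: "module K P" and ob: "X \<in> Ob D" "Y \<in> Ob D"
    and t: "t \<in> carrier (tensor K (Hom D X Y) P)"
  shows "postcomp P X Y Y (ident D Y) t = t"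
  by (rule tensor_hom_eqI[OF Hom_module[OF ob] P tensor_is_module[OF Hom_module[OF ob] P]
        postcomp_lin[OF P ob ob(2) ident_closed[OF ob(2)]] lin_hom_ident _ t])
    (simp add: postcomp_pure P ob ident_closed comp_ident_left)

lemma postcomp_comp:
  assumes P: "module K P" and ob: "W \<in> Ob D" "X \<in> Ob D" "Y \<in> Ob D" "Z \<in> Ob D"
    and g: "g \<in> carrier (Hom D X Y)" and h: "h \<in> carrier (Hom D Y Z)"
    and t: "t \<in> carrier (tensor K (Hom D W X) P)"
  shows "postcomp P W Y Z h (postcomp P W X Y g t) = postcomp P W X Z (comp D X Y Z h g) t"
proof -
  note hg = comp_closed[OF ob(2-4) g h]
  show ?thesis
    by (rule tensor_hom_eqI[OF Hom_module[OF ob(1,2)] P tensor_is_module[OF Hom_module[OF ob(1,4)] P]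
          lin_hom_compose[OF postcomp_lin[OF P ob(1,3,4) h] postcomp_lin[OF P ob(1,2,3) g]]
          postcomp_lin[OF P ob(1,2,4) hg] _ t])
      (simp add: postcomp_pure P ob g h hg comp_closed comp_assoc)
qed

end

section \<open>Consequences of the Galois condition\<close>

locale galois_comodule_category = comodule_category K D C \<rho>
  for K :: "('k, 'r) ring_scheme" and D :: "('k, 'o, 'm) lin_cat"
    and C :: "('k, 'c, 'x) coalgebra_scheme"
    and \<rho> :: "'o \<Rightarrow> 'o \<Rightarrow> 'm \<Rightarrow> ('k, 'm, 'c) tensor" +
  fixes E :: "'o \<Rightarrow> 'o \<Rightarrow> 'm set"
  assumes galois: "galois_extension K D C \<rho> E"
begin

text \<open>
  \<open>Hom(-, W) \<otimes>\<^sub>E Hom(Y, -)\<close>, the source of the canonical map.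
\<close>

abbreviation bal_tensor :: "'o \<Rightarrow> 'o \<Rightarrow> ('k, ('k, 'o, 'm, 'm) cat_tensor) module"
  where "bal_tensor Y W \<equiv> cat_tensor K (restrict_Hom D E) (right_hom D W) (left_hom D Y)"

abbreviation pure_bal :: "'o \<Rightarrow> 'o \<Rightarrow> 'o \<Rightarrow> 'm \<Rightarrow> 'm \<Rightarrow> ('k, 'o, 'm, 'm) cat_tensor"
  where "pure_bal Y W \<equiv> pure_cat_tensor K (restrict_Hom D E) (right_hom D W) (left_hom D Y)"

lemma coinvariant_closed:
  "X \<in> Ob D \<Longrightarrow> Y \<in> Ob D \<Longrightarrow> e \<in> E X Y \<Longrightarrow> e \<in> carrier (Hom D X Y)"
  using galois_extension.eq_coinvariants[OF galois] by (simp add: coinvariants_def)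

lemma rho_coinvariant:
  assumes "X \<in> Ob D" "Y \<in> Ob D" "Z \<in> Ob D" "e \<in> E X Y" "f \<in> carrier (Hom D Z X)"
  shows "\<rho> Z Y (comp D Z X Y e f) = postcomp C Z X Y e (\<rho> Z X f)"
  using assms galois_extension.eq_coinvariants[OF galois, of X Y] by (simp add: coinvariants_def)

lemma restrict_Hom_simps:
  "Ob (restrict_Hom D E) = Ob D"
  "carrier (Hom (restrict_Hom D E) X Y) = E X Y"
  by (simp_all add: restrict_Hom_def)

lemma right_hom_simps:
  "mod_obj (right_hom D Y) X = Hom D X Y"
  "mod_map (right_hom D Y) X Z f g = comp D Z X Y g f"
  by (simp_all add: right_hom_def)

lemma left_hom_simps:
  "mod_obj (left_hom D X) Y = Hom D X Y"
  "mod_map (left_hom D X) Y Z g f = comp D X Y Z g f"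
  by (simp_all add: left_hom_def)

lemmas rep_simps = restrict_Hom_simps right_hom_simps left_hom_simps

context
  fixes Y W :: 'o
  assumes ob: "Y \<in> Ob D" "W \<in> Ob D"
begin

lemma bal_premises:
  "Z \<in> Ob (restrict_Hom D E) \<Longrightarrow> module K (mod_obj (right_hom D W) Z)"
  "Z \<in> Ob (restrict_Hom D E) \<Longrightarrow> module K (mod_obj (left_hom D Y) Z)"
  "\<lbrakk>Z \<in> Ob (restrict_Hom D E); Z' \<in> Ob (restrict_Hom D E); e \<in> carrier (Hom (restrict_Hom D E) Z Z');
    h \<in> carrier (mod_obj (right_hom D W) Z')\<rbrakk> \<Longrightarrow>
    mod_map (right_hom D W) Z' Z e h \<in> carrier (mod_obj (right_hom D W) Z)"
  "\<lbrakk>Z \<in> Ob (restrict_Hom D E); Z' \<in> Ob (restrict_Hom D E); e \<in> carrier (Hom (restrict_Hom D E) Z Z');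
    g' \<in> carrier (mod_obj (left_hom D Y) Z)\<rbrakk> \<Longrightarrow>
    mod_map (left_hom D Y) Z Z' e g' \<in> carrier (mod_obj (left_hom D Y) Z')"
  by (simp_all add: rep_simps ob Hom_module comp_closed coinvariant_closed)

lemma bal_hom_eqI:
  assumes "module K P" "f \<in> lin_hom K (bal_tensor Y W) P" "g \<in> lin_hom K (bal_tensor Y W) P"
    and "\<And>Z h g'. Z \<in> Ob D \<Longrightarrow> h \<in> carrier (Hom D Z W) \<Longrightarrow> g' \<in> carrier (Hom D Y Z) \<Longrightarrow>
      f (pure_bal Y W Z h g') = g (pure_bal Y W Z h g')"
    and "t \<in> carrier (bal_tensor Y W)"
  shows "f t = g t"
  by (rule cat_tensor_hom_eqI[OF K_cring bal_premises assms(1-3) _ assms(5)]; (assumption)?)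
    (unfold rep_simps, rule assms(4))

context
  fixes X :: 'o and \<phi> :: "'o \<Rightarrow> 'm \<Rightarrow> ('k, 'm, 'c) tensor"
  assumes X: "X \<in> Ob D"
    and \<phi>: "\<And>Z. Z \<in> Ob D \<Longrightarrow> \<phi> Z \<in> lin_hom K (Hom D Y Z) (HC X Z)"
    and \<phi>_coinvariant: "\<And>Z Z' e g'. \<lbrakk>Z \<in> Ob D; Z' \<in> Ob D; e \<in> E Z Z'; g' \<in> carrier (Hom D Y Z)\<rbrakk> \<Longrightarrow>
      \<phi> Z' (comp D Y Z Z' e g') = postcomp C X Z Z' e (\<phi> Z g')"
begin

private abbreviation "lift \<equiv> cat_tensor_lift K (restrict_Hom D E) (right_hom D W) (left_hom D Y)
  (HC X W) (\<lambda>Z h g'. postcomp C X Z W h (\<phi> Z g'))"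

lemma bal_summand_bilinear:
  assumes Z: "Z \<in> Ob D"
  shows "bilinear_map K (Hom D Z W) (Hom D Y Z) (HC X W) (\<lambda>h g'. postcomp C X Z W h (\<phi> Z g'))"
  by (rule bilinear_map_compose[OF postcomp_bilinear[OF C_module X Z ob(2)] lin_hom_ident \<phi>[OF Z]
        lin_hom_ident])

text \<open>
  Maps of the form \<open>h \<otimes> g' \<mapsto> h \<cdot> \<phi>(g')\<close> descend to the tensor product over the coinvariants when
  \<open>\<phi>\<close> commutes with postcomposition by coinvariants. The choice \<open>\<phi> = \<rho>\<close> yields the canonical map,
  the choice \<open>\<phi>(g') = \<rho>(g' f)\<close> yields the map from which the entwining is built.
\<close>

lemma bal_summand_balanced:
  assumes "Z \<in> Ob D" "Z' \<in> Ob D" "e \<in> E Z Z'" "h \<in> carrier (Hom D Z' W)" "g' \<in> carrier (Hom D Y Z)"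
  shows "postcomp C X Z W (comp D Z Z' W h e) (\<phi> Z g') =
    postcomp C X Z' W h (\<phi> Z' (comp D Y Z Z' e g'))"
  using assms lin_hom_closed[OF \<phi>] coinvariant_closed[of Z Z' e]
  by (simp add: \<phi>_coinvariant postcomp_comp C_module X ob)

lemma bal_lift_lin: "lift \<in> lin_hom K (bal_tensor Y W) (HC X W)"
  by (rule cat_tensor_lift_lin[OF K_cring bal_premises HC_module[OF X ob(2)]]; (assumption)?)
    (unfold rep_simps, rule bal_summand_bilinear, assumption, rule bal_summand_balanced)

lemma bal_lift_pure:
  assumes "Z \<in> Ob D" "h \<in> carrier (Hom D Z W)" "g' \<in> carrier (Hom D Y Z)"
  shows "lift (pure_bal Y W Z h g') = postcomp C X Z W h (\<phi> Z g')"
  by (rule cat_tensor_lift_pure[OF K_cring bal_premises HC_module[OF X ob(2)]]; (assumption)?)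
    (unfold rep_simps, rule bal_summand_bilinear, assumption, (rule bal_summand_balanced; assumption),
      rule assms(1), rule assms(2), rule assms(3))

end

lemma can_lin: "can K D C \<rho> E Y W \<in> lin_hom K (bal_tensor Y W) (HC Y W)"
  unfolding can_def by (rule bal_lift_lin[OF ob(1) rho_lin[OF ob(1)] rho_coinvariant]) (auto simp: ob)

lemma can_pure:
  assumes "Z \<in> Ob D" "h \<in> carrier (Hom D Z W)" "g' \<in> carrier (Hom D Y Z)"
  shows "can K D C \<rho> E Y W (pure_bal Y W Z h g') = postcomp C Y Z W h (\<rho> Y Z g')"
  unfolding can_def
  by (rule bal_lift_pure[OF ob(1) rho_lin[OF ob(1)] rho_coinvariant]) (auto simp: ob assms)

lemma can_inverse:
  obtains \<theta> where "\<theta> \<in> lin_hom K (HC Y W) (bal_tensor Y W)"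
    and "\<And>x. x \<in> carrier (bal_tensor Y W) \<Longrightarrow> \<theta> (can K D C \<rho> E Y W x) = x"
    and "\<And>t. t \<in> carrier (HC Y W) \<Longrightarrow> can K D C \<rho> E Y W (\<theta> t) = t"
proof -
  have mods: "mod_obj (hom_tensor_hom K D C \<rho> E Y) W = bal_tensor Y W"
    "mod_obj (hom_tensor_C K D C Y) W = HC Y W"
    by (simp_all add: hom_tensor_hom_def hom_tensor_C_def Let_def)
  obtain \<Theta> where
    \<Theta>: "cat_comodule_hom K D C (hom_tensor_C K D C Y) (hom_tensor_hom K D C \<rho> E Y) \<Theta>"
    and inv: "\<forall>V\<in>Ob D.
      (\<forall>x\<in>carrier (mod_obj (hom_tensor_hom K D C \<rho> E Y) V). \<Theta> V (can K D C \<rho> E Y V x) = x) \<and>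
      (\<forall>t\<in>carrier (mod_obj (hom_tensor_C K D C Y) V). can K D C \<rho> E Y V (\<Theta> V t) = t)"
    using galois_extension.can_iso[OF galois ob(1)] unfolding cat_comodule_iso_def by blast
  have "\<Theta> W \<in> lin_hom K (HC Y W) (bal_tensor Y W)"
    using cat_comodule_hom.hom_lin[OF \<Theta>(1) ob(2)] by (simp add: mods)
  then show ?thesis using bspec[OF inv ob(2)] that by (simp add: mods)
qed

text \<open>
  Surjectivity of the canonical map: its values \<open>h \<cdot> \<rho>(g')\<close> on pure tensors span
  \<open>Hom(Y, W) \<otimes> C\<close>.
\<close>

lemma HC_hom_eqI:
  assumes P: "module K P" and f: "f \<in> lin_hom K (HC Y W) P" and g: "g \<in> lin_hom K (HC Y W) P"
    and eq: "\<And>Z h g'. Z \<in> Ob D \<Longrightarrow> h \<in> carrier (Hom D Z W) \<Longrightarrow> g' \<in> carrier (Hom D Y Z) \<Longrightarrow>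
      f (postcomp C Y Z W h (\<rho> Y Z g')) = g (postcomp C Y Z W h (\<rho> Y Z g'))"
    and t: "t \<in> carrier (HC Y W)"
  shows "f t = g t"
proof -
  obtain \<theta> where \<theta>: "\<theta> \<in> lin_hom K (HC Y W) (bal_tensor Y W)"
    and can_\<theta>: "\<And>t. t \<in> carrier (HC Y W) \<Longrightarrow> can K D C \<rho> E Y W (\<theta> t) = t"
    by (rule can_inverse) blast
  have "f (can K D C \<rho> E Y W (\<theta> t)) = g (can K D C \<rho> E Y W (\<theta> t))"
    by (rule bal_hom_eqI[OF P lin_hom_compose[OF f can_lin] lin_hom_compose[OF g can_lin] _
          lin_hom_closed[OF \<theta> t]]) (simp add: can_pure eq)
  then show ?thesis by (simp add: can_\<theta> t)
qed

text \<open>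
  Injectivity of the canonical map: \<open>h \<cdot> \<rho>(g') \<mapsto> h \<cdot> \<rho>(g' f)\<close> is well defined, being the composite
  of the inverse of the canonical map with the map induced by \<open>h \<otimes> g' \<mapsto> h \<cdot> \<rho>(g' f)\<close>.
\<close>

lemma precomp_exists:
  assumes X: "X \<in> Ob D" and f: "f \<in> carrier (Hom D X Y)"
  shows "\<exists>A. A \<in> lin_hom K (HC Y W) (HC X W) \<and>
    (\<forall>Z\<in>Ob D. \<forall>h\<in>carrier (Hom D Z W). \<forall>g'\<in>carrier (Hom D Y Z).
      A (postcomp C Y Z W h (\<rho> Y Z g')) = postcomp C X Z W h (\<rho> X Z (comp D X Y Z g' f)))"
proof -
  define \<phi> where "\<phi> Z g' = \<rho> X Z (comp D X Y Z g' f)" for Z g'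
  define B where "B = cat_tensor_lift K (restrict_Hom D E) (right_hom D W) (left_hom D Y)
    (HC X W) (\<lambda>Z h g'. postcomp C X Z W h (\<phi> Z g'))"
  have \<phi>_lin: "\<phi> Z \<in> lin_hom K (Hom D Y Z) (HC X Z)" if "Z \<in> Ob D" for Z
    unfolding \<phi>_def
    by (rule lin_hom_compose[OF rho_lin[OF X that] comp_right_lin[OF X ob(1) that f]])
  have \<phi>_coinv: "\<phi> Z' (comp D Y Z Z' e g') = postcomp C X Z Z' e (\<phi> Z g')"
    if "Z \<in> Ob D" "Z' \<in> Ob D" "e \<in> E Z Z'" "g' \<in> carrier (Hom D Y Z)" for Z Z' e g'
    using that f X ob coinvariant_closed[of Z Z' e]
    by (simp add: \<phi>_def comp_assoc comp_closed rho_coinvariant)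
  have B: "B \<in> lin_hom K (bal_tensor Y W) (HC X W)"
    unfolding B_def by (rule bal_lift_lin[OF X \<phi>_lin \<phi>_coinv])
  obtain \<theta> where \<theta>: "\<theta> \<in> lin_hom K (HC Y W) (bal_tensor Y W)"
    and \<theta>_can: "\<And>x. x \<in> carrier (bal_tensor Y W) \<Longrightarrow> \<theta> (can K D C \<rho> E Y W x) = x"
    by (rule can_inverse) blast
  have "B (\<theta> (postcomp C Y Z W h (\<rho> Y Z g'))) = postcomp C X Z W h (\<phi> Z g')"
    if "Z \<in> Ob D" "h \<in> carrier (Hom D Z W)" "g' \<in> carrier (Hom D Y Z)" for Z h g'
  proof -
    have "pure_bal Y W Z h g' \<in> carrier (bal_tensor Y W)"
      by (rule pure_cat_tensor_closed[OF K_cring bal_premises]; (assumption)?) (unfold rep_simps, (rule that)+)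
    then have "\<theta> (postcomp C Y Z W h (\<rho> Y Z g')) = pure_bal Y W Z h g'"
      using \<theta>_can can_pure[OF that] by metis
    moreover have "B (pure_bal Y W Z h g') = postcomp C X Z W h (\<phi> Z g')"
      unfolding B_def by (rule bal_lift_pure[OF X \<phi>_lin \<phi>_coinv that])
    ultimately show ?thesis by simp
  qed
  then show ?thesis
    using lin_hom_compose[OF B \<theta>] unfolding \<phi>_def by (intro exI[of _ "\<lambda>t. B (\<theta> t)"]) blast
qed

end

section \<open>The right action of morphisms on \<open>Hom(Y, W) \<otimes> C\<close>\<close>

text \<open>
  The map \<open>t \<mapsto> t \<triangleleft> f\<close> of the introduction. On \<open>Hom(Y, W) \<otimes> C\<close> the choice is forced, by
  \<open>HC_hom_eqI\<close>.
\<close>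

definition precomp :: "'o \<Rightarrow> 'o \<Rightarrow> 'o \<Rightarrow> 'm \<Rightarrow> ('k, 'm, 'c) tensor \<Rightarrow> ('k, 'm, 'c) tensor"
  where "precomp X Y W f = (SOME A. A \<in> lin_hom K (HC Y W) (HC X W) \<and>
    (\<forall>Z\<in>Ob D. \<forall>h\<in>carrier (Hom D Z W). \<forall>g\<in>carrier (Hom D Y Z).
      A (postcomp C Y Z W h (\<rho> Y Z g)) = postcomp C X Z W h (\<rho> X Z (comp D X Y Z g f))))"

lemma precomp_spec:
  assumes "X \<in> Ob D" "Y \<in> Ob D" "W \<in> Ob D" "f \<in> carrier (Hom D X Y)"
  shows "precomp X Y W f \<in> lin_hom K (HC Y W) (HC X W) \<and>
    (\<forall>Z\<in>Ob D. \<forall>h\<in>carrier (Hom D Z W). \<forall>g\<in>carrier (Hom D Y Z).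
      precomp X Y W f (postcomp C Y Z W h (\<rho> Y Z g)) = postcomp C X Z W h (\<rho> X Z (comp D X Y Z g f)))"
  unfolding precomp_def by (rule someI_ex[OF precomp_exists[OF assms(2,3,1,4)]])

context
  fixes X Y W :: 'o
  assumes ob: "X \<in> Ob D" "Y \<in> Ob D" "W \<in> Ob D"
begin

lemma precomp_lin: "f \<in> carrier (Hom D X Y) \<Longrightarrow> precomp X Y W f \<in> lin_hom K (HC Y W) (HC X W)"
  using precomp_spec[OF ob] by blast

lemma precomp_closed:
  "f \<in> carrier (Hom D X Y) \<Longrightarrow> t \<in> carrier (HC Y W) \<Longrightarrow> precomp X Y W f t \<in> carrier (HC X W)"
  using lin_hom_closed[OF precomp_lin] .

lemma precomp_postcomp_rho:
  "\<lbrakk>f \<in> carrier (Hom D X Y); Z \<in> Ob D; h \<in> carrier (Hom D Z W); g \<in> carrier (Hom D Y Z)\<rbrakk> \<Longrightarrow>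
    precomp X Y W f (postcomp C Y Z W h (\<rho> Y Z g)) = postcomp C X Z W h (\<rho> X Z (comp D X Y Z g f))"
  using precomp_spec[OF ob] by blast

lemma precomp_rho:
  assumes f: "f \<in> carrier (Hom D X Y)" and g: "g \<in> carrier (Hom D Y W)"
  shows "precomp X Y W f (\<rho> Y W g) = \<rho> X W (comp D X Y W g f)"
  using precomp_postcomp_rho[OF f ob(3) ident_closed[OF ob(3)] g] f g
  by (simp add: postcomp_ident C_module ob rho_closed comp_closed)

text \<open>
  Linearity in \<open>f\<close>, functoriality in \<open>f\<close>, and the uniqueness of the entwining all follow from this
  characterization.
\<close>

lemma precomp_unique:
  assumes f: "f \<in> carrier (Hom D X Y)" and A: "A \<in> lin_hom K (HC Y W) (HC X W)"
    and eq: "\<And>Z h g. Z \<in> Ob D \<Longrightarrow> h \<in> carrier (Hom D Z W) \<Longrightarrow> g \<in> carrier (Hom D Y Z) \<Longrightarrow>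
      A (postcomp C Y Z W h (\<rho> Y Z g)) = postcomp C X Z W h (\<rho> X Z (comp D X Y Z g f))"
    and t: "t \<in> carrier (HC Y W)"
  shows "precomp X Y W f t = A t"
  by (rule HC_hom_eqI[OF ob(2,3) HC_module[OF ob(1,3)] precomp_lin[OF f] A _ t])
    (simp add: precomp_postcomp_rho f eq)

lemma precomp_bilinear:
  "bilinear_map K (Hom D X Y) (HC Y W) (HC X W) (precomp X Y W)"
proof (rule bilinear_mapI)
  interpret H: module K "Hom D X Y" by (rule Hom_module[OF ob(1,2)])
  note HC = HC_module[OF ob(2,3)] HC_module[OF ob(1,3)]
  fix t assume t: "t \<in> carrier (HC Y W)"
  show "(\<lambda>f. precomp X Y W f t) \<in> lin_hom K (Hom D X Y) (HC X W)"
  proof (rule lin_homI)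
    fix f f' assume f: "f \<in> carrier (Hom D X Y)" and f': "f' \<in> carrier (Hom D X Y)"
    show "precomp X Y W (f \<oplus>\<^bsub>Hom D X Y\<^esub> f') t =
        precomp X Y W f t \<oplus>\<^bsub>HC X W\<^esub> precomp X Y W f' t"
    proof (rule precomp_unique[OF H.M.a_closed[OF f f']
          lin_hom_plus[OF HC precomp_lin[OF f] precomp_lin[OF f']] _ t])
      fix Z h g assume Z: "Z \<in> Ob D" and h: "h \<in> carrier (Hom D Z W)" and g: "g \<in> carrier (Hom D Y Z)"
      have gf: "comp D X Y Z g f \<in> carrier (Hom D X Z)" "comp D X Y Z g f' \<in> carrier (Hom D X Z)"
        using Z g f f' ob by (simp_all add: comp_closed)
      have "\<rho> X Z (comp D X Y Z g (f \<oplus>\<^bsub>Hom D X Y\<^esub> f')) =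
          \<rho> X Z (comp D X Y Z g f) \<oplus>\<^bsub>HC X Z\<^esub> \<rho> X Z (comp D X Y Z g f')"
        using lin_hom_add[OF comp_left_lin[OF ob(1,2) Z g] f f'] lin_hom_add[OF rho_lin[OF ob(1) Z] gf]
        by simp
      then show "precomp X Y W f (postcomp C Y Z W h (\<rho> Y Z g)) \<oplus>\<^bsub>HC X W\<^esub>
          precomp X Y W f' (postcomp C Y Z W h (\<rho> Y Z g)) =
          postcomp C X Z W h (\<rho> X Z (comp D X Y Z g (f \<oplus>\<^bsub>Hom D X Y\<^esub> f')))"
        using lin_hom_add[OF postcomp_lin[OF C_module ob(1) Z ob(3) h]
            rho_closed[OF ob(1) Z gf(1)] rho_closed[OF ob(1) Z gf(2)]]
        by (simp add: precomp_postcomp_rho f f' Z h g)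
    qed
  next
    fix a f assume a: "a \<in> carrier K" and f: "f \<in> carrier (Hom D X Y)"
    show "precomp X Y W (a \<odot>\<^bsub>Hom D X Y\<^esub> f) t = a \<odot>\<^bsub>HC X W\<^esub> precomp X Y W f t"
    proof (rule precomp_unique[OF H.smult_closed[OF a f] lin_hom_scale[OF HC precomp_lin[OF f] a] _ t])
      fix Z h g assume Z: "Z \<in> Ob D" and h: "h \<in> carrier (Hom D Z W)" and g: "g \<in> carrier (Hom D Y Z)"
      have gf: "comp D X Y Z g f \<in> carrier (Hom D X Z)"
        using Z g f ob by (simp add: comp_closed)
      have "\<rho> X Z (comp D X Y Z g (a \<odot>\<^bsub>Hom D X Y\<^esub> f)) = a \<odot>\<^bsub>HC X Z\<^esub> \<rho> X Z (comp D X Y Z g f)"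
        using lin_hom_smult[OF comp_left_lin[OF ob(1,2) Z g] a f]
          lin_hom_smult[OF rho_lin[OF ob(1) Z] a gf] by simp
      then show "a \<odot>\<^bsub>HC X W\<^esub> precomp X Y W f (postcomp C Y Z W h (\<rho> Y Z g)) =
          postcomp C X Z W h (\<rho> X Z (comp D X Y Z g (a \<odot>\<^bsub>Hom D X Y\<^esub> f)))"
        using lin_hom_smult[OF postcomp_lin[OF C_module ob(1) Z ob(3) h] a rho_closed[OF ob(1) Z gf]]
        by (simp add: precomp_postcomp_rho f Z h g)
    qed
  qed (rule precomp_closed[OF _ t])
qed (rule precomp_lin)

end

lemma precomp_postcomp:
  assumes ob: "X \<in> Ob D" "Y \<in> Ob D" "W \<in> Ob D" "V \<in> Ob D"
    and f: "f \<in> carrier (Hom D X Y)" and k: "k \<in> carrier (Hom D W V)"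
    and t: "t \<in> carrier (HC Y W)"
  shows "precomp X Y V f (postcomp C Y W V k t) = postcomp C X W V k (precomp X Y W f t)"
proof (rule HC_hom_eqI[OF ob(2,3) HC_module[OF ob(1,4)]
      lin_hom_compose[OF precomp_lin[OF ob(1,2,4) f] postcomp_lin[OF C_module ob(2-4) k]]
      lin_hom_compose[OF postcomp_lin[OF C_module ob(1,3,4) k] precomp_lin[OF ob(1-3) f]] _ t])
  fix Z h g assume Z: "Z \<in> Ob D" and h: "h \<in> carrier (Hom D Z W)" and g: "g \<in> carrier (Hom D Y Z)"
  show "precomp X Y V f (postcomp C Y W V k (postcomp C Y Z W h (\<rho> Y Z g))) =
      postcomp C X W V k (precomp X Y W f (postcomp C Y Z W h (\<rho> Y Z g)))"
    by (simp add: precomp_postcomp_rho postcomp_comp C_module comp_closed rho_closed ob Z h g k f)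
qed

text \<open>
  Both sides send \<open>h \<cdot> \<rho>(k)\<close> to \<open>h \<cdot> \<rho>(k g f)\<close>.
\<close>

lemma precomp_comp:
  assumes ob: "V \<in> Ob D" "X \<in> Ob D" "Y \<in> Ob D" "W \<in> Ob D"
    and f: "f \<in> carrier (Hom D V X)" and g: "g \<in> carrier (Hom D X Y)" and t: "t \<in> carrier (HC Y W)"
  shows "precomp V Y W (comp D V X Y g f) t = precomp V X W f (precomp X Y W g t)"
  by (rule precomp_unique[OF ob(1,3,4) comp_closed[OF ob(1-3) f g]
        lin_hom_compose[OF precomp_lin[OF ob(1,2,4) f] precomp_lin[OF ob(2-4) g]] _ t])
    (simp add: precomp_postcomp_rho ob f g comp_closed comp_assoc)

lemma precomp_ident:
  assumes ob: "Y \<in> Ob D" "W \<in> Ob D" and t: "t \<in> carrier (HC Y W)"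
  shows "precomp Y Y W (ident D Y) t = t"
  by (rule precomp_unique[OF ob(1,1,2) ident_closed[OF ob(1)] lin_hom_ident _ t])
    (simp add: ob comp_ident_right)

section \<open>The entwining, its compatibility with composition and with identities\<close>

lemma pure_ident_lin:
  "Y \<in> Ob D \<Longrightarrow> (\<lambda>c. pure_tensor K (Hom D Y Y) C (ident D Y) c) \<in> lin_hom K C (HC Y Y)"
  by (rule bilinear_map_right[OF pure_tensor_bilinear[OF Hom_module C_module] ident_closed])

lemma pure_ident_closed:
  "Y \<in> Ob D \<Longrightarrow> c \<in> carrier C \<Longrightarrow> pure_tensor K (Hom D Y Y) C (ident D Y) c \<in> carrier (HC Y Y)"
  using lin_hom_closed[OF pure_ident_lin] .

text \<open>
  The only candidate, since \<open>\<psi>(c \<otimes> f) = (id \<otimes> c) \<triangleleft> f\<close>. The restrictions make it extensional, as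
  equality of entwining structures demands.
\<close>

definition entwining :: "'o \<Rightarrow> 'o \<Rightarrow> ('k, 'c, 'm) tensor \<Rightarrow> ('k, 'm, 'c) tensor"
  where "entwining = (\<lambda>X\<in>Ob D. \<lambda>Y\<in>Ob D. \<lambda>t\<in>carrier (tensor K C (Hom D X Y)).
    tensor_lift K C (Hom D X Y) (HC X Y)
      (\<lambda>c f. precomp X Y Y f (pure_tensor K (Hom D Y Y) C (ident D Y) c)) t)"

context
  fixes X Y :: 'o
  assumes ob: "X \<in> Ob D" "Y \<in> Ob D"
begin

lemma entwining_bilinear:
  "bilinear_map K C (Hom D X Y) (HC X Y)
    (\<lambda>c f. precomp X Y Y f (pure_tensor K (Hom D Y Y) C (ident D Y) c))"
  by (rule bilinear_map_compose[OF bilinear_map_swap[OF precomp_bilinear[OF ob ob(2)]]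
        pure_ident_lin[OF ob(2)] lin_hom_ident lin_hom_ident])

lemma entwining_lin: "entwining X Y \<in> lin_hom K (tensor K C (Hom D X Y)) (HC X Y)"
  using tensor_lift_lin[OF C_module Hom_module[OF ob] HC_module[OF ob] entwining_bilinear]
  by (subst lin_hom_cong[OF tensor_is_module[OF C_module Hom_module[OF ob]]])
    (simp_all add: entwining_def ob)

lemma entwining_pure:
  assumes "c \<in> carrier C" "f \<in> carrier (Hom D X Y)"
  shows "entwining X Y (pure_tensor K C (Hom D X Y) c f) =
    precomp X Y Y f (pure_tensor K (Hom D Y Y) C (ident D Y) c)"
  using assms pure_tensor_closed[OF C_module Hom_module[OF ob] assms]
  by (simp add: entwining_def ob
      tensor_lift_pure[OF C_module Hom_module[OF ob] HC_module[OF ob] entwining_bilinear])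

lemma entwining_pure_closed:
  assumes "c \<in> carrier C" "f \<in> carrier (Hom D X Y)"
  shows "entwining X Y (pure_tensor K C (Hom D X Y) c f) \<in> carrier (HC X Y)"
  by (rule lin_hom_closed[OF entwining_lin pure_tensor_closed[OF C_module Hom_module[OF ob] assms]])

text \<open>
  The entwining recovers the whole action: write \<open>h \<otimes> c = h \<cdot> (id \<otimes> c)\<close> and use that the action
  commutes with postcomposition.
\<close>

lemma precomp_pure:
  assumes W: "W \<in> Ob D" and f: "f \<in> carrier (Hom D X Y)" and h: "h \<in> carrier (Hom D Y W)"
    and c: "c \<in> carrier C"
  shows "precomp X Y W f (pure_tensor K (Hom D Y W) C h c) =
    postcomp C X Y W h (entwining X Y (pure_tensor K C (Hom D X Y) c f))"
proof -
  have "precomp X Y W f (pure_tensor K (Hom D Y W) C h c) =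
      precomp X Y W f (postcomp C Y Y W h (pure_tensor K (Hom D Y Y) C (ident D Y) c))"
    by (simp add: postcomp_pure C_module ob W h c ident_closed comp_ident_right)
  also have "\<dots> = postcomp C X Y W h (precomp X Y Y f (pure_tensor K (Hom D Y Y) C (ident D Y) c))"
    by (rule precomp_postcomp) (simp_all add: ob W f h c pure_ident_closed)
  finally show ?thesis by (simp add: entwining_pure c f)
qed

lemma tensor_lift_entwining:
  assumes W: "W \<in> Ob D" and f: "f \<in> carrier (Hom D X Y)" and t: "t \<in> carrier (HC Y W)"
  shows "tensor_lift K (Hom D Y W) C (HC X W)
      (\<lambda>h c. postcomp C X Y W h (entwining X Y (pure_tensor K C (Hom D X Y) c f))) t =
    precomp X Y W f t"
  by (rule tensor_lift_unique[OF Hom_module[OF ob(2) W] C_module HC_module[OF ob(1) W]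
        precomp_lin[OF ob W f] _ t]) (simp add: precomp_pure W f)

end

text \<open>
  By \<open>tensor_lift_entwining\<close> the right hand side is \<open>((id \<otimes> c) \<triangleleft> g) \<triangleleft> f\<close>, and the left hand side is
  \<open>(id \<otimes> c) \<triangleleft> (g f)\<close>.
\<close>

lemma entwining_comp:
  assumes ob: "X \<in> Ob D" "Y \<in> Ob D" "Z \<in> Ob D" and c: "c \<in> carrier C"
    and f: "f \<in> carrier (Hom D X Y)" and g: "g \<in> carrier (Hom D Y Z)"
  shows "entwining X Z (pure_tensor K C (Hom D X Z) c (comp D X Y Z g f)) =
    tensor_lift K (Hom D Y Z) C (HC X Z)
      (\<lambda>g' c'. postcomp C X Y Z g' (entwining X Y (pure_tensor K C (Hom D X Y) c' f)))
      (entwining Y Z (pure_tensor K C (Hom D Y Z) c g))"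
proof -
  have "tensor_lift K (Hom D Y Z) C (HC X Z)
      (\<lambda>g' c'. postcomp C X Y Z g' (entwining X Y (pure_tensor K C (Hom D X Y) c' f)))
      (entwining Y Z (pure_tensor K C (Hom D Y Z) c g)) =
    precomp X Y Z f (entwining Y Z (pure_tensor K C (Hom D Y Z) c g))"
    by (rule tensor_lift_entwining) (simp_all add: ob f entwining_pure_closed c g)
  then show ?thesis
    by (simp add: entwining_pure precomp_comp pure_ident_closed comp_closed ob c f g)
qed

lemma entwining_ident:
  assumes "X \<in> Ob D" "c \<in> carrier C"
  shows "entwining X X (pure_tensor K C (Hom D X X) c (ident D X)) =
    pure_tensor K (Hom D X X) C (ident D X) c"
  using assms by (simp add: entwining_pure ident_closed precomp_ident pure_ident_closed)

section \<open>Compatibility of the entwining with the counit\<close>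

lemma counit_closed: "c \<in> carrier C \<Longrightarrow> counit C c \<in> carrier K"
  using lin_hom_closed[OF counit_lin] by (simp add: scalar_module_def)

abbreviation counit_map :: "'o \<Rightarrow> 'o \<Rightarrow> ('k, 'm, 'c) tensor \<Rightarrow> 'm"
  where "counit_map X Y \<equiv>
    tensor_lift K (Hom D X Y) C (Hom D X Y) (\<lambda>f c. counit C c \<odot>\<^bsub>Hom D X Y\<^esub> f)"

context
  fixes X Y :: 'o
  assumes ob: "X \<in> Ob D" "Y \<in> Ob D"
begin

interpretation H: module K "Hom D X Y" by (rule Hom_module[OF ob])

lemma counit_bilinear:
  "bilinear_map K (Hom D X Y) C (Hom D X Y) (\<lambda>f c. counit C c \<odot>\<^bsub>Hom D X Y\<^esub> f)"
proof (rule bilinear_mapI)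
  fix f assume f: "f \<in> carrier (Hom D X Y)"
  show "(\<lambda>c. counit C c \<odot>\<^bsub>Hom D X Y\<^esub> f) \<in> lin_hom K C (Hom D X Y)"
    by (rule lin_homI)
      (use f lin_hom_add[OF counit_lin] lin_hom_smult[OF counit_lin] in
        \<open>simp_all add: counit_closed scalar_module_def H.smult_l_distr H.smult_assoc1\<close>)
next
  fix c assume "c \<in> carrier C"
  then show "(\<lambda>f. counit C c \<odot>\<^bsub>Hom D X Y\<^esub> f) \<in> lin_hom K (Hom D X Y) (Hom D X Y)"
    by (intro lin_hom_scale H.module_axioms lin_hom_ident counit_closed)
qed

lemma counit_map_lin: "counit_map X Y \<in> lin_hom K (HC X Y) (Hom D X Y)"
  by (rule tensor_lift_lin[OF H.module_axioms C_module H.module_axioms counit_bilinear])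

lemma counit_map_pure:
  "f \<in> carrier (Hom D X Y) \<Longrightarrow> c \<in> carrier C \<Longrightarrow>
    counit_map X Y (pure_tensor K (Hom D X Y) C f c) = counit C c \<odot>\<^bsub>Hom D X Y\<^esub> f"
  by (rule tensor_lift_pure[OF H.module_axioms C_module H.module_axioms counit_bilinear])

lemma counit_map_rho: "f \<in> carrier (Hom D X Y) \<Longrightarrow> counit_map X Y (\<rho> X Y f) = f"
  by (rule right_comodule.coaction_counit[OF Hom_comodule[OF ob]])

end

lemma counit_map_postcomp:
  assumes ob: "X \<in> Ob D" "Y \<in> Ob D" "Z \<in> Ob D" and g: "g \<in> carrier (Hom D Y Z)"
    and t: "t \<in> carrier (HC X Y)"
  shows "counit_map X Z (postcomp C X Y Z g t) = comp D X Y Z g (counit_map X Y t)"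
  by (rule tensor_hom_eqI[OF Hom_module[OF ob(1,2)] C_module Hom_module[OF ob(1,3)]
        lin_hom_compose[OF counit_map_lin[OF ob(1,3)] postcomp_lin[OF C_module ob g]]
        lin_hom_compose[OF comp_left_lin[OF ob g] counit_map_lin[OF ob(1,2)]] _ t])
    (simp add: postcomp_pure C_module ob g comp_closed counit_map_pure
      lin_hom_smult[OF comp_left_lin[OF ob g]] counit_closed)

text \<open>
  On \<open>h \<cdot> \<rho>(g)\<close> both sides equal \<open>h g f\<close>, because the counit undoes \<open>\<rho>\<close>.
\<close>

lemma counit_map_precomp:
  assumes ob: "X \<in> Ob D" "Y \<in> Ob D" "W \<in> Ob D" and f: "f \<in> carrier (Hom D X Y)"
    and t: "t \<in> carrier (HC Y W)"
  shows "counit_map X W (precomp X Y W f t) = comp D X Y W (counit_map Y W t) f"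
proof (rule HC_hom_eqI[OF ob(2,3) Hom_module[OF ob(1,3)]
      lin_hom_compose[OF counit_map_lin[OF ob(1,3)] precomp_lin[OF ob f]]
      lin_hom_compose[OF comp_right_lin[OF ob f] counit_map_lin[OF ob(2,3)]] _ t])
  fix Z h g assume Z: "Z \<in> Ob D" and h: "h \<in> carrier (Hom D Z W)" and g: "g \<in> carrier (Hom D Y Z)"
  have "counit_map X W (postcomp C X Z W h (\<rho> X Z (comp D X Y Z g f))) = comp D X Z W h (comp D X Y Z g f)"
    using counit_map_postcomp[of X Z W h "\<rho> X Z (comp D X Y Z g f)"]
    by (simp add: ob Z h g f comp_closed rho_closed counit_map_rho)
  moreover have "counit_map Y W (postcomp C Y Z W h (\<rho> Y Z g)) = comp D Y Z W h g"
    using counit_map_postcomp[of Y Z W h "\<rho> Y Z g"]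
    by (simp add: ob Z h g rho_closed counit_map_rho)
  ultimately show "counit_map X W (precomp X Y W f (postcomp C Y Z W h (\<rho> Y Z g))) =
      comp D X Y W (counit_map Y W (postcomp C Y Z W h (\<rho> Y Z g))) f"
    by (simp add: precomp_postcomp_rho ob Z h g f comp_assoc)
qed

lemma entwining_counit:
  assumes ob: "X \<in> Ob D" "Y \<in> Ob D" and c: "c \<in> carrier C" and f: "f \<in> carrier (Hom D X Y)"
  shows "counit_map X Y (entwining X Y (pure_tensor K C (Hom D X Y) c f)) = counit C c \<odot>\<^bsub>Hom D X Y\<^esub> f"
  using lin_hom_smult[OF comp_right_lin[OF ob ob(2) f] counit_closed[OF c] ident_closed[OF ob(2)]]
  by (simp add: entwining_pure counit_map_precomp counit_map_pure pure_ident_closed ident_closed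
      comp_ident_left ob c f)

section \<open>Compatibility of the entwining with the comultiplication\<close>

abbreviation HCC :: "'o \<Rightarrow> 'o \<Rightarrow> ('k, ('k, 'm, ('k, 'c, 'c) tensor) tensor) module"
  where "HCC X Y \<equiv> tensor K (Hom D X Y) (tensor K C C)"

abbreviation HC_C :: "'o \<Rightarrow> 'o \<Rightarrow> ('k, ('k, ('k, 'm, 'c) tensor, 'c) tensor) module"
  where "HC_C X Y \<equiv> tensor K (HC X Y) C"

abbreviation assoc :: "'o \<Rightarrow> 'o \<Rightarrow> ('k, ('k, 'm, 'c) tensor, 'c) tensor \<Rightarrow> ('k, 'm, ('k, 'c, 'c) tensor) tensor"
  where "assoc X Y \<equiv> tensor_assoc K (Hom D X Y) C C"

abbreviation comult_map :: "'o \<Rightarrow> 'o \<Rightarrow> ('k, 'm, 'c) tensor \<Rightarrow> ('k, 'm, ('k, 'c, 'c) tensor) tensor"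
  where "comult_map X Y \<equiv> tensor_map K (Hom D X Y) C (Hom D X Y) (tensor K C C) (\<lambda>f. f) (comult C)"

abbreviation coact_map :: "'o \<Rightarrow> 'o \<Rightarrow> ('k, 'm, 'c) tensor \<Rightarrow> ('k, ('k, 'm, 'c) tensor, 'c) tensor"
  where "coact_map X Y \<equiv> tensor_map K (Hom D X Y) C (HC X Y) C (\<rho> X Y) (\<lambda>c. c)"

lemma comult_closed: "c \<in> carrier C \<Longrightarrow> comult C c \<in> carrier (tensor K C C)"
  using lin_hom_closed[OF comult_lin] .

context
  fixes X Y :: 'o
  assumes ob: "X \<in> Ob D" "Y \<in> Ob D"
begin

lemma HCC_module: "module K (HCC X Y)"
  by (intro tensor_is_module Hom_module ob C_module)

lemma comult_map_lin: "comult_map X Y \<in> lin_hom K (HC X Y) (HCC X Y)"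
  by (intro tensor_map_lin Hom_module ob C_module CC_module lin_hom_ident comult_lin)

lemma comult_map_pure:
  "f \<in> carrier (Hom D X Y) \<Longrightarrow> c \<in> carrier C \<Longrightarrow>
    comult_map X Y (pure_tensor K (Hom D X Y) C f c) =
    pure_tensor K (Hom D X Y) (tensor K C C) f (comult C c)"
  by (intro tensor_map_pure Hom_module ob C_module CC_module lin_hom_ident comult_lin)

lemma coact_map_lin: "coact_map X Y \<in> lin_hom K (HC X Y) (HC_C X Y)"
  by (intro tensor_map_lin Hom_module ob C_module HC_module lin_hom_ident rho_lin)

lemma coact_map_pure:
  "f \<in> carrier (Hom D X Y) \<Longrightarrow> c \<in> carrier C \<Longrightarrow>
    coact_map X Y (pure_tensor K (Hom D X Y) C f c) = pure_tensor K (HC X Y) C (\<rho> X Y f) c"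
  by (intro tensor_map_pure Hom_module ob C_module HC_module lin_hom_ident rho_lin)

lemma assoc_lin: "assoc X Y \<in> lin_hom K (HC_C X Y) (HCC X Y)"
  by (intro tensor_assoc_lin Hom_module ob C_module)

lemma assoc_pure_bilinear:
  "bilinear_map K (HC X Y) C (HCC X Y) (\<lambda>s d. assoc X Y (pure_tensor K (HC X Y) C s d))"
  by (rule bilinear_map_compose[OF pure_tensor_bilinear[OF HC_module[OF ob] C_module]
        lin_hom_ident lin_hom_ident assoc_lin])

lemma rho_coassoc:
  "f \<in> carrier (Hom D X Y) \<Longrightarrow> assoc X Y (coact_map X Y (\<rho> X Y f)) = comult_map X Y (\<rho> X Y f)"
  by (rule right_comodule.coaction_coassoc[OF Hom_comodule[OF ob]])

end

lemma comult_map_postcomp: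
  assumes ob: "X \<in> Ob D" "Y \<in> Ob D" "Z \<in> Ob D" and g: "g \<in> carrier (Hom D Y Z)"
    and t: "t \<in> carrier (HC X Y)"
  shows "comult_map X Z (postcomp C X Y Z g t) = postcomp (tensor K C C) X Y Z g (comult_map X Y t)"
  by (rule tensor_hom_eqI[OF Hom_module[OF ob(1,2)] C_module HCC_module[OF ob(1,3)]
        lin_hom_compose[OF comult_map_lin[OF ob(1,3)] postcomp_lin[OF C_module ob g]]
        lin_hom_compose[OF postcomp_lin[OF CC_module ob g] comult_map_lin[OF ob(1,2)]] _ t])
    (simp add: postcomp_pure C_module CC_module ob g comp_closed comult_map_pure comult_closed)

lemma assoc_postcomp:
  assumes ob: "X \<in> Ob D" "Y \<in> Ob D" "Z \<in> Ob D" and g: "g \<in> carrier (Hom D Y Z)"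
    and s: "s \<in> carrier (HC X Y)" and d: "d \<in> carrier C"
  shows "assoc X Z (pure_tensor K (HC X Z) C (postcomp C X Y Z g s) d) =
    postcomp (tensor K C C) X Y Z g (assoc X Y (pure_tensor K (HC X Y) C s d))"
  by (rule tensor_hom_eqI[OF Hom_module[OF ob(1,2)] C_module HCC_module[OF ob(1,3)]
        lin_hom_compose[OF bilinear_map_left[OF assoc_pure_bilinear[OF ob(1,3)] d] postcomp_lin[OF C_module ob g]]
        lin_hom_compose[OF postcomp_lin[OF CC_module ob g] bilinear_map_left[OF assoc_pure_bilinear[OF ob(1,2)] d]]
        _ s])
    (simp add: postcomp_pure C_module CC_module Hom_module ob g d comp_closed tensor_assoc_pure pure_tensor_closed)

text \<open>
  The bilinear pairing \<open>(s, f \<otimes> d) \<mapsto> (s \<triangleleft> f) \<otimes> d\<close> of \<open>Hom(Y, W) \<otimes> C\<close> with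
  \<open>Hom(X, Y) \<otimes> C\<close>, reassociated. It lets a twofold application of the entwining be computed in two
  ways: at \<open>s = k \<otimes> c\<close> it produces \<open>\<psi>\<close> a second time (\<open>precomp2_assoc\<close>), at \<open>s = \<rho>(k)\<close> it produces
  \<open>\<rho>\<close> of a composite (\<open>precomp_tensor_rho\<close>).
\<close>

abbreviation precomp_tensor :: "'o \<Rightarrow> 'o \<Rightarrow> 'o \<Rightarrow> ('k, 'm, 'c) tensor \<Rightarrow> ('k, 'm, 'c) tensor \<Rightarrow> ('k, 'm, ('k, 'c, 'c) tensor) tensor"
  where "precomp_tensor X Y W s \<equiv> tensor_lift K (Hom D X Y) C (HCC X W)
    (\<lambda>f d. assoc X W (pure_tensor K (HC X W) C (precomp X Y W f s) d))"

context
  fixes X Y W :: 'o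
  assumes ob: "X \<in> Ob D" "Y \<in> Ob D" "W \<in> Ob D"
begin

lemma precomp_tensor_summand_bilinear:
  "s \<in> carrier (HC Y W) \<Longrightarrow> bilinear_map K (Hom D X Y) C (HCC X W)
    (\<lambda>f d. assoc X W (pure_tensor K (HC X W) C (precomp X Y W f s) d))"
  by (rule bilinear_map_compose[OF assoc_pure_bilinear[OF ob(1,3)]
        bilinear_map_left[OF precomp_bilinear[OF ob]] lin_hom_ident lin_hom_ident])

lemma precomp_tensor_bilinear:
  "bilinear_map K (HC Y W) (HC X Y) (HCC X W) (precomp_tensor X Y W)"
proof (intro bilinear_map_parameter_lift Hom_module C_module HC_module HCC_module ob precomp_tensor_summand_bilinear)
  fix f d assume f: "f \<in> carrier (Hom D X Y)" and d: "d \<in> carrier C"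
  show "(\<lambda>s. assoc X W (pure_tensor K (HC X W) C (precomp X Y W f s) d)) \<in> lin_hom K (HC Y W) (HCC X W)"
    by (rule lin_hom_compose[OF bilinear_map_left[OF assoc_pure_bilinear[OF ob(1,3)] d] precomp_lin[OF ob f]])
qed

lemma precomp_tensor_pure:
  "\<lbrakk>s \<in> carrier (HC Y W); f \<in> carrier (Hom D X Y); d \<in> carrier C\<rbrakk> \<Longrightarrow>
    precomp_tensor X Y W s (pure_tensor K (Hom D X Y) C f d) =
    assoc X W (pure_tensor K (HC X W) C (precomp X Y W f s) d)"
  by (rule tensor_lift_pure[OF Hom_module[OF ob(1,2)] C_module HCC_module[OF ob(1,3)] precomp_tensor_summand_bilinear])

text \<open>
  On \<open>f \<otimes> d\<close> both sides are \<open>\<rho>(k f) \<otimes> d\<close>.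
\<close>

lemma precomp_tensor_rho:
  assumes k: "k \<in> carrier (Hom D Y W)" and u: "u \<in> carrier (HC X Y)"
  shows "precomp_tensor X Y W (\<rho> Y W k) u = assoc X W (coact_map X W (postcomp C X Y W k u))"
  by (rule tensor_hom_eqI[OF Hom_module[OF ob(1,2)] C_module HCC_module[OF ob(1,3)]
        bilinear_map_right[OF precomp_tensor_bilinear rho_closed[OF ob(2,3) k]]
        lin_hom_compose[OF assoc_lin[OF ob(1,3)] lin_hom_compose[OF coact_map_lin[OF ob(1,3)]
          postcomp_lin[OF C_module ob k]]] _ u])
    (simp add: precomp_tensor_pure rho_closed ob k postcomp_pure C_module coact_map_pure comp_closed precomp_rho)

end

lemma precomp_tensor_postcomp:
  assumes ob: "X \<in> Ob D" "Y \<in> Ob D" "W \<in> Ob D" "V \<in> Ob D" and k: "k \<in> carrier (Hom D W V)"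
    and s: "s \<in> carrier (HC Y W)" and u: "u \<in> carrier (HC X Y)"
  shows "precomp_tensor X Y V (postcomp C Y W V k s) u = postcomp (tensor K C C) X W V k (precomp_tensor X Y W s u)"
  by (rule tensor_hom_eqI[OF Hom_module[OF ob(1,2)] C_module HCC_module[OF ob(1,4)]
        bilinear_map_right[OF precomp_tensor_bilinear[OF ob(1,2,4)] postcomp_closed[OF C_module ob(2-4) k s]]
        lin_hom_compose[OF postcomp_lin[OF CC_module ob(1,3,4) k]
          bilinear_map_right[OF precomp_tensor_bilinear[OF ob(1-3)] s]] _ u])
    (simp add: precomp_tensor_pure ob k s postcomp_closed C_module precomp_postcomp precomp_closed assoc_postcomp)

context
  fixes X Y :: 'o and f :: 'm
  assumes ob: "X \<in> Ob D" "Y \<in> Ob D" and f: "f \<in> carrier (Hom D X Y)"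
begin

private abbreviation "ent c \<equiv> entwining X Y (pure_tensor K C (Hom D X Y) c f)"
text \<open>
  \<open>psi2\<close> is \<open>c\<^sub>1 \<otimes> c\<^sub>2 \<mapsto> (f\<^sub>\<psi>)\<^sub>\<psi>\<^sub>' \<otimes> c\<^sub>1\<^sup>\<psi>\<^sup>' \<otimes> c\<^sub>2\<^sup>\<psi>\<close>, with the inner \<open>\<psi>'\<close> written as
  \<open>(id \<otimes> c\<^sub>1) \<triangleleft> -\<close>; \<open>precomp2\<close> is the resulting action of \<open>f\<close> on \<open>Hom(Y, W) \<otimes> (C \<otimes> C)\<close>.
  Compatibility with the comultiplication amounts to \<open>id \<otimes> \<Delta>\<close> intertwining the action of \<open>f\<close> on
  \<open>Hom(Y, W) \<otimes> C\<close> with this one (\<open>comult_map_precomp\<close>).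
\<close>

private abbreviation "psi2 \<equiv> tensor_lift K C C (HCC X Y)
  (\<lambda>c1 c2. precomp_tensor X Y Y (pure_tensor K (Hom D Y Y) C (ident D Y) c1) (ent c2))"
private abbreviation "precomp2 W \<equiv> tensor_lift K (Hom D Y W) (tensor K C C) (HCC X W)
  (\<lambda>k w. postcomp (tensor K C C) X Y W k (psi2 w))"

lemma entwining_left_lin: "(\<lambda>c. ent c) \<in> lin_hom K C (HC X Y)"
  by (rule lin_hom_compose[OF entwining_lin[OF ob]
      bilinear_map_left[OF pure_tensor_bilinear[OF C_module Hom_module[OF ob]] f]])

lemma psi2_bilinear: "bilinear_map K C C (HCC X Y)
    (\<lambda>c1 c2. precomp_tensor X Y Y (pure_tensor K (Hom D Y Y) C (ident D Y) c1) (ent c2))"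
  by (rule bilinear_map_compose[OF precomp_tensor_bilinear[OF ob ob(2)] pure_ident_lin[OF ob(2)] entwining_left_lin lin_hom_ident])

lemma psi2_lin: "psi2 \<in> lin_hom K (tensor K C C) (HCC X Y)"
  by (rule tensor_lift_lin[OF C_module C_module HCC_module[OF ob] psi2_bilinear])

context
  fixes W :: 'o
  assumes W: "W \<in> Ob D"
begin

lemma precomp2_bilinear: "bilinear_map K (Hom D Y W) (tensor K C C) (HCC X W)
    (\<lambda>k w. postcomp (tensor K C C) X Y W k (psi2 w))"
  by (rule bilinear_map_compose[OF postcomp_bilinear[OF CC_module ob W] lin_hom_ident psi2_lin lin_hom_ident])

lemma precomp2_lin: "precomp2 W \<in> lin_hom K (HCC Y W) (HCC X W)"
  by (rule tensor_lift_lin[OF Hom_module[OF ob(2) W] CC_module HCC_module[OF ob(1) W] precomp2_bilinear])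

lemma precomp2_pure: "k \<in> carrier (Hom D Y W) \<Longrightarrow> w \<in> carrier (tensor K C C) \<Longrightarrow>
    precomp2 W (pure_tensor K (Hom D Y W) (tensor K C C) k w) = postcomp (tensor K C C) X Y W k (psi2 w)"
  by (rule tensor_lift_pure[OF Hom_module[OF ob(2) W] CC_module HCC_module[OF ob(1) W] precomp2_bilinear])

lemma precomp2_assoc:
  assumes s: "s \<in> carrier (HC Y W)" and d: "d \<in> carrier C"
  shows "precomp2 W (assoc Y W (pure_tensor K (HC Y W) C s d)) = precomp_tensor X Y W s (ent d)"
proof (rule tensor_hom_eqI[OF Hom_module[OF ob(2) W] C_module HCC_module[OF ob(1) W]
      lin_hom_compose[OF precomp2_lin bilinear_map_left[OF assoc_pure_bilinear[OF ob(2) W] d]]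
      bilinear_map_left[OF precomp_tensor_bilinear[OF ob W] lin_hom_closed[OF entwining_left_lin d]] _ s])
  fix k c assume k: "k \<in> carrier (Hom D Y W)" and c: "c \<in> carrier C"
  have "precomp2 W (assoc Y W (pure_tensor K (HC Y W) C (pure_tensor K (Hom D Y W) C k c) d)) =
      postcomp (tensor K C C) X Y W k (psi2 (pure_tensor K C C c d))"
    by (simp add: tensor_assoc_pure Hom_module C_module ob W k c d precomp2_pure pure_tensor_closed)
  also have "\<dots> = postcomp (tensor K C C) X Y W k
      (precomp_tensor X Y Y (pure_tensor K (Hom D Y Y) C (ident D Y) c) (ent d))"
    by (simp add: tensor_lift_pure[OF C_module C_module HCC_module[OF ob] psi2_bilinear] c d)
  also have "\<dots> = precomp_tensor X Y W (postcomp C Y Y W k (pure_tensor K (Hom D Y Y) C (ident D Y) c)) (ent d)"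
    by (simp add: precomp_tensor_postcomp ob W k pure_ident_closed c lin_hom_closed[OF entwining_left_lin d])
  also have "\<dots> = precomp_tensor X Y W (pure_tensor K (Hom D Y W) C k c) (ent d)"
    by (simp add: postcomp_pure C_module ob W k c ident_closed comp_ident_right)
  finally show "precomp2 W (assoc Y W (pure_tensor K (HC Y W) C (pure_tensor K (Hom D Y W) C k c) d)) =
      precomp_tensor X Y W (pure_tensor K (Hom D Y W) C k c) (ent d)" .
qed

text \<open>
  The action on \<open>Hom(Y, W) \<otimes> (C \<otimes> C)\<close> is intertwined with the one on \<open>Hom(Y, W) \<otimes> C\<close> by
  \<open>\<rho> \<otimes> id\<close>: on \<open>k \<otimes> c\<close> both sides are \<open>\<rho>(k f\<^sub>\<psi>) \<otimes> c\<^sup>\<psi>\<close>, reassociated.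
\<close>

lemma precomp2_coact:
  assumes t: "t \<in> carrier (HC Y W)"
  shows "precomp2 W (assoc Y W (coact_map Y W t)) = assoc X W (coact_map X W (precomp X Y W f t))"
  by (rule tensor_hom_eqI[OF Hom_module[OF ob(2) W] C_module HCC_module[OF ob(1) W]
        lin_hom_compose[OF precomp2_lin lin_hom_compose[OF assoc_lin[OF ob(2) W] coact_map_lin[OF ob(2) W]]]
        lin_hom_compose[OF assoc_lin[OF ob(1) W] lin_hom_compose[OF coact_map_lin[OF ob(1) W]
          precomp_lin[OF ob W f]]] _ t])
    (simp add: coact_map_pure ob W precomp2_assoc rho_closed precomp_tensor_rho lin_hom_closed[OF entwining_left_lin] precomp_pure f)

text \<open>
  Coassociativity turns \<open>\<rho> \<otimes> id\<close> into \<open>id \<otimes> \<Delta>\<close> on the elements \<open>\<rho>(g)\<close> and \<open>\<rho>(g f)\<close>, though not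
  on general elements of \<open>Hom(Y, W) \<otimes> C\<close>.
\<close>

lemma precomp2_rho:
  assumes g: "g \<in> carrier (Hom D Y W)"
  shows "precomp2 W (comult_map Y W (\<rho> Y W g)) = comult_map X W (\<rho> X W (comp D X Y W g f))"
  using precomp2_coact[OF rho_closed[OF ob(2) W g]]
  by (simp add: rho_coassoc precomp_rho comp_closed ob W f g)

end

lemma precomp2_postcomp:
  assumes Z: "Z \<in> Ob D" and W: "W \<in> Ob D" and h: "h \<in> carrier (Hom D Z W)"
    and z: "z \<in> carrier (HCC Y Z)"
  shows "precomp2 W (postcomp (tensor K C C) Y Z W h z) = postcomp (tensor K C C) X Z W h (precomp2 Z z)"
  by (rule tensor_hom_eqI[OF Hom_module[OF ob(2) Z] CC_module HCC_module[OF ob(1) W]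
        lin_hom_compose[OF precomp2_lin[OF W] postcomp_lin[OF CC_module ob(2) Z W h]]
        lin_hom_compose[OF postcomp_lin[OF CC_module ob(1) Z W h] precomp2_lin[OF Z]] _ z])
    (simp add: postcomp_pure CC_module ob Z W h precomp2_pure comp_closed postcomp_comp lin_hom_closed[OF psi2_lin])

text \<open>
  Both sides commute with postcomposition, so \<open>precomp2_rho\<close> extends from \<open>\<rho>(g)\<close> to
  \<open>h \<cdot> \<rho>(g)\<close>, and these span.
\<close>

lemma comult_map_precomp:
  assumes W: "W \<in> Ob D" and t: "t \<in> carrier (HC Y W)"
  shows "comult_map X W (precomp X Y W f t) = precomp2 W (comult_map Y W t)"
proof (rule HC_hom_eqI[OF ob(2) W HCC_module[OF ob(1) W]
      lin_hom_compose[OF comult_map_lin[OF ob(1) W] precomp_lin[OF ob W f]]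
      lin_hom_compose[OF precomp2_lin[OF W] comult_map_lin[OF ob(2) W]] _ t])
  fix Z h g assume Z: "Z \<in> Ob D" and h: "h \<in> carrier (Hom D Z W)" and g: "g \<in> carrier (Hom D Y Z)"
  show "comult_map X W (precomp X Y W f (postcomp C Y Z W h (\<rho> Y Z g))) =
      precomp2 W (comult_map Y W (postcomp C Y Z W h (\<rho> Y Z g)))"
    by (simp add: precomp_postcomp_rho ob W Z h g f comult_map_postcomp rho_closed comp_closed
        precomp2_postcomp precomp2_rho lin_hom_closed[OF comult_map_lin])
qed

text \<open>
  The value of \<open>comult_map_precomp\<close> at \<open>id \<otimes> c\<close>.
\<close>

lemma entwining_comult:
  assumes c: "c \<in> carrier C"
  shows "comult_map X Y (ent c) =
    tensor_lift K C C (HCC X Y)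
      (\<lambda>c1 c2. tensor_lift K (Hom D X Y) C (HCC X Y)
        (\<lambda>f' c2'. assoc X Y (pure_tensor K (HC X Y) C
          (entwining X Y (pure_tensor K C (Hom D X Y) c1 f')) c2'))
        (ent c2))
      (comult C c)"
proof -
  have "comult_map X Y (ent c) =
      precomp2 Y (comult_map Y Y (pure_tensor K (Hom D Y Y) C (ident D Y) c))"
    by (simp add: entwining_pure ob c f comult_map_precomp pure_ident_closed)
  also have "\<dots> = postcomp (tensor K C C) X Y Y (ident D Y) (psi2 (comult C c))"
    by (simp add: comult_map_pure ob ident_closed c precomp2_pure comult_closed)
  also have "\<dots> = psi2 (comult C c)"
    by (rule postcomp_ident[OF CC_module ob lin_hom_closed[OF psi2_lin comult_closed[OF c]]])
  also have "\<dots> = tensor_lift K C C (HCC X Y)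
      (\<lambda>c1 c2. tensor_lift K (Hom D X Y) C (HCC X Y)
        (\<lambda>f' c2'. assoc X Y (pure_tensor K (HC X Y) C
          (entwining X Y (pure_tensor K C (Hom D X Y) c1 f')) c2'))
        (ent c2))
      (comult C c)"
  proof (rule tensor_lift_unique[OF C_module C_module HCC_module[OF ob] psi2_lin _ comult_closed[OF c], symmetric])
    fix c1 c2 assume c12: "c1 \<in> carrier C" "c2 \<in> carrier C"
    have "tensor_lift K (Hom D X Y) C (HCC X Y)
        (\<lambda>f' c2'. assoc X Y (pure_tensor K (HC X Y) C
          (entwining X Y (pure_tensor K C (Hom D X Y) c1 f')) c2')) (ent c2) =
        precomp_tensor X Y Y (pure_tensor K (Hom D Y Y) C (ident D Y) c1) (ent c2)"
      by (rule tensor_lift_unique[OF Hom_module[OF ob] C_module HCC_module[OF ob]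
            bilinear_map_right[OF precomp_tensor_bilinear[OF ob ob(2)] pure_ident_closed[OF ob(2) c12(1)]] _
            lin_hom_closed[OF entwining_left_lin c12(2)]])
        (simp add: precomp_tensor_pure ob pure_ident_closed entwining_pure c12)
    then show "psi2 (pure_tensor K C C c1 c2) = tensor_lift K (Hom D X Y) C (HCC X Y)
        (\<lambda>f' c2'. assoc X Y (pure_tensor K (HC X Y) C
          (entwining X Y (pure_tensor K C (Hom D X Y) c1 f')) c2')) (ent c2)"
      by (simp add: tensor_lift_pure[OF C_module C_module HCC_module[OF ob] psi2_bilinear] c12)
  qed
  finally show ?thesis .
qed

end

section \<open>Existence and uniqueness\<close>

lemma entwining_is_entwining_structure: "entwining_structure K D C entwining"
proof (intro entwining_structure.intro entwining_structure_axioms.intro)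
  show "linear_category K D" "coalgebra K C"
    by (rule linear_category_axioms, rule coalgebra_axioms)
  show "entwining \<in> (\<Pi>\<^sub>E X\<in>Ob D. \<Pi>\<^sub>E Y\<in>Ob D.
      lin_hom K (tensor K C (Hom D X Y)) (HC X Y) \<inter> extensional (carrier (tensor K C (Hom D X Y))))"
  proof (intro PiE_I IntI)
    fix X Y assume "X \<in> Ob D" "Y \<in> Ob D"
    then show "entwining X Y \<in> lin_hom K (tensor K C (Hom D X Y)) (HC X Y)"
      "entwining X Y \<in> extensional (carrier (tensor K C (Hom D X Y)))"
      by (rule entwining_lin, simp add: entwining_def)
  qed (simp_all add: entwining_def)
qed (rule entwining_comp entwining_counit entwining_comult entwining_ident; assumption)+

lemma right_hom_comodule_simps:
  "mod_obj (right_hom_comodule D \<rho> Y) X = Hom D X Y"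
  "mod_map (right_hom_comodule D \<rho> Y) X Z f = (\<lambda>g. comp D Z X Y g f)"
  "coact (right_hom_comodule D \<rho> Y) X = \<rho> X Y"
  by (simp_all add: right_hom_comodule_def right_hom_def cat_module.extend_def)

lemma right_hom_left_opposite_module:
  assumes Y: "Y \<in> Ob D"
  shows "left_cat_module K (opposite D) (right_hom_comodule D \<rho> Y)"
  by (rule left_cat_module.intro)
    (auto simp: opposite_def right_hom_comodule_simps Y Hom_module comp_ident_right comp_assoc
      comp_left_lin comp_right_lin)

text \<open>
  Module and comodule axioms hold for every representable right module; only the entwined condition
  depends on \<open>\<psi>\<close>.
\<close>

lemma entwined_module_right_hom_iff:
  assumes Y: "Y \<in> Ob D"
  shows "entwined_module K D C \<psi> (right_hom_comodule D \<rho> Y) \<longleftrightarrow>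
    (\<forall>X\<in>Ob D. \<forall>Z\<in>Ob D. \<forall>f\<in>carrier (Hom D Z X). \<forall>g\<in>carrier (Hom D X Y).
      \<rho> Z Y (comp D Z X Y g f) =
      tensor_lift K (Hom D X Y) C (HC Z Y)
        (\<lambda>h c. postcomp C Z X Y h (\<psi> Z X (pure_tensor K C (Hom D Z X) c f))) (\<rho> X Y g))"
proof -
  have "entwined_module K D C \<psi> (right_hom_comodule D \<rho> Y) \<longleftrightarrow>
      entwined_module_axioms K D C \<psi> (right_hom_comodule D \<rho> Y)"
    using right_hom_left_opposite_module[OF Y] by (simp add: entwined_module_def)
  then show ?thesis
    using Hom_comodule[OF _ Y]
    by (auto simp: entwined_module_axioms_def right_hom_comodule_simps tensor_map_def)
qed

lemma entwined_module_entwining: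
  "Y \<in> Ob D \<Longrightarrow> entwined_module K D C entwining (right_hom_comodule D \<rho> Y)"
  by (simp add: entwined_module_right_hom_iff tensor_lift_entwining rho_closed precomp_rho)

text \<open>
  Any \<open>\<psi>\<close> as in the statement defines an action \<open>h \<otimes> c \<mapsto> h \<cdot> \<psi>(c \<otimes> f)\<close> satisfying the formula that
  characterizes \<open>precomp\<close>, and \<open>\<psi>(c \<otimes> f)\<close> is its value at \<open>id \<otimes> c\<close>. Extensionality of both families
  turns agreement on pure tensors into equality.
\<close>

lemma entwining_unique:
  assumes \<psi>: "entwining_structure K D C \<psi>"
    and entwined: "\<And>Y. Y \<in> Ob D \<Longrightarrow> entwined_module K D C \<psi> (right_hom_comodule D \<rho> Y)"
  shows "\<psi> = entwining"
proof -
  have \<psi>_mem: "f \<in> (\<Pi>\<^sub>E X\<in>Ob D. \<Pi>\<^sub>E Y\<in>Ob D.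
      lin_hom K (tensor K C (Hom D X Y)) (HC X Y) \<inter> extensional (carrier (tensor K C (Hom D X Y))))"
    if "entwining_structure K D C f" for f
    using entwining_structure.psi_lin[OF that] .
  note \<psi>_PiE = \<psi>_mem[OF \<psi>] and ent_PiE = \<psi>_mem[OF entwining_is_entwining_structure]
  have eq: "\<psi> X Y t = entwining X Y t"
    if ob: "X \<in> Ob D" "Y \<in> Ob D" and t: "t \<in> carrier (tensor K C (Hom D X Y))" for X Y t
  proof (rule tensor_hom_eqI[OF C_module Hom_module[OF ob] HC_module[OF ob] _ entwining_lin[OF ob] _ t])
    show \<psi>_lin: "\<psi> X Y \<in> lin_hom K (tensor K C (Hom D X Y)) (HC X Y)"
      using PiE_mem[OF PiE_mem[OF \<psi>_PiE ob(1)] ob(2)] by blast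
    fix c f assume c: "c \<in> carrier C" and f: "f \<in> carrier (Hom D X Y)"
    have \<psi>f: "(\<lambda>c. \<psi> X Y (pure_tensor K C (Hom D X Y) c f)) \<in> lin_hom K C (HC X Y)"
      by (rule lin_hom_compose[OF \<psi>_lin
            bilinear_map_left[OF pure_tensor_bilinear[OF C_module Hom_module[OF ob]] f]])
    define A where "A W = tensor_lift K (Hom D Y W) C (HC X W)
      (\<lambda>h c. postcomp C X Y W h (\<psi> X Y (pure_tensor K C (Hom D X Y) c f)))" for W
    have b: "bilinear_map K (Hom D Y W) C (HC X W)
        (\<lambda>h c. postcomp C X Y W h (\<psi> X Y (pure_tensor K C (Hom D X Y) c f)))" if W: "W \<in> Ob D" for W
      by (rule bilinear_map_compose[OF postcomp_bilinear[OF C_module ob W] lin_hom_ident \<psi>f lin_hom_ident])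
    have A_lin: "A W \<in> lin_hom K (HC Y W) (HC X W)" if W: "W \<in> Ob D" for W
      unfolding A_def
      by (rule tensor_lift_lin[OF Hom_module[OF ob(2) W] C_module HC_module[OF ob(1) W] b[OF W]])
    have A_pure: "A W (pure_tensor K (Hom D Y W) C h c) =
        postcomp C X Y W h (\<psi> X Y (pure_tensor K C (Hom D X Y) c f))"
      if W: "W \<in> Ob D" and "h \<in> carrier (Hom D Y W)" "c \<in> carrier C" for W h c
      unfolding A_def
      by (rule tensor_lift_pure[OF Hom_module[OF ob(2) W] C_module HC_module[OF ob(1) W] b[OF W]]) fact+
    have A_rho: "A W (\<rho> Y W g) = \<rho> X W (comp D X Y W g f)"
      if "W \<in> Ob D" "g \<in> carrier (Hom D Y W)" for W g
      using entwined[OF that(1)] ob f that by (simp add: entwined_module_right_hom_iff A_def)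
    have A_postcomp: "A W (postcomp C Y Z W h t) = postcomp C X Z W h (A Z t)"
      if Z: "Z \<in> Ob D" and W: "W \<in> Ob D" and h: "h \<in> carrier (Hom D Z W)" and t: "t \<in> carrier (HC Y Z)"
      for Z W h t
      by (rule tensor_hom_eqI[OF Hom_module[OF ob(2) Z] C_module HC_module[OF ob(1) W]
            lin_hom_compose[OF A_lin[OF W] postcomp_lin[OF C_module ob(2) Z W h]]
            lin_hom_compose[OF postcomp_lin[OF C_module ob(1) Z W h] A_lin[OF Z]] _ t])
        (simp add: postcomp_pure C_module ob Z W h A_pure comp_closed postcomp_comp lin_hom_closed[OF \<psi>f])
    have "entwining X Y (pure_tensor K C (Hom D X Y) c f) =
        A Y (pure_tensor K (Hom D Y Y) C (ident D Y) c)"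
      unfolding entwining_pure[OF ob c f]
      by (rule precomp_unique[OF ob ob(2) f A_lin[OF ob(2)] _ pure_ident_closed[OF ob(2) c]])
        (simp add: A_postcomp A_rho ob rho_closed)
    also have "\<dots> = \<psi> X Y (pure_tensor K C (Hom D X Y) c f)"
      by (simp add: A_pure ob ident_closed c postcomp_ident C_module lin_hom_closed[OF \<psi>f])
    finally show "\<psi> X Y (pure_tensor K C (Hom D X Y) c f) = entwining X Y (pure_tensor K C (Hom D X Y) c f)" ..
  qed
  show ?thesis
  proof (rule PiE_ext[OF \<psi>_PiE ent_PiE])
    fix X assume X: "X \<in> Ob D"
    show "\<psi> X = entwining X"
    proof (rule PiE_ext[OF PiE_mem[OF \<psi>_PiE X] PiE_mem[OF ent_PiE X]])
      fix Y assume Y: "Y \<in> Ob D"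
      show "\<psi> X Y = entwining X Y"
        by (rule extensionalityI[OF IntD2[OF PiE_mem[OF PiE_mem[OF \<psi>_PiE X] Y]]
              IntD2[OF PiE_mem[OF PiE_mem[OF ent_PiE X] Y]] eq[OF X Y]])
    qed
  qed
qed

end

theorem theorem4:
  fixes K :: "('k, 'r) ring_scheme"
    and D :: "('k, 'o, 'm) lin_cat"
    and C :: "('k, 'c, 'x) coalgebra_scheme"
    and \<rho> :: "'o \<Rightarrow> 'o \<Rightarrow> 'm \<Rightarrow> ('k, 'm, 'c) tensor"
    and E :: "'o \<Rightarrow> 'o \<Rightarrow> 'm set"
  assumes "field K"
    and "linear_category K D"
    and "coalgebra K C"
    and "\<And>X Y. X \<in> Ob D \<Longrightarrow> Y \<in> Ob D \<Longrightarrow> right_comodule K C (Hom D X Y) (\<rho> X Y)"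
    and "galois_extension K D C \<rho> E"
  shows "\<exists>!\<psi>. entwining_structure K D C \<psi> \<and>
    (\<forall>Y\<in>Ob D. entwined_module K D C \<psi> (right_hom_comodule D \<rho> Y))"
proof -
  interpret galois_comodule_category K D C \<rho> E
    by (intro galois_comodule_category.intro comodule_category.intro comodule_category_axioms.intro
        galois_comodule_category_axioms.intro assms)
  show ?thesis
    using entwining_is_entwining_structure entwined_module_entwining entwining_unique
    by (intro ex1I[of _ entwining]) blast+
qed

end
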